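(* Let $d\ge 1$ and $N\ge 2$ be integers and let $u\in H^1(\mathbb R^{dN})$ be anti-symmetric. Then $$\sum_{j=1}^N\int_{\mathbb R^{dN}}|\nabla_{x_j}u|^2\,dx\ \ge\ \frac{d^2}{N}\sum_{1\le i<j\le N}\int_{\mathbb R^{dN}}\frac{|u|^2}{r_{ij}^2}\,dx.$$
   Context: Points of $\mathbb R^{dN}$ are written $x=(x_1,\dots,x_N)$ with $x_j\in\mathbb R^d$; $r_{ij}=|x_i-x_j|$; $\nabla_{x_j}$ is the gradient in the variable $x_j\in\mathbb R^d$. A function $u$ on $\mathbb R^{dN}$ is anti-symmetric if $u(x_1,\dots,x_i,\dots,x_j,\dots,x_N)=-u(x_1,\dots,x_j,\dots,x_i,\dots,x_N)$ for all pairs $i\neq j$ (i.e. it changes sign when the $i$-th and $j$-th particles $x_i,x_j\in\mathbb R^d$ are exchanged). *)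

theory Defs
  imports "HOL-Analysis.Analysis"
begin

section \<open>Weak derivatives and the Sobolev space of order one\<close>

primrec Ck :: "nat \<Rightarrow> ('a::euclidean_space \<Rightarrow> real) \<Rightarrow> bool" where
  "Ck 0 f \<longleftrightarrow> continuous_on UNIV f"
| "Ck (Suc k) f \<longleftrightarrow> (\<forall>x. f differentiable (at x)) \<and>
     (\<forall>b\<in>Basis. Ck k (\<lambda>x. frechet_derivative f (at x) b))"

definition test_functions :: "('a::euclidean_space \<Rightarrow> real) set" where
  "test_functions = {\<phi>. (\<forall>k. Ck k \<phi>) \<and> compact (closure {x. \<phi> x \<noteq> 0})}"

definition locally_integrable :: "('a::euclidean_space \<Rightarrow> complex) \<Rightarrow> bool" where
  "locally_integrable f \<longleftrightarrow> (\<forall>K. compact K \<longrightarrow> set_integrable lebesgue K f)"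

definition L2 :: "('a::euclidean_space \<Rightarrow> complex) set" where
  "L2 = {f. f \<in> borel_measurable lebesgue \<and> integrable lebesgue (\<lambda>x. (norm (f x))\<^sup>2)}"

text \<open>Real-valued test functions suffice for complex-valued \<open>u\<close>, by linearity of the
  defining identity in the test function.\<close>

definition is_weak_partial ::
  "'a::euclidean_space \<Rightarrow> ('a \<Rightarrow> complex) \<Rightarrow> ('a \<Rightarrow> complex) \<Rightarrow> bool" where
  "is_weak_partial b u g \<longleftrightarrow> locally_integrable u \<and> locally_integrable g \<and>
     (\<forall>\<phi>\<in>test_functions.
        (\<integral>x. frechet_derivative \<phi> (at x) b *\<^sub>R u x \<partial>lebesgue) = - (\<integral>x. \<phi> x *\<^sub>R g x \<partial>lebesgue))"

text \<open>A weak partial derivative is unique up to a null set; \<open>weak_partial\<close> picks a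
  representative. It is meaningful only if a weak derivative exists, as it does on \<open>H1\<close>.\<close>

definition weak_partial :: "'a::euclidean_space \<Rightarrow> ('a \<Rightarrow> complex) \<Rightarrow> 'a \<Rightarrow> complex" where
  "weak_partial b u = (SOME g. is_weak_partial b u g)"

definition H1 :: "('a::euclidean_space \<Rightarrow> complex) set" where
  "H1 = {u \<in> L2. \<forall>b\<in>Basis. \<exists>g\<in>L2. is_weak_partial b u g}"

section \<open>Functions of several particles\<close>

text \<open>A configuration \<open>x :: real^'d^'n\<close> consists of the particles \<open>x $ j :: real^'d\<close>;
  \<open>axis j (axis k 1)\<close> is the unit vector of the \<open>k\<close>-th coordinate of the \<open>j\<close>-th particle.\<close>

definition particle_grad ::
  "'n::finite \<Rightarrow> (real^'d^'n \<Rightarrow> complex) \<Rightarrow> real^'d^'n \<Rightarrow> complex^'d" where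
  "particle_grad j u x = (\<chi> k. weak_partial (axis j (axis k 1)) u x)"

definition swap_particles :: "'n::finite \<Rightarrow> 'n \<Rightarrow> real^'d^'n \<Rightarrow> real^'d^'n" where
  "swap_particles i j x = (\<chi> k. x $ Transposition.transpose i j k)"

text \<open>The identity is required almost everywhere, since elements of \<open>L2\<close> and \<open>H1\<close>
  represent classes of functions modulo null sets.\<close>

definition antisymmetric :: "(real^'d^'n::finite \<Rightarrow> complex) \<Rightarrow> bool" where
  "antisymmetric u \<longleftrightarrow>
     (\<forall>i j. i \<noteq> j \<longrightarrow> (AE x in lebesgue. u (swap_particles i j x) = - u x))"

definition particle_dist :: "'n::finite \<Rightarrow> 'n \<Rightarrow> real^'d^'n \<Rightarrow> real" where
  "particle_dist i j x = norm (x $ i - x $ j)"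

end

theory Submission
  imports Defs
begin

text \<open>
  \<^bold>\<open>The pair inequality.\<close> For a fixed pair \<open>i \<noteq> j\<close> the claim is reduced to a Hardy inequality in
  the relative coordinate \<open>y = x\<^sub>i - x\<^sub>j\<close>:
  \<open>d\<^sup>2 \<integral> |u|\<^sup>2 / r\<^sub>i\<^sub>j\<^sup>2 \<le> \<integral> |\<nabla>\<^sub>i u - \<nabla>\<^sub>j u|\<^sup>2\<close> (lemma \<open>hardy_antisymmetric_pair\<close>). Summing over all pairs and
  using \<open>\<Sum>\<^bsub>i<j\<^esub> |z\<^sub>i - z\<^sub>j|\<^sup>2 = N \<Sum> |z\<^sub>i|\<^sup>2 - |\<Sum> z\<^sub>i|\<^sup>2\<close> (lemma \<open>sum_pair_differences_le\<close>) then gives the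
  theorem.

  \<^bold>\<open>Hardy inequality for odd functions.\<close> Let \<open>e\<^sub>i\<^sub>k\<close> be the unit vector of the \<open>k\<close>-th
  coordinate of the \<open>i\<close>-th particle. The exchange of the particles \<open>i\<close> and \<open>j\<close> changes the sign of the
  components in the orthonormal directions \<open>(e\<^sub>i\<^sub>k - e\<^sub>j\<^sub>k) / \<surd>2\<close>, \<open>k = 1, \<dots>, d\<close>, and fixes
  their orthogonal complement. So the pair inequality is an instance of the following: if \<open>S\<close> is a finite orthonormal
  set and \<open>v\<close> changes sign under the reflection in all directions of \<open>S\<close>, then
  \<open>|S|\<^sup>2/4 \<integral> v\<^sup>2 / |y|\<^sup>2 \<le> \<Sum>\<^bsub>l\<in>S\<^esub> \<integral> (\<partial>\<^sub>l v)\<^sup>2\<close> with \<open>|y|\<^sup>2 = \<Sum>\<^bsub>l\<in>S\<^esub> (x \<bullet> l)\<^sup>2\<close> (lemma \<open>hardy_weak\<close>).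
  No spherical harmonics are needed. If \<open>v\<close> is odd in a single coordinate \<open>y\<^sub>k\<close>, then it vanishes on
  \<open>y\<^sub>k = 0\<close>, and the constant \<open>d\<^sup>2/4\<close> is the half-space Hardy constant: \<open>y\<^sub>k |y|\<^bsup>-d/2\<^esup>\<close> is a positive
  solution of \<open>- \<Delta>\<phi> = d\<^sup>2/4 |y|\<^bsup>-2\<^esup> \<phi>\<close> on \<open>y\<^sub>k > 0\<close>, and its logarithmic gradient \<open>F\<close>, regularised, is the vector field
  in \<open>0 \<le> \<integral> |\<nabla>v - F v|\<^sup>2\<close> (lemma \<open>hardy_odd_in_one_direction\<close>). In general, splitting \<open>v\<close> into its even
  and odd parts in one coordinate after the other is orthogonal for both quadratic forms; every odd
  part satisfies the one-coordinate inequality, and the remainder that is even in all coordinates is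
  zero, because \<open>v\<close> is odd as a whole (lemma \<open>hardy_odd_smooth\<close>).

  \<^bold>\<open>From smooth to weakly differentiable functions.\<close> Convolution with a smooth radial mollifier
  preserves the oddness, commutes with weak derivatives, and does not increase \<open>L\<^sup>2\<close> norms. The passage to
  the limit in the potential term uses duality: with \<open>\<omega> = 1 / (|y|\<^sup>2 + \<delta>)\<close>, \<open>\<integral> v\<^sub>n\<^sup>2 \<omega> \<ge> 2 \<integral> v\<^sub>n \<psi> \<omega> - \<integral> \<psi>\<^sup>2 \<omega>\<close> for
  continuous bounded \<open>\<psi>\<close>, where the limit \<open>n \<rightarrow> \<infinity>\<close> is taken first and \<open>\<psi>\<close> then approaches \<open>v\<close> almost
  everywhere (lemmas \<open>hardy_weak_dual\<close> and \<open>hardy_weak_bounded_support\<close>). A smooth cutoff removes the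
  assumption of bounded support.
\<close>

section \<open>Smooth bump functions\<close>

text \<open>The functions \<open>p(1/t) exp(-1/t)\<close> for \<open>t > 0\<close>, extended by zero. This family, indexed by the
  polynomial \<open>p\<close>, is closed under differentiation, so that smoothness follows by induction.\<close>
definition flat :: "real poly \<Rightarrow> real \<Rightarrow> real" where
  "flat p t = (if t \<le> 0 then 0 else poly p (1 / t) * exp (- (1 / t)))"

lemma poly_times_exp_minus_tendsto_0:
  fixes p :: "real poly"
  shows "((\<lambda>s. poly p s * exp (- s)) \<longlongrightarrow> 0) at_top"
proof -
  have "((\<lambda>s. \<Sum>i\<le>degree p. coeff p i * (s ^ i / exp s)) \<longlongrightarrow> (\<Sum>i\<le>degree p. coeff p i * 0)) at_top"
    by (intro tendsto_intros tendsto_power_div_exp_0)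
  then show ?thesis
    by (simp add: poly_altdef sum_distrib_right exp_minus divide_inverse mult.assoc)
qed

lemma flat_has_field_derivative:
  "(flat p has_field_derivative flat ([:0, 0, 1:] * (p - pderiv p)) t) (at t)"
proof (cases t "0 :: real" rule: linorder_cases)
  case less
  have "((\<lambda>_. 0) has_field_derivative 0) (at t)"
    by simp
  then have "(flat p has_field_derivative 0) (at t)"
    by (rule has_field_derivative_transform_within_open[of _ _ _ "{..<0}"])
       (use less in \<open>auto simp: flat_def\<close>)
  then show ?thesis
    using less by (simp add: flat_def)
next
  case equal
  have "((\<lambda>h. flat p h / h) \<longlongrightarrow> 0) (at_right 0)"
  proof -
    have "((\<lambda>h. poly ([:0, 1:] * p) (inverse h) * exp (- inverse h)) \<longlongrightarrow> 0) (at_right (0::real))"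
      by (rule filterlim_compose[OF poly_times_exp_minus_tendsto_0 filterlim_inverse_at_top_right])
    then show ?thesis
      by (rule Lim_transform_eventually)
         (auto simp: eventually_at_filter flat_def divide_simps)
  qed
  moreover have "((\<lambda>h. flat p h / h) \<longlongrightarrow> 0) (at_left 0)"
    by (rule Lim_transform_eventually[of "\<lambda>_. 0"])
       (auto simp: eventually_at_filter flat_def)
  ultimately have "((\<lambda>h. flat p h / h) \<longlongrightarrow> 0) (at 0)"
    by (simp add: filterlim_at_split)
  then show ?thesis
    using equal by (simp add: has_field_derivative_iff flat_def)
next
  case greater
  have "((\<lambda>t. poly p (1 / t) * exp (- (1 / t))) has_field_derivative
      flat ([:0, 0, 1:] * (p - pderiv p)) t) (at t)"
    by (rule derivative_eq_intros refl poly_DERIV[THEN DERIV_chain2] | use greater in force)+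
       (use greater in \<open>simp add: flat_def field_simps power2_eq_square\<close>)
  then show ?thesis
    by (rule has_field_derivative_transform_within_open[of _ _ _ "{0<..}"])
       (use greater in \<open>auto simp: flat_def\<close>)
qed

lemma continuous_on_flat: "continuous_on A (flat p)"
  using flat_has_field_derivative[THEN DERIV_isCont]
  by (simp add: continuous_at_imp_continuous_on)

lemma Ck_SucI:
  assumes "\<And>x. (f has_derivative f' x) (at x)" "\<And>b. b \<in> Basis \<Longrightarrow> Ck k (\<lambda>x. f' x b)"
  shows "Ck (Suc k) f"
proof -
  have "frechet_derivative f (at x) = f' x" for x
    using assms(1) frechet_derivative_at by metis
  then show ?thesis
    using assms by (auto simp: differentiable_def)
qed

lemma Ck_SucD:
  assumes "Ck (Suc k) f"
  shows "(f has_derivative frechet_derivative f (at x)) (at x)"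
  using assms frechet_derivative_works by auto

lemma Ck_continuous: "Ck k f \<Longrightarrow> continuous_on UNIV f"
  by (cases k) (auto intro!: continuous_at_imp_continuous_on differentiable_imp_continuous_within)

lemma Ck_Suc_imp: "Ck (Suc k) f \<Longrightarrow> Ck k f"
proof (induction k arbitrary: f)
  case 0
  then show ?case
    using Ck_continuous[OF 0] by simp
next
  case (Suc k)
  then show ?case
    by (metis Ck.simps(2))
qed

lemma Ck_const: "Ck k (\<lambda>_. c)"
proof (induction k arbitrary: c)
  case (Suc k)
  show ?case
    by (rule Ck_SucI[where f' = "\<lambda>_ _. 0"]) (auto intro: Suc)
qed auto

lemma Ck_add: "Ck k f \<Longrightarrow> Ck k g \<Longrightarrow> Ck k (\<lambda>x. f x + g x)"
proof (induction k arbitrary: f g)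
  case (Suc k)
  show ?case
    by (rule Ck_SucI[OF has_derivative_add[OF Ck_SucD[OF Suc.prems(1)] Ck_SucD[OF Suc.prems(2)]]])
       (use Suc in auto)
qed (auto intro: continuous_intros)

lemma Ck_mult: "Ck k f \<Longrightarrow> Ck k g \<Longrightarrow> Ck k (\<lambda>x. f x * g x)"
proof (induction k arbitrary: f g)
  case (Suc k)
  show ?case
    by (rule Ck_SucI[OF has_derivative_mult[OF Ck_SucD[OF Suc.prems(1)] Ck_SucD[OF Suc.prems(2)]]])
       (use Suc in \<open>auto intro!: Ck_add Suc.IH Ck_Suc_imp[OF Suc.prems(1)] Ck_Suc_imp[OF Suc.prems(2)]\<close>)
qed (auto intro: continuous_intros)

lemma Ck_flat: "(\<And>j. Ck j f) \<Longrightarrow> Ck k (\<lambda>x. flat p (f x))"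
proof (induction k arbitrary: p)
  case 0
  then show ?case
    using continuous_on_compose2[OF continuous_on_flat Ck_continuous[OF 0]] by auto
next
  case (Suc k)
  have D: "((\<lambda>x. flat p (f x)) has_derivative
     (\<lambda>h. frechet_derivative f (at x) h * flat ([:0, 0, 1:] * (p - pderiv p)) (f x))) (at x)" for x
    using DERIV_compose_FDERIV[OF flat_has_field_derivative Ck_SucD[OF Suc.prems]] .
  show ?case
    by (rule Ck_SucI[OF D], rule Ck_mult[OF _ Suc.IH[OF Suc.prems]])
       (use Suc.prems[of "Suc k"] in auto)
qed

lemma Ck_inner: "Ck k (\<lambda>x. (x - y) \<bullet> a)"
proof (cases k)
  case (Suc j)
  show ?thesis
    unfolding Suc
    by (rule Ck_SucI[where f' = "\<lambda>_ h. h \<bullet> a"])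
       (auto intro!: derivative_eq_intros Ck_const)
qed (auto intro!: continuous_intros)

lemma Ck_inner_self: "Ck k (\<lambda>x. (x - y) \<bullet> (x - y))"
proof (cases k)
  case (Suc j)
  show ?thesis
    unfolding Suc
  proof (rule Ck_SucI[where f' = "\<lambda>x h. 2 * ((x - y) \<bullet> h)"])
    show "Ck j (\<lambda>x. 2 * ((x - y) \<bullet> b))" for b
      by (intro Ck_mult Ck_const Ck_inner)
  qed (auto intro!: derivative_eq_intros simp: inner_commute)
qed (auto intro!: continuous_intros)

text \<open>The radial bump \<open>exp (-1 / (1 - a |w|\<^sup>2))\<close>, supported in the ball of radius \<open>1 / sqrt a\<close>. For large
  \<open>a\<close> its normalisation is a mollifier, for small \<open>a\<close> a multiple of it is a cutoff function.\<close>
definition bump :: "real \<Rightarrow> 'a::euclidean_space \<Rightarrow> real" where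
  "bump a w = flat 1 (1 - a * (w \<bullet> w))"

text \<open>The derivative of \<open>bump a\<close> at \<open>w\<close> in the direction \<open>h\<close>.\<close>
definition bump_grad :: "real \<Rightarrow> 'a::euclidean_space \<Rightarrow> 'a \<Rightarrow> real" where
  "bump_grad a h w = - 2 * a * (w \<bullet> h) * flat [:0, 0, 1:] (1 - a * (w \<bullet> w))"

lemma bump_has_derivative: "(bump a has_derivative (\<lambda>h. bump_grad a h w)) (at w)"
proof -
  have "((\<lambda>w. 1 - a * (w \<bullet> w)) has_derivative (\<lambda>h. - 2 * a * (w \<bullet> h))) (at w)"
    by (auto intro!: derivative_eq_intros simp: inner_commute algebra_simps)
  from DERIV_compose_FDERIV[OF flat_has_field_derivative this, of 1]
  show ?thesis
    by (simp add: bump_def[abs_def] bump_grad_def[abs_def] pCons_one)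
qed

lemma bump_nonneg: "0 \<le> bump a w"
  by (simp add: bump_def flat_def)

lemma bump_le: assumes "0 \<le> a" shows "bump a w \<le> exp (- 1)"
proof -
  have "- (1 / (1 - a * (w \<bullet> w))) \<le> - 1" if "1 - a * (w \<bullet> w) > 0"
    using that assms by (auto simp: field_simps)
  then show ?thesis
    by (auto simp: bump_def flat_def)
qed

lemma bump_support:
  assumes "a > 0" "norm w \<ge> 1 / sqrt a"
  shows "bump a w = 0" "bump_grad a h w = 0"
proof -
  have "(1 / sqrt a)\<^sup>2 \<le> (norm w)\<^sup>2"
    using assms by (intro power_mono) auto
  then have "1 - a * (w \<bullet> w) \<le> 0"
    using assms(1) by (simp add: power2_norm_eq_inner field_simps power_divide)
  then show "bump a w = 0" "bump_grad a h w = 0"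
    by (simp_all add: bump_def bump_grad_def flat_def)
qed

lemma continuous_on_bump: "continuous_on A (bump a)"
  by (intro continuous_at_imp_continuous_on ballI has_derivative_continuous[OF bump_has_derivative])

lemma continuous_on_bump_grad: "continuous_on A (bump_grad a h)"
  unfolding bump_grad_def[abs_def]
  by (intro continuous_intros continuous_on_compose2[OF continuous_on_flat]) auto

lemma bump_minus: "bump a (x - z) = bump a (z - x)"
  by (simp add: bump_def inner_diff algebra_simps inner_commute)

lemma bump_grad_minus: "bump_grad a h (x - z) = - bump_grad a h (z - x)"
  by (simp add: bump_grad_def inner_diff algebra_simps inner_commute)

lemma bump_shift_test_function:
  fixes x :: "'a::euclidean_space"
  assumes "a > 0" shows "(\<lambda>z. bump a (z - x)) \<in> test_functions"
proof -
  have "Ck k (\<lambda>z. bump a (z - x))" for k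
  proof -
    have "Ck j (\<lambda>z. 1 + (- a) * ((z - x) \<bullet> (z - x)))" for j
      by (intro Ck_add Ck_mult Ck_const Ck_inner_self)
    from Ck_flat[OF this, of k 1] show ?thesis
      by (simp add: bump_def)
  qed
  moreover have "{z. bump a (z - x) \<noteq> 0} \<subseteq> cball x (1 / sqrt a)"
    using bump_support(1)[OF assms] by (force simp: dist_norm norm_minus_commute)
  then have "compact (closure {z. bump a (z - x) \<noteq> 0})"
    by (meson bounded_cball bounded_subset compact_closure)
  ultimately show ?thesis
    by (auto simp: test_functions_def)
qed

lemma frechet_derivative_bump_shift:
  "frechet_derivative (\<lambda>z. bump a (z - x)) (at z) h = bump_grad a h (z - x)"
proof -
  have "((\<lambda>z. bump a (z - x)) has_derivative (\<lambda>h. bump_grad a h (z - x))) (at z)"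
    by (rule has_derivative_compose[OF _ bump_has_derivative, of "\<lambda>z. z - x" "\<lambda>h. h" z UNIV a])
       (auto intro!: derivative_eq_intros)
  from frechet_derivative_at[OF this] show ?thesis
    by metis
qed

lemma test_functions_mult:
  assumes "\<phi> \<in> test_functions" "\<psi> \<in> test_functions"
  shows "(\<lambda>x. \<phi> x * \<psi> x) \<in> test_functions"
proof -
  have "closure {x. \<phi> x * \<psi> x \<noteq> 0} \<subseteq> closure {x. \<phi> x \<noteq> 0}"
    by (rule closure_mono) auto
  then have "compact (closure {x. \<phi> x * \<psi> x \<noteq> 0})"
    using assms(1) compact_Int_closed[of "closure {x. \<phi> x \<noteq> 0}" "closure {x. \<phi> x * \<psi> x \<noteq> 0}"]
    by (simp add: test_functions_def Int_absorb1)
  then show ?thesis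
    using assms by (auto simp: test_functions_def Ck_mult)
qed

text \<open>The constant does not depend on \<open>a\<close>: the gradient of a cutoff at radius \<open>1 / sqrt a\<close> is of the
  order \<open>sqrt a\<close>.\<close>
lemma bump_grad_bound:
  obtains C where "C \<ge> 0" "\<And>(a::real) h w::'a::euclidean_space. a > 0 \<Longrightarrow> \<bar>bump_grad a h w\<bar> \<le> C * sqrt a * norm h"
proof -
  have "compact (flat [:0, 0, 1:] ` {0..1})"
    by (intro compact_continuous_image continuous_on_flat compact_Icc)
  then obtain C where C: "\<And>t. t \<in> {0..1} \<Longrightarrow> \<bar>flat [:0, 0, 1:] t\<bar> \<le> C"
    using compact_imp_bounded[of "flat [:0, 0, 1:] ` {0..1}"] unfolding bounded_iff image_iff real_norm_def
    by blast
  from C[of 0] have C0: "C \<ge> 0" by auto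
  have "\<bar>bump_grad a h w\<bar> \<le> 2 * C * sqrt a * norm h" if a: "a > 0" for a and h w :: 'a
  proof (cases "norm w \<ge> 1 / sqrt a")
    case True
    then show ?thesis
      using bump_support[OF a True] C0 a by simp
  next
    case False
    then have n: "norm w * sqrt a \<le> 1"
      using a by (simp add: field_simps)
    then have "(norm w * sqrt a)\<^sup>2 \<le> 1"
      using a by (simp add: power_le_one)
    then have "1 - a * (w \<bullet> w) \<in> {0..1}"
      using a by (simp add: power_mult_distrib power2_norm_eq_inner mult.commute)
    from C[OF this] have 1: "\<bar>flat [:0, 0, 1:] (1 - a * (w \<bullet> w))\<bar> \<le> C" .
    have "a * \<bar>w \<bullet> h\<bar> \<le> (sqrt a * sqrt a) * (norm w * norm h)"
      using a by (intro mult_mono Cauchy_Schwarz_ineq2) auto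
    also have "\<dots> = (norm w * sqrt a) * (sqrt a * norm h)"
      by simp
    also have "\<dots> \<le> sqrt a * norm h"
      using n a by (intro mult_left_le_one_le) auto
    finally have 2: "2 * (a * \<bar>w \<bullet> h\<bar>) \<le> 2 * (sqrt a * norm h)"
      by linarith
    have "\<bar>bump_grad a h w\<bar> = 2 * (a * \<bar>w \<bullet> h\<bar>) * \<bar>flat [:0, 0, 1:] (1 - a * (w \<bullet> w))\<bar>"
      using a by (simp add: bump_grad_def abs_mult)
    also have "\<dots> \<le> 2 * (sqrt a * norm h) * C"
      using 1 2 a by (intro mult_mono 1 2) (auto simp del: mult_le_cancel_left_pos)
    finally show ?thesis by (simp add: algebra_simps)
  qed
  with C0 that[of "2 * C"] show ?thesis by auto
qed

section \<open>Functions differentiable in one direction\<close>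

text \<open>Continuous functions with bounded support.\<close>
definition cont_csupp :: "('a::euclidean_space \<Rightarrow> real) \<Rightarrow> bool" where
  "cont_csupp f \<longleftrightarrow> continuous_on UNIV f \<and> (\<exists>R. \<forall>x. norm x > R \<longrightarrow> f x = 0)"

lemma cont_csupp_mult: "cont_csupp f \<Longrightarrow> continuous_on UNIV g \<Longrightarrow> cont_csupp (\<lambda>x. f x * g x)"
  by (auto simp: cont_csupp_def intro!: continuous_intros)

lemma cont_csupp_power2: "cont_csupp f \<Longrightarrow> cont_csupp (\<lambda>x. (f x)\<^sup>2)"
  by (auto simp: cont_csupp_def intro!: continuous_intros)

lemma cont_csupp_add:
  assumes "cont_csupp f" "cont_csupp g" shows "cont_csupp (\<lambda>x. f x + g x)"
proof -
  obtain R R' where "\<And>x. norm x > R \<Longrightarrow> f x = 0" "\<And>x. norm x > R' \<Longrightarrow> g x = 0"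
    using assms by (auto simp: cont_csupp_def)
  then have "\<exists>R. \<forall>x. norm x > R \<longrightarrow> f x + g x = 0"
    by (intro exI[of _ "max R R'"]) auto
  then show ?thesis
    using assms by (auto simp: cont_csupp_def intro!: continuous_intros)
qed

lemma cont_csupp_cmult: "cont_csupp f \<Longrightarrow> cont_csupp (\<lambda>x. c * f x)"
  by (auto simp: cont_csupp_def intro!: continuous_intros)

lemma cont_csupp_bounded:
  assumes "cont_csupp f" obtains C where "C \<ge> 0" "\<And>x. \<bar>f x\<bar> \<le> C"
proof -
  obtain R where R: "\<And>x. norm x > R \<Longrightarrow> f x = 0"
    using assms by (auto simp: cont_csupp_def)
  have "compact (f ` cball 0 R)"
    using assms by (intro compact_continuous_image compact_cball)
      (auto simp: cont_csupp_def intro: continuous_on_subset)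
  then obtain C where C: "\<And>x. norm x \<le> R \<Longrightarrow> \<bar>f x\<bar> \<le> C"
    using compact_imp_bounded[of "f ` cball 0 R"] unfolding bounded_iff by force
  have "\<bar>f x\<bar> \<le> max C 0" for x
    using C[of x] R[of x] by (cases "norm x \<le> R") auto
  then show ?thesis
    using that[of "max C 0"] by auto
qed

lemma cont_csupp_borel: "cont_csupp f \<Longrightarrow> f \<in> borel_measurable borel"
  by (simp add: cont_csupp_def borel_measurable_continuous_onI)

lemma integrable_const_cball: "integrable lborel (\<lambda>x::'a::euclidean_space. c * indicator (cball 0 R) x :: real)"
  using borel_integrable_compact[of "cball 0 R" "\<lambda>_::'a. c"] by (simp add: mult.commute)

lemma cont_csupp_integrable: assumes "cont_csupp f" shows "integrable lborel f"
proof -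
  obtain R where R: "\<And>x. norm x > R \<Longrightarrow> f x = 0"
    using assms by (auto simp: cont_csupp_def)
  have "(\<lambda>x. indicator (cball 0 R) x *\<^sub>R f x) = f"
    using R by (auto simp: indicator_def fun_eq_iff not_le)
  with borel_integrable_compact[of "cball 0 R" f] show ?thesis
    using assms continuous_on_subset by (fastforce simp: cont_csupp_def)
qed

lemma integral_lborel_translate:
  fixes f :: "'a::euclidean_space \<Rightarrow> 'b::{banach, second_countable_topology}"
  assumes "f \<in> borel_measurable borel"
  shows "(\<integral>x. f (x + c) \<partial>lborel) = (\<integral>x. f x \<partial>lborel)"
  using assms lborel_distr_plus[of c] integral_distr[of "(+) c" lborel borel f]
  by (simp add: add.commute)

text \<open>\<open>v\<close> has the continuous derivative \<open>v'\<close> in the direction \<open>h\<close>, both with bounded support. Only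
  derivatives in the directions that occur in the inequality are needed, so no full derivative
  is required.\<close>
definition C1_along :: "'a::euclidean_space \<Rightarrow> ('a \<Rightarrow> real) \<Rightarrow> ('a \<Rightarrow> real) \<Rightarrow> bool" where
  "C1_along h v v' \<longleftrightarrow> cont_csupp v \<and> cont_csupp v' \<and>
     (\<forall>x. ((\<lambda>t. v (x + t *\<^sub>R h)) has_field_derivative v' x) (at 0))"

lemma C1_along_has_field_derivative:
  assumes "C1_along h v v'"
  shows "((\<lambda>t. v (x + t *\<^sub>R h)) has_field_derivative v' (x + s *\<^sub>R h)) (at s)"
proof -
  have "((\<lambda>t. v (x + s *\<^sub>R h + t *\<^sub>R h)) has_field_derivative v' (x + s *\<^sub>R h)) (at 0)"
    using assms by (simp add: C1_along_def)
  then show ?thesis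
    using DERIV_shift[of "\<lambda>t. v (x + t *\<^sub>R h)" "v' (x + s *\<^sub>R h)" 0 s]
    by (simp add: scaleR_add_left ac_simps)
qed

lemma C1_along_lipschitz:
  assumes "C1_along h v v'" "\<And>x. \<bar>v' x\<bar> \<le> C"
  shows "\<bar>v (x + t *\<^sub>R h) - v x\<bar> \<le> C * \<bar>t\<bar>"
  using field_differentiable_bound[of UNIV "\<lambda>t. v (x + t *\<^sub>R h)" "\<lambda>s. v' (x + s *\<^sub>R h)" C t 0]
    C1_along_has_field_derivative[OF assms(1)] assms(2) by simp

lemma difference_quotient_tendsto:
  fixes f :: "'a::real_vector \<Rightarrow> real"
  assumes "((\<lambda>t. f (x + t *\<^sub>R h)) has_field_derivative d) (at 0)"
    and X: "X \<longlonglongrightarrow> 0" "\<And>n. X n \<noteq> (0::real)"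
  shows "(\<lambda>n. (f (x + X n *\<^sub>R h) - f x) / X n) \<longlonglongrightarrow> d"
proof -
  have "((\<lambda>t. (f (x + t *\<^sub>R h) - f x) / t) \<longlongrightarrow> d) (at 0)"
    using assms(1) unfolding has_field_derivative_iff by simp
  moreover have "filterlim X (at 0) sequentially"
    using X by (simp add: filterlim_at)
  ultimately show ?thesis
    by (rule filterlim_compose)
qed

text \<open>Integration by parts: the integral of \<open>(v(x + t h) - v x) / t\<close> vanishes by translation invariance,
  and \<open>t \<rightarrow> 0\<close>.\<close>
lemma C1_along_integral_derivative:
  assumes "C1_along h v v'"
  shows "(\<integral>x. v' x \<partial>lborel) = 0"
proof -
  define X where "X n = 1 / real (Suc n)" for n
  have X: "X \<longlonglongrightarrow> 0" "\<And>n. X n \<noteq> 0" "\<And>n. X n > 0" "\<And>n. X n \<le> 1"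
    using LIMSEQ_Suc[OF lim_1_over_n[where 'a = real]] by (auto simp: X_def[abs_def] field_simps)
  have v: "cont_csupp v" "cont_csupp v'"
    using assms by (auto simp: C1_along_def)
  have vm [measurable]: "v \<in> borel_measurable borel" "v' \<in> borel_measurable borel"
    using v by (auto intro: cont_csupp_borel)
  obtain C where C: "C \<ge> 0" "\<And>x. \<bar>v' x\<bar> \<le> C"
    using cont_csupp_bounded[OF v(2)] by metis
  obtain R where R: "\<And>x. norm x > R \<Longrightarrow> v x = 0"
    using v(1) by (auto simp: cont_csupp_def)
  let ?q = "\<lambda>n x. (v (x + X n *\<^sub>R h) - v x) / X n"
  have bound: "\<bar>?q n x\<bar> \<le> C * indicator (cball 0 (R + norm h)) x" for n x
  proof (cases "norm x \<le> R + norm h")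
    case True
    have "\<bar>?q n x\<bar> = \<bar>v (x + X n *\<^sub>R h) - v x\<bar> / X n"
      using X(3)[of n] by (simp add: abs_divide)
    also have "\<dots> \<le> C"
      using C1_along_lipschitz[OF assms C(2), of x "X n"] X(3)[of n] by (simp add: field_simps)
    finally show ?thesis
      using True by simp
  next
    case False
    have "norm (X n *\<^sub>R h) \<le> norm h"
      using X(3,4)[of n] by (simp add: mult_left_le_one_le)
    then have "norm (x + X n *\<^sub>R h) > R" "norm x > R"
      using False norm_diff_ineq[of x "X n *\<^sub>R h"] by (auto, smt (verit) norm_ge_zero)
    then show ?thesis
      using R False by simp
  qed
  have "(\<lambda>n. \<integral>x. ?q n x \<partial>lborel) \<longlonglongrightarrow> (\<integral>x. v' x \<partial>lborel)"
  proof (rule integral_dominated_convergence[where w = "\<lambda>x. C * indicator (cball 0 (R + norm h)) x"])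
    show "AE x in lborel. (\<lambda>n. ?q n x) \<longlonglongrightarrow> v' x"
      using assms X by (intro AE_I2 difference_quotient_tendsto) (auto simp: C1_along_def)
  qed (use bound integrable_const_cball in auto)
  moreover have "(\<integral>x. ?q n x \<partial>lborel) = 0" for n
  proof -
    have "integrable lborel (\<lambda>x. v (x + X n *\<^sub>R h))"
      using cont_csupp_integrable[OF v(1)] lborel_distr_plus[of "X n *\<^sub>R h"]
        integrable_distr[of "(+) (X n *\<^sub>R h)" lborel borel v]
      by (simp add: add.commute)
    then show ?thesis
      using cont_csupp_integrable[OF v(1)] integral_lborel_translate[of v "X n *\<^sub>R h"] by simp
  qed
  ultimately have "(\<lambda>n. 0) \<longlonglongrightarrow> (\<integral>x. v' x \<partial>lborel)"
    by (simp only:)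
  then show ?thesis
    by (simp add: LIMSEQ_const_iff)
qed

lemma C1_along_power2_mult:
  assumes "C1_along h v v'" "continuous_on UNIV F" "continuous_on UNIV F'"
    "\<And>x. ((\<lambda>t. F (x + t *\<^sub>R h)) has_field_derivative F' x) (at 0)"
  shows "C1_along h (\<lambda>x. F x * (v x)\<^sup>2) (\<lambda>x. F' x * (v x)\<^sup>2 + 2 * F x * v x * v' x)"
proof -
  have v: "cont_csupp v" "cont_csupp v'" "continuous_on UNIV v" "continuous_on UNIV v'"
    using assms(1) by (auto simp: C1_along_def cont_csupp_def)
  have "cont_csupp (\<lambda>x. (v x)\<^sup>2 * F x)" "cont_csupp (\<lambda>x. (v x)\<^sup>2 * F' x + v' x * (2 * F x * v x))"
    using v assms by (intro cont_csupp_add cont_csupp_mult cont_csupp_power2 continuous_intros; simp)+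
  moreover have "((\<lambda>t. F (x + t *\<^sub>R h) * (v (x + t *\<^sub>R h))\<^sup>2) has_field_derivative
      F' x * (v x)\<^sup>2 + 2 * F x * v x * v' x) (at 0)" for x
  proof -
    have "((\<lambda>t. v (x + t *\<^sub>R h)) has_field_derivative v' x) (at 0)"
      using assms(1) by (simp add: C1_along_def)
    from DERIV_mult[OF assms(4)[of x] DERIV_power[OF this, of 2]] show ?thesis
      by (simp add: algebra_simps)
  qed
  ultimately show ?thesis
    by (simp add: C1_along_def algebra_simps)
qed

section \<open>Reflections in orthonormal directions\<close>

text \<open>Finite orthonormal sets.\<close>
definition orthonormal :: "'a::euclidean_space set \<Rightarrow> bool" where
  "orthonormal S \<longleftrightarrow> finite S \<and> (\<forall>a\<in>S. \<forall>b\<in>S. a \<bullet> b = (if a = b then 1 else 0))"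

text \<open>The linear map that changes the sign of \<open>x \<bullet> e\<close> for all \<open>e \<in> T\<close> (for orthonormal \<open>T\<close>), and fixes the
  orthogonal complement of \<open>T\<close>. With \<open>T\<close> all relative directions of two particles it exchanges these particles, with a
  single one it exchanges one of their coordinates.\<close>
definition reflect :: "'a::euclidean_space set \<Rightarrow> 'a \<Rightarrow> 'a" where
  "reflect T x = x - (\<Sum>e\<in>T. (2 * (x \<bullet> e)) *\<^sub>R e)"

text \<open>The squared length of the projection of \<open>x\<close> to the span of \<open>S\<close>, for orthonormal \<open>S\<close>; that is, the squared
  distance to the orthogonal complement.\<close>
definition sqdist :: "'a::euclidean_space set \<Rightarrow> 'a \<Rightarrow> real" where
  "sqdist S x = (\<Sum>e\<in>S. (x \<bullet> e)\<^sup>2)"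

lemma sqdist_nonneg: "0 \<le> sqdist S x"
  by (simp add: sqdist_def sum_nonneg)

lemma continuous_on_sqdist [continuous_intros]:
  "continuous_on A f \<Longrightarrow> continuous_on A (\<lambda>x. sqdist S (f x))"
  unfolding sqdist_def by (intro continuous_intros)

lemma orthonormal_line:
  assumes "orthonormal S" "l \<in> S"
  shows "sqdist S (x + t *\<^sub>R l) = sqdist S x + 2 * t * (x \<bullet> l) + t\<^sup>2"
proof -
  have fin: "finite S" using assms by (simp add: orthonormal_def)
  have "sqdist S (x + t *\<^sub>R l) = (\<Sum>e\<in>S. (x \<bullet> e)\<^sup>2 + (if e = l then 2 * t * (x \<bullet> l) + t\<^sup>2 else 0))"
    unfolding sqdist_def
    using assms by (intro sum.cong) (auto simp: orthonormal_def inner_add_left power2_eq_square algebra_simps)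
  also have "\<dots> = sqdist S x + 2 * t * (x \<bullet> l) + t\<^sup>2"
    using fin assms(2) by (simp add: sum.distrib sqdist_def)
  finally show ?thesis .
qed

lemma reflect_inner:
  assumes "orthonormal S" "T \<subseteq> S" "l \<in> S"
  shows "reflect T x \<bullet> l = (if l \<in> T then - (x \<bullet> l) else x \<bullet> l)"
proof -
  have fin: "finite T" using assms by (auto simp: orthonormal_def intro: finite_subset)
  have "(\<Sum>e\<in>T. (2 * (x \<bullet> e)) * (e \<bullet> l)) = (\<Sum>e\<in>T. if e = l then 2 * (x \<bullet> l) else 0)"
    using assms by (intro sum.cong) (auto simp: orthonormal_def)
  then show ?thesis
    using fin by (simp add: reflect_def inner_diff_left inner_sum_left)
qed

lemma reflect_insert:
  assumes "orthonormal S" "insert k T \<subseteq> S" "k \<notin> T"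
  shows "reflect T (reflect {k} x) = reflect (insert k T) x"
    and "reflect {k} (reflect T x) = reflect (insert k T) x"
proof -
  have fin: "finite T" using assms by (auto simp: orthonormal_def intro: finite_subset)
  have "reflect {k} x \<bullet> e = x \<bullet> e" if "e \<in> T" for e
    using reflect_inner[OF assms(1), of "{k}" e x] that assms by auto
  moreover have "reflect T x \<bullet> k = x \<bullet> k"
    using reflect_inner[OF assms(1), of T k x] assms by auto
  ultimately show "reflect T (reflect {k} x) = reflect (insert k T) x"
    "reflect {k} (reflect T x) = reflect (insert k T) x"
    using fin assms(3) by (simp_all add: reflect_def[of T "reflect {k} x"] reflect_def[of "{k}" "reflect T x"])
       (simp_all add: reflect_def algebra_simps)
qed

lemma reflect_singleton_involution: "k \<bullet> k = 1 \<Longrightarrow> reflect {k} (reflect {k} x) = x"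
  by (simp add: reflect_def inner_diff_left algebra_simps)

lemma sqdist_reflect:
  assumes "orthonormal S" "T \<subseteq> S" shows "sqdist S (reflect T x) = sqdist S x"
  unfolding sqdist_def using reflect_inner[OF assms] by (intro sum.cong) auto

lemma norm_reflect_singleton:
  assumes "k \<bullet> k = 1" shows "norm (reflect {k} x) = norm x"
proof -
  have "reflect {k} x \<bullet> reflect {k} x = x \<bullet> x"
    using assms by (simp add: reflect_def inner_diff_left inner_diff_right algebra_simps inner_commute)
  then show ?thesis
    by (simp add: norm_eq_sqrt_inner)
qed

lemma reflect_line:
  "reflect {k} (x + t *\<^sub>R l) = reflect {k} x + t *\<^sub>R (l - (2 * (l \<bullet> k)) *\<^sub>R k)"
  by (simp add: reflect_def inner_add_left algebra_simps)

lemma continuous_on_reflect [continuous_intros]: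
  "continuous_on A f \<Longrightarrow> continuous_on A (\<lambda>x. reflect T (f x))"
  unfolding reflect_def by (intro continuous_intros)

lemma borel_measurable_reflect [measurable]: "reflect T \<in> borel \<rightarrow>\<^sub>M borel"
  by (intro borel_measurable_continuous_onI continuous_intros)

lemma reflect_diff: "reflect T (x - z) = reflect T x - reflect T z"
  by (simp add: reflect_def inner_diff_left algebra_simps sum_subtractf)

lemma reflect_isometry:
  assumes S: "orthonormal S" and T: "T \<subseteq> S"
    and inv: "\<And>k. k \<in> S \<Longrightarrow> distr lborel borel (reflect {k}) = lborel"
  shows norm_reflect: "norm (reflect T x) = norm x"
    and distr_reflect: "distr lborel borel (reflect T) = lborel"
proof -
  have "finite T" using S T by (auto simp: orthonormal_def intro: finite_subset)
  then have "(\<forall>x. norm (reflect T x) = norm x) \<and> distr lborel borel (reflect T) = lborel"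
    using T
  proof induction
    case empty
    have "reflect {} = (\<lambda>x::'a. x)" by (simp add: reflect_def fun_eq_iff)
    then show ?case by (simp add: distr_id2[of borel lborel])
  next
    case (insert k T)
    have k: "k \<in> S" "k \<bullet> k = 1" using insert.prems S by (auto simp: orthonormal_def)
    have eq: "reflect (insert k T) = reflect {k} \<circ> reflect T"
      using reflect_insert(2)[OF S insert.prems insert.hyps(2)] by (simp add: fun_eq_iff)
    have "distr lborel borel (reflect (insert k T)) = distr (distr lborel borel (reflect T)) borel (reflect {k})"
      unfolding eq by (rule distr_distr[symmetric]) auto
    also have "\<dots> = lborel"
      using insert inv[OF k(1)] by simp
    finally show ?case
      using insert norm_reflect_singleton[OF k(2)] by (simp add: eq del: comp_apply) (simp add: o_def)
  qed
  then show "norm (reflect T x) = norm x" "distr lborel borel (reflect T) = lborel"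
    by auto
qed

section \<open>The Hardy inequality for smooth odd functions\<close>

text \<open>The field \<open>F\<close> regularises the logarithmic gradient of \<open>(x \<bullet> k) * (sqdist S x)\<^bsup>-d/4\<^esup>\<close>, and \<open>G l\<close> is the derivative
  of \<open>F l\<close> in the direction \<open>l\<close>. Expanding \<open>0 \<le> \<Sum> (p l - F l * w)\<^sup>2\<close> leaves \<open>- \<Sum> G l - \<Sum> (F l)\<^sup>2\<close>, which is at
  least \<open>d\<^sup>2/4 * b\<close> up to the terms with the factor \<open>\<epsilon>\<close>. Here \<open>p l\<close> and \<open>w\<close> stand for the derivatives and the
  value of a function at \<open>x\<close>; then the first sum on the right is a divergence.\<close>
lemma hardy_pointwise:
  fixes x :: "'a::euclidean_space"
  assumes S: "orthonormal S" "k \<in> S" and pos: "\<epsilon> > 0" "\<delta> > 0"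
  defines "d \<equiv> real (card S)"
    and "a \<equiv> 1 / ((x \<bullet> k)\<^sup>2 + \<epsilon>)" and "b \<equiv> 1 / (sqdist S x + \<delta>)"
  defines "F \<equiv> \<lambda>l. (if l = k then (x \<bullet> k) * a else 0) - d / 2 * ((x \<bullet> l) * b)"
    and "G \<equiv> \<lambda>l. (if l = k then a - 2 * (x \<bullet> k)\<^sup>2 * a\<^sup>2 else 0) - d / 2 * (b - 2 * (x \<bullet> l)\<^sup>2 * b\<^sup>2)"
  shows "(\<Sum>l\<in>S. p l ^ 2) \<ge> (\<Sum>l\<in>S. G l * w\<^sup>2 + 2 * F l * w * p l) + (d\<^sup>2 / 4 * b - (\<epsilon> * a\<^sup>2 + d * \<epsilon> * a * b)) * w\<^sup>2"
proof -
  have fin: "finite S" using S by (simp add: orthonormal_def)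
  define Q where "Q = sqdist S x"
  have A: "(x \<bullet> k)\<^sup>2 + \<epsilon> > 0" "Q + \<delta> > 0"
    using pos sqdist_nonneg[of S x] by (auto simp: Q_def add_nonneg_pos)
  have ya: "(x \<bullet> k)\<^sup>2 * a = 1 - \<epsilon> * a" and Qb: "Q * b = 1 - \<delta> * b" and b0: "b > 0"
    using A by (auto simp: a_def b_def Q_def field_simps)
  have sG: "(\<Sum>l\<in>S. G l) = a - 2 * (x \<bullet> k)\<^sup>2 * a\<^sup>2 - d / 2 * (d * b - 2 * Q * b\<^sup>2)"
  proof -
    have "(\<Sum>l\<in>S. d / 2 * (b - 2 * (x \<bullet> l)\<^sup>2 * b\<^sup>2)) = d / 2 * ((\<Sum>l\<in>S. b) - 2 * Q * b\<^sup>2)"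
      by (simp only: sum_distrib_left[symmetric] sum_subtractf Q_def sqdist_def sum_distrib_right[symmetric])
    then show ?thesis
      using fin S(2) by (simp add: G_def sum_subtractf d_def)
  qed
  have sF: "(\<Sum>l\<in>S. (F l)\<^sup>2) = (x \<bullet> k)\<^sup>2 * a\<^sup>2 - d * (x \<bullet> k)\<^sup>2 * a * b + d\<^sup>2 / 4 * (Q * b\<^sup>2)"
  proof -
    have "(\<Sum>l\<in>S. (F l)\<^sup>2) = (\<Sum>l\<in>S. (if l = k then (x \<bullet> k)\<^sup>2 * a\<^sup>2 - d * (x \<bullet> k)\<^sup>2 * a * b else 0)
        + d\<^sup>2 / 4 * b\<^sup>2 * (x \<bullet> l)\<^sup>2)"
      by (intro sum.cong) (auto simp: F_def power2_eq_square algebra_simps)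
    also have "\<dots> = (x \<bullet> k)\<^sup>2 * a\<^sup>2 - d * (x \<bullet> k)\<^sup>2 * a * b + d\<^sup>2 / 4 * b\<^sup>2 * Q"
      using fin S(2) by (simp add: sum.distrib sum_distrib_left Q_def sqdist_def)
    finally show ?thesis by (simp add: algebra_simps)
  qed
  have "- (\<Sum>l\<in>S. G l) - (\<Sum>l\<in>S. (F l)\<^sup>2) =
      - a + (x \<bullet> k)\<^sup>2 * a * a + d\<^sup>2 / 2 * b - d * (Q * b) * b + d * ((x \<bullet> k)\<^sup>2 * a) * b - d\<^sup>2 / 4 * (Q * b) * b"
    unfolding sG sF by (simp add: algebra_simps power2_eq_square)
  also have "\<dots> = d\<^sup>2 / 4 * b - (\<epsilon> * a\<^sup>2 + d * \<epsilon> * a * b) + (d + d\<^sup>2 / 4) * \<delta> * b\<^sup>2"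
    unfolding ya Qb by (simp add: field_simps power2_eq_square)
  also have "\<dots> \<ge> d\<^sup>2 / 4 * b - (\<epsilon> * a\<^sup>2 + d * \<epsilon> * a * b)"
    using pos by (auto simp: d_def)
  finally have key: "d\<^sup>2 / 4 * b - (\<epsilon> * a\<^sup>2 + d * \<epsilon> * a * b) \<le> - (\<Sum>l\<in>S. G l) - (\<Sum>l\<in>S. (F l)\<^sup>2)" .
  have "0 \<le> (\<Sum>l\<in>S. (p l - F l * w)\<^sup>2)"
    by (simp add: sum_nonneg)
  also have "\<dots> = (\<Sum>l\<in>S. p l ^ 2) - (\<Sum>l\<in>S. G l * w\<^sup>2 + 2 * F l * w * p l)
      + ((\<Sum>l\<in>S. G l) + (\<Sum>l\<in>S. (F l)\<^sup>2)) * w\<^sup>2"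
    by (simp add: sum_distrib_right sum.distrib[symmetric] sum_subtractf[symmetric])
       (intro sum.cong refl, simp add: power2_eq_square algebra_simps)
  also have "((\<Sum>l\<in>S. G l) + (\<Sum>l\<in>S. (F l)\<^sup>2)) * w\<^sup>2 \<le> - (d\<^sup>2 / 4 * b - (\<epsilon> * a\<^sup>2 + d * \<epsilon> * a * b)) * w\<^sup>2"
    using key by (intro mult_right_mono) auto
  finally show ?thesis by (simp add: algebra_simps)
qed

lemma inverse_sqdist_continuous:
  fixes S :: "'a::euclidean_space set"
  assumes "\<delta> > 0"
  shows "continuous_on UNIV (\<lambda>x. 1 / (sqdist S x + \<delta>))"
  using sqdist_nonneg[of S] assms by (intro continuous_intros) (auto simp: add_nonneg_eq_0_iff)

lemma hardy_regularised:
  fixes v :: "'a::euclidean_space \<Rightarrow> real"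
  assumes S: "orthonormal S" "k \<in> S" and pos: "\<epsilon> > 0" "\<delta> > 0"
    and v: "\<And>l. l \<in> S \<Longrightarrow> C1_along l v (D l)"
  shows "(\<Sum>l\<in>S. \<integral>x. (D l x)\<^sup>2 \<partial>lborel) \<ge>
    (real (card S))\<^sup>2 / 4 * (\<integral>x. (v x)\<^sup>2 * (1 / (sqdist S x + \<delta>)) \<partial>lborel)
    - (\<integral>x. (v x)\<^sup>2 * (\<epsilon> * (1 / ((x \<bullet> k)\<^sup>2 + \<epsilon>))\<^sup>2
        + real (card S) * \<epsilon> * (1 / ((x \<bullet> k)\<^sup>2 + \<epsilon>)) * (1 / (sqdist S x + \<delta>))) \<partial>lborel)"
proof -
  define d where "d = real (card S)"
  define a where "a x = 1 / ((x \<bullet> k)\<^sup>2 + \<epsilon>)" for x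
  define b where "b x = 1 / (sqdist S x + \<delta>)" for x
  define F where "F l x = (if l = k then (x \<bullet> k) * a x else 0) - d / 2 * ((x \<bullet> l) * b x)" for l x
  define G where "G l x = (if l = k then a x - 2 * (x \<bullet> k)\<^sup>2 * (a x)\<^sup>2 else 0)
      - d / 2 * (b x - 2 * (x \<bullet> l)\<^sup>2 * (b x)\<^sup>2)" for l x
  have A: "(x \<bullet> k)\<^sup>2 + \<epsilon> > 0" "sqdist S x + \<delta> > 0" for x
    using pos sqdist_nonneg[of S x] by (auto simp: add_nonneg_pos)
  have cont: "continuous_on UNIV a" "continuous_on UNIV b"
    unfolding a_def[abs_def] b_def[abs_def] using A(1)
    by (auto intro!: continuous_intros inverse_sqdist_continuous pos simp: less_imp_neq[symmetric])
  have cF: "continuous_on UNIV (F l)" "continuous_on UNIV (G l)" for l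
    unfolding F_def[abs_def] G_def[abs_def]
    by (cases "l = k"; simp; intro continuous_intros cont)+
  have dF: "((\<lambda>t. F l (x + t *\<^sub>R l)) has_field_derivative G l x) (at 0)" if l: "l \<in> S" for l x
  proof -
    have b': "((\<lambda>t. (x \<bullet> l + t) * (1 / (sqdist S x + 2 * t * (x \<bullet> l) + t\<^sup>2 + \<delta>)))
        has_field_derivative (b x - 2 * (x \<bullet> l)\<^sup>2 * (b x)\<^sup>2)) (at 0)"
      using A(2)[of x]
      by (auto intro!: derivative_eq_intros simp: b_def divide_simps)
         (simp add: algebra_simps power2_eq_square)
    have ll: "l \<bullet> l = 1" "l \<noteq> k \<Longrightarrow> l \<bullet> k = 0"
      using S l by (auto simp: orthonormal_def)
    have eb: "((x + t *\<^sub>R l) \<bullet> l) * b (x + t *\<^sub>R l) = (x \<bullet> l + t) * (1 / (sqdist S x + 2 * t * (x \<bullet> l) + t\<^sup>2 + \<delta>))" for t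
      using ll by (simp add: b_def orthonormal_line[OF S(1) l] inner_add_left)
    show ?thesis
    proof (cases "l = k")
      case True
      have a': "((\<lambda>t. (x \<bullet> l + t) * (1 / ((x \<bullet> l + t)\<^sup>2 + \<epsilon>)))
          has_field_derivative (a x - 2 * (x \<bullet> k)\<^sup>2 * (a x)\<^sup>2)) (at 0)"
        using A(1)[of x] True
        by (auto intro!: derivative_eq_intros simp: a_def divide_simps)
           (simp add: algebra_simps power2_eq_square)
      have ea: "((x + t *\<^sub>R l) \<bullet> k) * a (x + t *\<^sub>R l) = (x \<bullet> l + t) * (1 / ((x \<bullet> l + t)\<^sup>2 + \<epsilon>))" for t
        using ll True by (simp add: a_def inner_add_left)
      show ?thesis
        unfolding F_def G_def eb ea if_P[OF True]
        by (intro DERIV_diff DERIV_cmult a' b')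
    next
      case False
      show ?thesis
        unfolding F_def G_def eb if_not_P[OF False]
        by (intro DERIV_diff DERIV_cmult b' DERIV_const)
    qed
  qed
  have C: "C1_along l (\<lambda>x. F l x * (v x)\<^sup>2) (\<lambda>x. G l x * (v x)\<^sup>2 + 2 * F l x * v x * D l x)" if "l \<in> S" for l
    by (intro C1_along_power2_mult v that cF dF)
  have CCv: "cont_csupp v" "\<And>l. l \<in> S \<Longrightarrow> cont_csupp (D l)"
    using v S(2) by (auto simp: C1_along_def)
  have i1: "integrable lborel (\<lambda>x. G l x * (v x)\<^sup>2 + 2 * F l x * v x * D l x)" if "l \<in> S" for l
    using C[OF that] by (auto simp: C1_along_def intro: cont_csupp_integrable)
  have i2: "integrable lborel (\<lambda>x. (v x)\<^sup>2 * b x)"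
    by (intro cont_csupp_integrable cont_csupp_mult cont_csupp_power2 CCv cont)
  have i3: "integrable lborel (\<lambda>x. (v x)\<^sup>2 * (\<epsilon> * (a x)\<^sup>2 + d * \<epsilon> * a x * b x))"
    by (intro cont_csupp_integrable cont_csupp_mult cont_csupp_power2 CCv continuous_intros cont)
  have i4: "integrable lborel (\<lambda>x. (D l x)\<^sup>2)" if "l \<in> S" for l
    by (intro cont_csupp_integrable cont_csupp_power2 CCv that)
  let ?R = "\<lambda>x. (\<Sum>l\<in>S. G l x * (v x)\<^sup>2 + 2 * F l x * v x * D l x) +
      (d\<^sup>2 / 4 * ((v x)\<^sup>2 * b x) - (v x)\<^sup>2 * (\<epsilon> * (a x)\<^sup>2 + d * \<epsilon> * a x * b x))"
  have "(\<integral>x. ?R x \<partial>lborel) \<le> (\<integral>x. (\<Sum>l\<in>S. (D l x)\<^sup>2) \<partial>lborel)"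
  proof (rule integral_mono)
    show "?R x \<le> (\<Sum>l\<in>S. (D l x)\<^sup>2)" for x
      using hardy_pointwise[OF S pos, of x "v x" "\<lambda>l. D l x", folded a_def b_def d_def, folded F_def G_def]
      by (simp add: algebra_simps)
  qed (use i1 i2 i3 i4 in auto)
  also have "(\<integral>x. ?R x \<partial>lborel) = (\<Sum>l\<in>S. 0)
      + (d\<^sup>2 / 4 * (\<integral>x. (v x)\<^sup>2 * b x \<partial>lborel) - (\<integral>x. (v x)\<^sup>2 * (\<epsilon> * (a x)\<^sup>2 + d * \<epsilon> * a x * b x) \<partial>lborel))"
    using i1 i2 i3 C[THEN C1_along_integral_derivative] by simp
  finally show ?thesis
    using i4 by (simp add: a_def b_def d_def)
qed

text \<open>Letting \<open>\<epsilon> \<rightarrow> 0\<close> in the preceding inequality. The error terms concentrate on \<open>x \<bullet> k = 0\<close>, where the odd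
  function \<open>v\<close> vanishes to first order; this is the only use of the oddness.\<close>
lemma hardy_odd_in_one_direction:
  fixes v :: "'a::euclidean_space \<Rightarrow> real"
  assumes S: "orthonormal S" "k \<in> S" and pos: "\<delta> > 0"
    and v: "\<And>l. l \<in> S \<Longrightarrow> C1_along l v (D l)"
    and odd: "\<And>x. v (reflect {k} x) = - v x"
  shows "(real (card S))\<^sup>2 / 4 * (\<integral>x. (v x)\<^sup>2 * (1 / (sqdist S x + \<delta>)) \<partial>lborel)
    \<le> (\<Sum>l\<in>S. \<integral>x. (D l x)\<^sup>2 \<partial>lborel)"
proof -
  define d where "d = real (card S)"
  define X where "X n = 1 / real (Suc n)" for n
  have X: "X \<longlonglongrightarrow> 0" "\<And>n. X n > 0" "\<And>n. X n \<le> 1"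
    using LIMSEQ_Suc[OF lim_1_over_n[where 'a = real]] by (auto simp: X_def[abs_def] field_simps)
  define a where "a n x = 1 / ((x \<bullet> k)\<^sup>2 + X n)" for n x
  define b where "b x = 1 / (sqdist S x + \<delta>)" for x
  let ?f = "\<lambda>n x. (v x)\<^sup>2 * (X n * (a n x)\<^sup>2 + d * X n * a n x * b x)"
  have v1: "C1_along k v (D k)" "cont_csupp v" "cont_csupp (D k)"
    using v[OF S(2)] by (auto simp: C1_along_def)
  obtain C where C: "C \<ge> 0" "\<And>x. \<bar>D k x\<bar> \<le> C"
    using cont_csupp_bounded[OF v1(3)] by metis
  obtain R where R: "\<And>x. norm x > R \<Longrightarrow> v x = 0"
    using v1(2) by (auto simp: cont_csupp_def)
  \<comment> \<open>Oddness gives \<open>2 v x = v x - v (reflect {k} x)\<close>, and the two points differ by a multiple of \<open>k\<close>.\<close>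
  have vle: "\<bar>v x\<bar> \<le> C * \<bar>x \<bullet> k\<bar>" for x
    using C1_along_lipschitz[OF v1(1) C(2), of x "- 2 * (x \<bullet> k)"] odd[of x]
    by (simp add: reflect_def abs_mult)
  have v2: "(v x)\<^sup>2 \<le> C\<^sup>2 * (x \<bullet> k)\<^sup>2" for x
    using power_mono[OF vle[of x], of 2] by (simp add: power_mult_distrib)
  have A: "(x \<bullet> k)\<^sup>2 + X n > 0" "sqdist S x + \<delta> > 0" for x n
    using pos X(2)[of n] sqdist_nonneg[of S x] by (auto simp: add_nonneg_pos)
  have a0: "a n x > 0" "b x > 0" for n x
    using A by (auto simp: a_def b_def)
  have ya: "(x \<bullet> k)\<^sup>2 * a n x \<le> 1" "X n * a n x \<le> 1" and b1: "b x \<le> 1 / \<delta>" for n x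
    using A(1)[of x n] A(2)[of x] X(2)[of n] pos sqdist_nonneg[of S x]
    by (auto simp: a_def b_def field_simps)
  have bound: "\<bar>?f n x\<bar> \<le> (C\<^sup>2 + d * C\<^sup>2 / \<delta>) * indicator (cball 0 R) x" for n x
  proof (cases "norm x \<le> R")
    case True
    have d0: "d \<ge> 0" by (simp add: d_def)
    have "?f n x \<le> (C\<^sup>2 * (x \<bullet> k)\<^sup>2) * (X n * (a n x)\<^sup>2 + d * X n * a n x * b x)"
      using v2[of x] X(2)[of n] a0(1)[of n x] a0(2)[of x] d0 by (intro mult_right_mono) auto
    also have "\<dots> = C\<^sup>2 * (((x \<bullet> k)\<^sup>2 * a n x) * (X n * a n x)) + d * C\<^sup>2 * (((x \<bullet> k)\<^sup>2 * a n x) * (X n * b x))"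
      by (simp add: power2_eq_square algebra_simps)
    also have "\<dots> \<le> C\<^sup>2 * (1 * 1) + d * C\<^sup>2 * (1 * (1 * (1 / \<delta>)))"
      using X(2,3)[of n] a0(1)[of n x] a0(2)[of x] b1[of x] ya(1)[of x n] ya(2)[of n x] d0 pos
      by (intro add_mono mult_left_mono mult_mono) auto
    finally show ?thesis
      using True X(2)[of n] a0(1)[of n x] a0(2)[of x] d0 by simp
  next
    case False
    then show ?thesis using R[of x] by simp
  qed
  have lim: "(\<lambda>n. ?f n x) \<longlonglongrightarrow> 0" for x
  proof (cases "x \<bullet> k = 0")
    case True
    then show ?thesis using vle[of x] by simp
  next
    case False
    then have "(\<lambda>n. ?f n x) \<longlonglongrightarrow> (v x)\<^sup>2 * (0 * (1 / ((x \<bullet> k)\<^sup>2 + 0))\<^sup>2 + d * 0 * (1 / ((x \<bullet> k)\<^sup>2 + 0)) * b x)"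
      unfolding a_def by (intro tendsto_intros X) auto
    then show ?thesis by simp
  qed
  have [measurable]: "v \<in> borel_measurable borel"
    using v1 by (auto intro: cont_csupp_borel)
  have [measurable]: "b \<in> borel_measurable borel"
    unfolding b_def[abs_def] by (intro borel_measurable_continuous_onI inverse_sqdist_continuous pos)
  have [measurable]: "a n \<in> borel_measurable borel" for n
    unfolding a_def[abs_def] by measurable
  have "(\<lambda>n. \<integral>x. ?f n x \<partial>lborel) \<longlonglongrightarrow> integral\<^sup>L lborel (\<lambda>_::'a. 0)"
    by (rule integral_dominated_convergence[where w = "\<lambda>x::'a. (C\<^sup>2 + d * C\<^sup>2 / \<delta>) * indicator (cball 0 R) x"])
       (use bound lim integrable_const_cball[of 1 R] in auto)
  then have "(\<lambda>n. d\<^sup>2 / 4 * (\<integral>x. (v x)\<^sup>2 * b x \<partial>lborel) - (\<integral>x. ?f n x \<partial>lborel))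
      \<longlonglongrightarrow> d\<^sup>2 / 4 * (\<integral>x. (v x)\<^sup>2 * b x \<partial>lborel) - integral\<^sup>L lborel (\<lambda>_::'a. 0)"
    by (intro tendsto_intros)
  then have "d\<^sup>2 / 4 * (\<integral>x. (v x)\<^sup>2 * b x \<partial>lborel) - integral\<^sup>L lborel (\<lambda>_::'a. 0) \<le> (\<Sum>l\<in>S. \<integral>x. (D l x)\<^sup>2 \<partial>lborel)"
    by (rule LIMSEQ_le_const2)
       (use hardy_regularised[OF S X(2) pos v] in \<open>auto simp: a_def b_def d_def\<close>)
  then show ?thesis
    by (simp add: b_def d_def)
qed

lemma C1_along_lincomb:
  assumes "C1_along h v v'" "C1_along h w w'" shows "C1_along h (\<lambda>x. a * v x + b * w x) (\<lambda>x. a * v' x + b * w' x)"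
  using assms by (auto simp: C1_along_def intro!: cont_csupp_add cont_csupp_cmult DERIV_add DERIV_cmult)

lemma cont_csupp_reflect:
  assumes "k \<bullet> k = 1" "cont_csupp f" shows "cont_csupp (\<lambda>x. f (reflect {k} x))"
proof -
  have "continuous_on UNIV (\<lambda>x. f (reflect {k} x))"
    using assms(2) by (auto simp: cont_csupp_def intro!: continuous_on_compose2[of UNIV f] continuous_intros)
  then show ?thesis
    using assms(2) unfolding cont_csupp_def by (metis norm_reflect_singleton[OF assms(1)])
qed

lemma C1_along_reflect:
  assumes S: "orthonormal S" "k \<in> S" "l \<in> S" and v: "C1_along l v v'"
  shows "C1_along l (\<lambda>x. v (reflect {k} x)) (\<lambda>x. (if l = k then - 1 else 1) * v' (reflect {k} x))"
proof -
  have k: "k \<bullet> k = 1" "l \<bullet> l = 1"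
    using S by (auto simp: orthonormal_def)
  let ?s = "if l = k then - 1 else 1 :: real"
  have line: "reflect {k} (x + t *\<^sub>R l) = reflect {k} x + (?s * t) *\<^sub>R l" for x t
    using S by (auto simp: reflect_line orthonormal_def algebra_simps simp flip: scaleR_left.add)
  have "((\<lambda>t. v (reflect {k} x + (?s * t) *\<^sub>R l)) has_field_derivative ?s * v' (reflect {k} x)) (at 0)" for x
  proof -
    have "((\<lambda>t. v (reflect {k} x + t *\<^sub>R l)) has_field_derivative v' (reflect {k} x)) (at (?s * 0))"
      using v by (simp add: C1_along_def)
    from DERIV_chain2[OF this DERIV_cmult_Id[of ?s]] show ?thesis
      by (simp add: mult.commute)
  qed
  then show ?thesis
    unfolding C1_along_def line using v by (intro conjI allI cont_csupp_reflect cont_csupp_cmult k) (auto simp: C1_along_def)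
qed

lemma integral_reflect:
  fixes f :: "'a::euclidean_space \<Rightarrow> real"
  assumes "distr lborel borel (reflect T) = lborel" "f \<in> borel_measurable borel"
  shows "(\<integral>x. f (reflect T x) \<partial>lborel) = (\<integral>x. f x \<partial>lborel)"
  using integral_distr[of "reflect T" lborel borel f] assms by simp

text \<open>Induction over the set \<open>T\<close> of directions: the part of \<open>v\<close> that is odd in \<open>k\<close> is covered by the
  inequality for one direction, and the part that is even in \<open>k\<close> changes sign under the
  reflection in the remaining directions. Invariance of Lebesgue measure is assumed for the reflections in a
  single direction; below they exchange two coordinates, where invariance is immediate.\<close>
lemma hardy_odd_smooth:
  fixes v :: "'a::euclidean_space \<Rightarrow> real"
  assumes S: "orthonormal S" and pos: "\<delta> > 0"
    and inv: "\<And>k. k \<in> S \<Longrightarrow> distr lborel borel (reflect {k}) = lborel"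
    and T: "T \<subseteq> S"
    and v: "\<And>l. l \<in> S \<Longrightarrow> C1_along l v (D l)"
    and odd: "\<And>x. v (reflect T x) = - v x"
  shows "(real (card S))\<^sup>2 / 4 * (\<integral>x. (v x)\<^sup>2 * (1 / (sqdist S x + \<delta>)) \<partial>lborel)
    \<le> (\<Sum>l\<in>S. \<integral>x. (D l x)\<^sup>2 \<partial>lborel)"
proof -
  have "finite T" using S T by (auto simp: orthonormal_def intro: finite_subset)
  then show ?thesis
    using T v odd
  proof (induction T arbitrary: v D)
    case empty
    then have "v = (\<lambda>_. 0)" by (auto simp: reflect_def fun_eq_iff)
    then show ?case by (simp add: sum_nonneg)
  next
    case (insert k T)
    have k: "k \<in> S" "k \<bullet> k = 1" and TS: "T \<subseteq> S"
      using insert.prems(1) S by (auto simp: orthonormal_def)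
    let ?R = "reflect {k}"
    define s where "s l = (if l = k then - 1 else 1 :: real)" for l
    define P where "P x = 1 / 2 * v x + 1 / 2 * v (?R x)" for x
    define Q where "Q x = 1 / 2 * v x + (- 1 / 2) * v (?R x)" for x
    define DP where "DP l x = 1 / 2 * D l x + 1 / 2 * (s l * D l (?R x))" for l x
    define DQ where "DQ l x = 1 / 2 * D l x + (- 1 / 2) * (s l * D l (?R x))" for l x
    have C: "C1_along l P (DP l)" "C1_along l Q (DQ l)" if "l \<in> S" for l
      unfolding P_def[abs_def] DP_def[abs_def] Q_def[abs_def] DQ_def[abs_def] s_def
      by (rule C1_along_lincomb[OF insert.prems(2)[OF that] C1_along_reflect[OF S k(1) that insert.prems(2)[OF that]]])+
    have RR: "?R (?R x) = x" for x
      by (rule reflect_singleton_involution[OF k(2)])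
    have oddQ: "Q (?R x) = - Q x" for x
      by (simp add: Q_def RR)
    have oddP: "P (reflect T x) = - P x" for x
    proof -
      have "v (reflect T x) = - v (?R x)"
        using insert.prems(3)[of "?R x"] reflect_insert(1)[OF S insert.prems(1) insert.hyps(2), of "?R x"]
        by (simp add: RR)
      moreover have "v (?R (reflect T x)) = - v x"
        using insert.prems(3)[of x] reflect_insert(2)[OF S insert.prems(1) insert.hyps(2), of x] by simp
      ultimately show ?thesis by (simp add: P_def)
    qed
    \<comment> \<open>The even and the odd part are orthogonal, by invariance of Lebesgue measure under the
      reflection. The sign \<open>c\<close> is minus one for the derivative in the direction \<open>k\<close>, which turns an odd
      function into an even one and conversely.\<close>
    have split: "(\<integral>x. ((f x)\<^sup>2) * w x \<partial>lborel) =
        (\<integral>x. (1 / 2 * f x + 1 / 2 * (c * f (?R x)))\<^sup>2 * w x \<partial>lborel) + (\<integral>x. (1 / 2 * f x + (- 1 / 2) * (c * f (?R x)))\<^sup>2 * w x \<partial>lborel)"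
      if f: "cont_csupp f" and c: "c\<^sup>2 = 1" and w: "continuous_on UNIV w" "\<And>x. w (?R x) = w x" for f w c
    proof -
      have fR: "cont_csupp (\<lambda>x. c * f (?R x))"
        by (intro cont_csupp_cmult cont_csupp_reflect f k)
      have i: "integrable lborel (\<lambda>x. (f x)\<^sup>2 * w x)"
        by (intro cont_csupp_integrable cont_csupp_mult cont_csupp_power2 f w)
      have [measurable]: "f \<in> borel_measurable borel" "w \<in> borel_measurable borel"
        using f w by (auto intro: cont_csupp_borel borel_measurable_continuous_onI)
      have i': "integrable lborel (\<lambda>x. (c * f (?R x))\<^sup>2 * w x)"
        by (intro cont_csupp_integrable cont_csupp_mult cont_csupp_power2 fR w)
      have "(\<integral>x. (1 / 2 * f x + 1 / 2 * (c * f (?R x)))\<^sup>2 * w x \<partial>lborel) + (\<integral>x. (1 / 2 * f x + (- 1 / 2) * (c * f (?R x)))\<^sup>2 * w x \<partial>lborel)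
        = (\<integral>x. (1 / 2 * f x + 1 / 2 * (c * f (?R x)))\<^sup>2 * w x + (1 / 2 * f x + (- 1 / 2) * (c * f (?R x)))\<^sup>2 * w x \<partial>lborel)"
        by (intro Bochner_Integration.integral_add[symmetric] cont_csupp_integrable cont_csupp_mult cont_csupp_power2 cont_csupp_add fR f w cont_csupp_cmult)
      also have "\<dots> = (\<integral>x. 1 / 2 * ((f x)\<^sup>2 * w x) + 1 / 2 * ((c * f (?R x))\<^sup>2 * w x) \<partial>lborel)"
        by (intro Bochner_Integration.integral_cong) (auto simp: power2_eq_square field_simps)
      also have "\<dots> = 1 / 2 * (\<integral>x. (f x)\<^sup>2 * w x \<partial>lborel) + 1 / 2 * (\<integral>x. (c * f (?R x))\<^sup>2 * w x \<partial>lborel)"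
        using i i' by simp
      also have "(\<integral>x. (c * f (?R x))\<^sup>2 * w x \<partial>lborel) = (\<integral>x. (f x)\<^sup>2 * w x \<partial>lborel)"
        using integral_reflect[OF inv[OF k(1)], of "\<lambda>x. (f x)\<^sup>2 * w x"] c by (simp add: w power_mult_distrib)
      finally show ?thesis by simp
    qed
    have sp: "(\<integral>x. (D l x)\<^sup>2 \<partial>lborel) = (\<integral>x. (DP l x)\<^sup>2 \<partial>lborel) + (\<integral>x. (DQ l x)\<^sup>2 \<partial>lborel)" if "l \<in> S" for l
      using split[of "D l" "s l" "\<lambda>_. 1"] insert.prems(2)[OF that]
      by (simp add: DP_def DQ_def C1_along_def s_def)
    have "cont_csupp v"
      using insert.prems(2)[OF k(1)] by (simp add: C1_along_def)
    then have spv: "(\<integral>x. (v x)\<^sup>2 * (1 / (sqdist S x + \<delta>)) \<partial>lborel) =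
       (\<integral>x. (P x)\<^sup>2 * (1 / (sqdist S x + \<delta>)) \<partial>lborel) + (\<integral>x. (Q x)\<^sup>2 * (1 / (sqdist S x + \<delta>)) \<partial>lborel)"
      using split[of v 1 "\<lambda>x. 1 / (sqdist S x + \<delta>)"] inverse_sqdist_continuous[OF pos, of S]
        sqdist_reflect[OF S, of "{k}"] k(1)
      by (simp add: P_def Q_def)
    have "(real (card S))\<^sup>2 / 4 * (\<integral>x. (v x)\<^sup>2 * (1 / (sqdist S x + \<delta>)) \<partial>lborel)
      = (real (card S))\<^sup>2 / 4 * (\<integral>x. (P x)\<^sup>2 * (1 / (sqdist S x + \<delta>)) \<partial>lborel)
      + (real (card S))\<^sup>2 / 4 * (\<integral>x. (Q x)\<^sup>2 * (1 / (sqdist S x + \<delta>)) \<partial>lborel)"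
      unfolding spv by (rule distrib_left)
    also have "\<dots> \<le> (\<Sum>l\<in>S. \<integral>x. (DP l x)\<^sup>2 \<partial>lborel) + (\<Sum>l\<in>S. \<integral>x. (DQ l x)\<^sup>2 \<partial>lborel)"
      by (intro add_mono insert.IH[OF TS C(1) oddP] hardy_odd_in_one_direction[OF S k(1) pos C(2) oddQ])
    also have "\<dots> = (\<Sum>l\<in>S. \<integral>x. (D l x)\<^sup>2 \<partial>lborel)"
      using sp by (simp add: sum.distrib)
    finally show ?case .
  qed
qed

section \<open>Mollification\<close>

text \<open>Convolution of real functions with respect to Lebesgue measure.\<close>
definition convolve :: "('a::euclidean_space \<Rightarrow> real) \<Rightarrow> ('a \<Rightarrow> real) \<Rightarrow> 'a \<Rightarrow> real" where
  "convolve r v x = (\<integral>z. r (x - z) * v z \<partial>lborel)"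

lemma cont_csupp_shift:
  assumes "cont_csupp r" shows "cont_csupp (\<lambda>z. r (x - z))" "cont_csupp (\<lambda>z. r (z - x))"
proof -
  obtain R where R: "\<And>w. norm w > R \<Longrightarrow> r w = 0"
    using assms by (auto simp: cont_csupp_def)
  have "r (x - z) = 0 \<and> r (z - x) = 0" if "norm z > R + norm x" for z
    using R[of "x - z"] R[of "z - x"] that norm_triangle_ineq2[of z x] by (simp add: norm_minus_commute)
  then have "\<exists>R. \<forall>z. norm z > R \<longrightarrow> r (x - z) = 0 \<and> r (z - x) = 0"
    by blast
  moreover have "continuous_on UNIV (\<lambda>z. r (x - z))" "continuous_on UNIV (\<lambda>z. r (z - x))"
    using assms by (auto simp: cont_csupp_def intro!: continuous_on_compose2[of UNIV r] continuous_intros)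
  ultimately show "cont_csupp (\<lambda>z. r (x - z))" "cont_csupp (\<lambda>z. r (z - x))"
    by (auto simp: cont_csupp_def)
qed

lemma cont_csupp_mult_integrable:
  assumes "cont_csupp f" "integrable lborel v" shows "integrable lborel (\<lambda>x. f x * v x)"
proof -
  obtain C where C: "\<And>x. \<bar>f x\<bar> \<le> C"
    using cont_csupp_bounded[OF assms(1)] by metis
  have [measurable]: "f \<in> borel_measurable borel"
    using assms cont_csupp_borel by auto
  show ?thesis
  proof (rule Bochner_Integration.integrable_bound)
    show "integrable lborel (\<lambda>x. C * \<bar>v x\<bar>)"
      using assms(2) by simp
    show "AE x in lborel. norm (f x * v x) \<le> norm (C * \<bar>v x\<bar>)"
      using C by (intro AE_I2) (auto simp: abs_mult intro!: mult_right_mono order_trans[OF C])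
  qed (use assms(2) in measurable)
qed

lemma continuous_on_convolve:
  assumes r: "cont_csupp r" and v: "integrable lborel v"
  shows "continuous_on UNIV (convolve r v)"
proof (intro continuous_at_imp_continuous_on ballI continuous_at_sequentiallyI)
  fix x :: 'a and u :: "nat \<Rightarrow> 'a"
  assume u: "u \<longlonglongrightarrow> x"
  obtain C where C: "\<And>x. \<bar>r x\<bar> \<le> C"
    using cont_csupp_bounded[OF r] by metis
  have [measurable]: "r \<in> borel_measurable borel" "v \<in> borel_measurable borel"
    using r v cont_csupp_borel by auto
  have "(\<lambda>n. \<integral>z. r (u n - z) * v z \<partial>lborel) \<longlonglongrightarrow> (\<integral>z. r (x - z) * v z \<partial>lborel)"
  proof (rule integral_dominated_convergence[where w = "\<lambda>z. C * \<bar>v z\<bar>"])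
    have "isCont r y" for y
      using r by (auto simp: cont_csupp_def continuous_on_eq_continuous_at)
    then have "(\<lambda>n. r (u n - z)) \<longlonglongrightarrow> r (x - z)" for z
      by (rule isCont_tendsto_compose) (intro tendsto_intros u)
    then show "AE z in lborel. (\<lambda>n. r (u n - z) * v z) \<longlonglongrightarrow> r (x - z) * v z"
      by (intro AE_I2 tendsto_intros)
    show "AE z in lborel. norm (r (u n - z) * v z) \<le> C * \<bar>v z\<bar>" for n
      using C by (intro AE_I2) (auto simp: abs_mult intro!: mult_right_mono)
  qed (use v in auto)
  then show "(\<lambda>n. convolve r v (u n)) \<longlonglongrightarrow> convolve r v x"
    by (simp add: convolve_def)
qed

lemma convolve_support:
  assumes "\<And>w. norm w > R \<Longrightarrow> r w = 0" "\<And>z. norm z > M \<Longrightarrow> v z = 0" "norm x > M + R"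
  shows "convolve r v x = 0"
proof -
  have "r (x - z) * v z = 0" for z
    using assms(1)[of "x - z"] assms(2)[of z] assms(3) norm_triangle_ineq2[of x z] by (cases "norm z > M") auto
  then show ?thesis by (simp only: convolve_def) simp
qed

lemma cont_csupp_convolve:
  assumes r: "cont_csupp r" and v: "integrable lborel v" "\<And>z. norm z > M \<Longrightarrow> v z = 0"
  shows "cont_csupp (convolve r v)"
proof -
  obtain R where R: "\<And>w. norm w > R \<Longrightarrow> r w = 0"
    using r by (auto simp: cont_csupp_def)
  have "convolve r v x = 0" if "norm x > M + R" for x
    by (rule convolve_support[of R r M v]) (use R v(2) that in auto)
  then show ?thesis
    using continuous_on_convolve[OF r v(1)] unfolding cont_csupp_def by blast
qed

lemma C1_along_convolve:
  assumes r: "C1_along h r r'" and v: "integrable lborel v" "\<And>z. norm z > M \<Longrightarrow> v z = 0"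
  shows "C1_along h (convolve r v) (convolve r' v)"
proof -
  have rr: "cont_csupp r" "cont_csupp r'"
    using r by (auto simp: C1_along_def)
  obtain C where C: "\<And>x. \<bar>r' x\<bar> \<le> C"
    using cont_csupp_bounded[OF rr(2)] by metis
  have [measurable]: "r \<in> borel_measurable borel" "r' \<in> borel_measurable borel" "v \<in> borel_measurable borel"
    using rr v cont_csupp_borel by auto
  have "((\<lambda>t. convolve r v (x + t *\<^sub>R h)) has_field_derivative convolve r' v x) (at 0)" for x
    unfolding has_field_derivative_iff tendsto_at_iff_sequentially o_def
  proof (intro allI impI)
    fix X :: "nat \<Rightarrow> real"
    assume "\<forall>i. X i \<in> UNIV - {0}" and X: "X \<longlonglongrightarrow> 0"
    then have X0: "X n \<noteq> 0" for n by auto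
    let ?q = "\<lambda>n z. (r ((x - z) + X n *\<^sub>R h) - r (x - z)) / X n * v z"
    have "(\<lambda>n. \<integral>z. ?q n z \<partial>lborel) \<longlonglongrightarrow> (\<integral>z. r' (x - z) * v z \<partial>lborel)"
    proof (rule integral_dominated_convergence[where w = "\<lambda>z. C * \<bar>v z\<bar>"])
      show "AE z in lborel. (\<lambda>n. ?q n z) \<longlonglongrightarrow> r' (x - z) * v z"
        using r X X0 by (intro AE_I2 tendsto_intros difference_quotient_tendsto) (auto simp: C1_along_def)
      have "\<bar>(r ((x - z) + X n *\<^sub>R h) - r (x - z)) / X n\<bar> \<le> C" for n z
        using C1_along_lipschitz[OF r C, of "x - z" "X n"] X0[of n] by (simp add: field_simps)
      then show "AE z in lborel. norm (?q n z) \<le> C * \<bar>v z\<bar>" for n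
        by (intro AE_I2) (simp only: real_norm_def abs_mult mult_right_mono abs_ge_zero)
    qed (use v in auto)
    moreover have "(\<integral>z. ?q n z \<partial>lborel) = (convolve r v (x + X n *\<^sub>R h) - convolve r v (x + 0 *\<^sub>R h)) / (X n - 0)" for n
    proof -
      have i: "integrable lborel (\<lambda>z. r (y - z) * v z)" for y
        by (intro cont_csupp_mult_integrable cont_csupp_shift rr v)
      have "(\<integral>z. ?q n z \<partial>lborel) = (\<integral>z. (r ((x + X n *\<^sub>R h) - z) * v z - r (x - z) * v z) / X n \<partial>lborel)"
        by (intro Bochner_Integration.integral_cong) (auto simp: algebra_simps diff_divide_distrib)
      also have "\<dots> = (convolve r v (x + X n *\<^sub>R h) - convolve r v x) / X n"
        unfolding convolve_def by (subst integral_divide_zero) (simp only: Bochner_Integration.integral_diff[OF i i])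
      finally show ?thesis by simp
    qed
    ultimately show "(\<lambda>n. (convolve r v (x + X n *\<^sub>R h) - convolve r v (x + 0 *\<^sub>R h)) / (X n - 0)) \<longlonglongrightarrow> convolve r' v x"
      by (simp only: convolve_def[of r' v])
  qed
  then show ?thesis
    using cont_csupp_convolve[OF rr(1) v] cont_csupp_convolve[OF rr(2) v] by (simp add: C1_along_def)
qed

lemma convolve_Fubini:
  assumes r: "cont_csupp r" and f: "integrable lborel f"
    and \<psi>: "\<psi> \<in> borel_measurable borel" "\<And>x. \<bar>\<psi> x\<bar> \<le> K"
  shows "integrable lborel (\<lambda>x. convolve r f x * \<psi> x)"
    and "(\<integral>x. convolve r f x * \<psi> x \<partial>lborel) = (\<integral>z. f z * (\<integral>x. r (x - z) * \<psi> x \<partial>lborel) \<partial>lborel)"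
proof -
  have [measurable]: "r \<in> borel_measurable borel" "f \<in> borel_measurable borel" "\<psi> \<in> borel_measurable borel"
    using r f \<psi> cont_csupp_borel by auto
  have K: "K \<ge> 0" using \<psi>(2)[of 0] by linarith
  define H where "H = (\<lambda>(z, x). r (x - z) * f z * \<psi> x)"
  have i\<psi>: "integrable lborel (\<lambda>x. r (x - z) * \<psi> x)" for z
  proof (rule Bochner_Integration.integrable_bound)
    show "integrable lborel (\<lambda>x. K * \<bar>r (x - z)\<bar>)"
      using cont_csupp_integrable[OF cont_csupp_shift(2)[OF r]] by (intro integrable_mult_right integrable_abs)
    show "AE x in lborel. norm (r (x - z) * \<psi> x) \<le> norm (K * \<bar>r (x - z)\<bar>)"
      using \<psi>(2) K by (intro AE_I2) (auto simp: abs_mult mult.commute intro!: mult_right_mono)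
  qed measurable
  have "integrable (lborel \<Otimes>\<^sub>M lborel) H"
  proof (rule lborel_pair.Fubini_integrable)
    show "H \<in> borel_measurable (lborel \<Otimes>\<^sub>M lborel)"
      unfolding H_def by measurable
    show "AE z in lborel. integrable lborel (\<lambda>x. H (z, x))"
    proof (intro AE_I2)
      fix z
      show "integrable lborel (\<lambda>x. H (z, x))"
        using integrable_mult_right[OF i\<psi>[of z], of "f z"] by (simp add: H_def mult_ac)
    qed
    show "integrable lborel (\<lambda>z. \<integral>x. norm (H (z, x)) \<partial>lborel)"
    proof (rule Bochner_Integration.integrable_bound)
      show "integrable lborel (\<lambda>z. \<bar>f z\<bar> * (K * (\<integral>x. \<bar>r x\<bar> \<partial>lborel)))"
        using f by simp
      show "(\<lambda>z. \<integral>x. norm (H (z, x)) \<partial>lborel) \<in> borel_measurable lborel"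
        unfolding H_def by measurable
      have "(\<integral>x. norm (H (z, x)) \<partial>lborel) \<le> \<bar>f z\<bar> * (K * (\<integral>x. \<bar>r x\<bar> \<partial>lborel))" for z
      proof -
        have "(\<integral>x. norm (H (z, x)) \<partial>lborel) = (\<integral>x. \<bar>f z\<bar> * \<bar>r (x - z) * \<psi> x\<bar> \<partial>lborel)"
          by (simp add: H_def abs_mult mult_ac)
        also have "\<dots> \<le> (\<integral>x. \<bar>f z\<bar> * (K * \<bar>r (x - z)\<bar>) \<partial>lborel)"
          using \<psi>(2) i\<psi>[of z] cont_csupp_integrable[OF cont_csupp_shift(2)[OF r], of z]
          by (intro integral_mono integrable_mult_right integrable_abs mult_left_mono)
             (auto simp: abs_mult mult.commute intro!: mult_right_mono)
        also have "\<dots> = \<bar>f z\<bar> * (K * (\<integral>x. \<bar>r x\<bar> \<partial>lborel))"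
          using integral_lborel_translate[of "\<lambda>x. \<bar>r x\<bar>" "- z"] by simp
        finally show ?thesis .
      qed
      moreover have "0 \<le> (\<integral>x. norm (H (z, x)) \<partial>lborel)" for z
        by simp
      ultimately show "AE z in lborel. norm (\<integral>x. norm (H (z, x)) \<partial>lborel) \<le> norm (\<bar>f z\<bar> * (K * (\<integral>x. \<bar>r x\<bar> \<partial>lborel)))"
        using K by (intro AE_I2) (auto simp: abs_mult)
    qed
  qed
  then have I: "integrable (lborel \<Otimes>\<^sub>M lborel) (case_prod (\<lambda>z x. r (x - z) * f z * \<psi> x))"
    by (simp add: H_def)
  have eq: "(\<integral>z. r (x - z) * f z * \<psi> x \<partial>lborel) = convolve r f x * \<psi> x" for x
    by (simp add: convolve_def)
  have eq': "(\<integral>x. r (x - z) * f z * \<psi> x \<partial>lborel) = f z * (\<integral>x. r (x - z) * \<psi> x \<partial>lborel)" for z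
    by (subst integral_mult_right_zero[symmetric]) (simp add: mult_ac)
  show "integrable lborel (\<lambda>x. convolve r f x * \<psi> x)"
    using lborel_pair.integrable_snd[OF I] by (simp only: eq)
  show "(\<integral>x. convolve r f x * \<psi> x \<partial>lborel) = (\<integral>z. f z * (\<integral>x. r (x - z) * \<psi> x \<partial>lborel) \<partial>lborel)"
    using lborel_pair.Fubini_integral[OF I] by (simp only: eq eq')
qed

lemma integral_lborel_minus:
  fixes f :: "'a::euclidean_space \<Rightarrow> 'b::{banach, second_countable_topology}"
  assumes "f \<in> borel_measurable borel"
  shows "(\<integral>z. f (x - z) \<partial>lborel) = (\<integral>z. f z \<partial>lborel)"
proof -
  have "lborel = distr lborel borel (\<lambda>z. x - z)"
    using lborel_affine[of "- 1" x] by (simp add: density_1)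
  then show ?thesis
    using assms integral_distr[of "\<lambda>z. x - z" lborel borel f] by simp
qed

text \<open>Jensen's inequality for the probability density \<open>z \<mapsto> r (x - z)\<close>.\<close>
lemma convolve_power2_le:
  assumes r: "cont_csupp r" "\<And>w. 0 \<le> r w" "(\<integral>w. r w \<partial>lborel) = 1"
    and g: "integrable lborel g" "integrable lborel (\<lambda>x. (g x)\<^sup>2)"
  shows "(convolve r g x)\<^sup>2 \<le> convolve r (\<lambda>z. (g z)\<^sup>2) x"
proof -
  have [measurable]: "r \<in> borel_measurable borel" using r cont_csupp_borel by auto
  have i: "integrable lborel (\<lambda>z. r (x - z) * g z)" "integrable lborel (\<lambda>z. r (x - z) * (g z)\<^sup>2)"
    "integrable lborel (\<lambda>z. r (x - z))"
    by (intro cont_csupp_mult_integrable cont_csupp_shift cont_csupp_integrable r g)+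
  have one: "(\<integral>z. r (x - z) \<partial>lborel) = 1"
  proof -
    have "(\<integral>z. r (x - z) \<partial>lborel) = (\<integral>z. r z \<partial>lborel)"
      by (rule integral_lborel_minus) measurable
    then show ?thesis using r by simp
  qed
  define m where "m = convolve r g x"
  have "0 \<le> (\<integral>z. r (x - z) * (g z - m)\<^sup>2 \<partial>lborel)"
    by (intro integral_nonneg_AE AE_I2 mult_nonneg_nonneg r) auto
  also have "\<dots> = (\<integral>z. r (x - z) * (g z)\<^sup>2 - 2 * m * (r (x - z) * g z) + m\<^sup>2 * r (x - z) \<partial>lborel)"
    by (simp add: power2_eq_square algebra_simps)
  also have "\<dots> = convolve r (\<lambda>z. (g z)\<^sup>2) x - 2 * m * m + m\<^sup>2"
    using i one by (simp add: convolve_def m_def)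
  finally show ?thesis
    by (simp add: m_def power2_eq_square)
qed

lemma integral_convolve_power2_le:
  assumes r: "cont_csupp r" "\<And>w. 0 \<le> r w" "(\<integral>w. r w \<partial>lborel) = 1"
    and g: "integrable lborel g" "integrable lborel (\<lambda>x. (g x)\<^sup>2)" "\<And>z. norm z > M \<Longrightarrow> g z = 0"
  shows "(\<integral>x. (convolve r g x)\<^sup>2 \<partial>lborel) \<le> (\<integral>x. (g x)\<^sup>2 \<partial>lborel)"
proof -
  have [measurable]: "r \<in> borel_measurable borel" using r cont_csupp_borel by auto
  have one: "(\<integral>x. r (x - z) \<partial>lborel) = 1" for z
    using integral_lborel_translate[of r "- z"] r(3) by simp
  have "(\<integral>x. (convolve r g x)\<^sup>2 \<partial>lborel) \<le> (\<integral>x. convolve r (\<lambda>z. (g z)\<^sup>2) x \<partial>lborel)"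
  proof (rule integral_mono)
    show "integrable lborel (convolve r (\<lambda>z. (g z)\<^sup>2))"
      using convolve_Fubini(1)[OF r(1) g(2), of "\<lambda>_. 1" 1] by simp
    show "integrable lborel (\<lambda>x. (convolve r g x)\<^sup>2)"
      by (rule cont_csupp_integrable[OF cont_csupp_power2[OF cont_csupp_convolve[OF r(1) g(1,3)]]])
  qed (intro convolve_power2_le r g)
  also have "\<dots> = (\<integral>z. (g z)\<^sup>2 \<partial>lborel)"
    using convolve_Fubini(2)[OF r(1) g(2), of "\<lambda>_. 1" 1] one by simp
  finally show ?thesis .
qed

text \<open>The bump function with support in the ball of radius \<open>1 / (n + 1)\<close>, normalised to integral one.\<close>
definition mollifier :: "nat \<Rightarrow> 'a::euclidean_space \<Rightarrow> real" where
  "mollifier n w = bump ((real (Suc n))\<^sup>2) w / (\<integral>z. bump ((real (Suc n))\<^sup>2) (z::'a) \<partial>lborel)"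

lemma cont_csupp_bump:
  fixes h :: "'a::euclidean_space"
  assumes "a > 0" shows "cont_csupp (bump a :: 'a \<Rightarrow> real)" "cont_csupp (bump_grad a h)"
  unfolding cont_csupp_def
  by (intro conjI continuous_on_bump continuous_on_bump_grad exI[of _ "1 / sqrt a"] allI impI
      bump_support[OF assms]; simp)+

lemma C1_along_bump: assumes "a > 0" shows "C1_along h (bump a) (bump_grad a h)"
proof -
  have "((\<lambda>t. bump a (x + t *\<^sub>R h)) has_field_derivative bump_grad a h x) (at 0)" for x
  proof -
    have "((\<lambda>t. x + t *\<^sub>R h) has_derivative (\<lambda>t. t *\<^sub>R h)) (at 0)"
      by (auto intro!: derivative_eq_intros)
    moreover have "(bump a has_derivative (\<lambda>h. bump_grad a h x)) (at (x + 0 *\<^sub>R h))"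
      using bump_has_derivative[of a x] by simp
    ultimately have "((\<lambda>t. bump a (x + t *\<^sub>R h)) has_derivative (\<lambda>t. bump_grad a (t *\<^sub>R h) x)) (at 0)"
      by (rule has_derivative_compose)
    moreover have "(\<lambda>t. bump_grad a (t *\<^sub>R h) x) = (*) (bump_grad a h x)"
      by (simp add: bump_grad_def fun_eq_iff mult_ac)
    ultimately show ?thesis
      by (simp add: has_field_derivative_def)
  qed
  then show ?thesis
    by (simp add: C1_along_def cont_csupp_bump assms)
qed

lemma integral_bump_pos:
  assumes "a > 0" shows "(\<integral>z. bump a (z::'a::euclidean_space) \<partial>lborel) > 0"
proof -
  define \<rho> where "\<rho> = 1 / sqrt (2 * a)"
  have \<rho>: "\<rho> > 0" using assms by (simp add: \<rho>_def)
  have le: "exp (- 2) * indicator (cball 0 \<rho>) z \<le> bump a z" for z :: 'a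
  proof (cases "norm z \<le> \<rho>")
    case True
    have "(norm z)\<^sup>2 \<le> \<rho>\<^sup>2"
      using True by (intro power_mono) auto
    then have "1 - a * (z \<bullet> z) \<ge> 1 / 2"
      using assms by (simp add: \<rho>_def power2_norm_eq_inner field_simps power_divide)
    then show ?thesis
      using True by (simp add: bump_def flat_def field_simps)
  next
    case False
    then show ?thesis by (simp add: bump_nonneg)
  qed
  have "0 < exp (- 2) * measure lborel (cball (0::'a) \<rho>)"
    using content_cball_pos[OF \<rho>, of "0::'a"] by simp
  also have "\<dots> = (\<integral>z. exp (- 2) * indicator (cball (0::'a) \<rho>) z \<partial>lborel)"
    by simp
  also have "\<dots> \<le> (\<integral>z. bump a (z::'a) \<partial>lborel)"
    using le cont_csupp_integrable[OF cont_csupp_bump(1)[OF assms]] by (intro integral_mono integrable_const_cball) auto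
  finally show ?thesis .
qed

lemma mollifier_props:
  shows cont_csupp_mollifier: "cont_csupp (mollifier n :: 'a::euclidean_space \<Rightarrow> real)"
    and mollifier_nonneg: "0 \<le> mollifier n (w::'a)"
    and integral_mollifier: "(\<integral>w. mollifier n (w::'a) \<partial>lborel) = 1"
    and mollifier_support: "norm w \<ge> 1 / real (Suc n) \<Longrightarrow> mollifier n (w::'a) = 0"
    and mollifier_cong_norm: "norm w = norm w' \<Longrightarrow> mollifier n w = mollifier n (w'::'a)"
proof -
  have a: "(real (Suc n))\<^sup>2 > 0" by simp
  note pos = integral_bump_pos[OF a, where 'a = 'a]
  show "cont_csupp (mollifier n :: 'a \<Rightarrow> real)"
    using cont_csupp_cmult[OF cont_csupp_bump(1)[OF a], of "1 / (\<integral>z. bump ((real (Suc n))\<^sup>2) (z::'a) \<partial>lborel)"]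
    by (simp add: mollifier_def[abs_def])
  show "0 \<le> mollifier n (w::'a)" for w
    using pos by (simp add: mollifier_def bump_nonneg)
  show "(\<integral>w. mollifier n (w::'a) \<partial>lborel) = 1"
    using pos unfolding mollifier_def by simp
  show "mollifier n w = 0" if "norm w \<ge> 1 / real (Suc n)" for w :: 'a
    using bump_support(1)[OF a, of w] that by (simp add: mollifier_def real_sqrt_abs)
  show "mollifier n w = mollifier n w'" if "norm w = norm w'" for w w' :: 'a
    using that by (simp add: mollifier_def bump_def dot_square_norm)
qed

lemma mollifier_approximates:
  fixes \<psi> :: "'a::euclidean_space \<Rightarrow> real"
  assumes \<psi>: "continuous_on UNIV \<psi>"
  shows "(\<lambda>n. \<integral>x. mollifier n (x - z) * \<psi> x \<partial>lborel) \<longlonglongrightarrow> \<psi> z"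
proof (rule LIMSEQ_I)
  fix e :: real assume e: "e > 0"
  have "isCont \<psi> z" using \<psi> by (simp add: continuous_on_eq_continuous_at)
  then obtain d where d: "d > 0" "\<And>x. norm (x - z) < d \<Longrightarrow> \<bar>\<psi> x - \<psi> z\<bar> < e / 2"
    using e unfolding continuous_at_eps_delta dist_norm real_norm_def by (metis half_gt_zero)
  obtain N where N: "1 / real (Suc N) < d"
    using nat_approx_posE[OF d(1)] by auto
  have "norm ((\<integral>x. mollifier n (x - z) * \<psi> x \<partial>lborel) - \<psi> z) < e" if n: "n \<ge> N" for n
  proof -
    have [measurable]: "mollifier n \<in> borel_measurable (borel :: 'a measure)"
      using cont_csupp_borel cont_csupp_mollifier by blast
    have i: "integrable lborel (\<lambda>x. mollifier n (x - z) * \<psi> x)" "integrable lborel (\<lambda>x. mollifier n (x - z))"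
      by (intro cont_csupp_integrable cont_csupp_mult cont_csupp_shift cont_csupp_mollifier \<psi>)+
    have one: "(\<integral>x. mollifier n (x - z) \<partial>lborel) = 1"
      using integral_lborel_translate[of "mollifier n" "- z"] integral_mollifier[of n, where 'a = 'a] by simp
    have "1 / real (Suc n) \<le> 1 / real (Suc N)"
      using n by (intro divide_left_mono) auto
    then have le: "\<bar>mollifier n (x - z) * (\<psi> x - \<psi> z)\<bar> \<le> mollifier n (x - z) * (e / 2)" for x
    proof (cases "norm (x - z) < d")
      case True
      then have "\<bar>\<psi> x - \<psi> z\<bar> \<le> e / 2"
        using d(2) by (simp add: less_imp_le)
      then have "mollifier n (x - z) * \<bar>\<psi> x - \<psi> z\<bar> \<le> mollifier n (x - z) * (e / 2)"
        by (rule mult_left_mono) (rule mollifier_nonneg)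
      then show ?thesis
        by (simp add: abs_mult mollifier_nonneg)
    next
      case False
      then show ?thesis
        using mollifier_support[of n "x - z"] N \<open>1 / real (Suc n) \<le> 1 / real (Suc N)\<close> by simp
    qed
    have "(\<integral>x. mollifier n (x - z) * \<psi> x \<partial>lborel) - \<psi> z = (\<integral>x. mollifier n (x - z) * \<psi> x - \<psi> z * mollifier n (x - z) \<partial>lborel)"
      using i one by simp
    also have "\<dots> = (\<integral>x. mollifier n (x - z) * (\<psi> x - \<psi> z) \<partial>lborel)"
      by (simp add: algebra_simps)
    finally have eq: "(\<integral>x. mollifier n (x - z) * \<psi> x \<partial>lborel) - \<psi> z = (\<integral>x. mollifier n (x - z) * (\<psi> x - \<psi> z) \<partial>lborel)" .
    have "norm (\<integral>x. mollifier n (x - z) * (\<psi> x - \<psi> z) \<partial>lborel) \<le> (\<integral>x. mollifier n (x - z) * (e / 2) \<partial>lborel)"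
      using i le by (intro Bochner_Integration.integral_norm_bound_integral) (auto simp: right_diff_distrib)
    also have "\<dots> = e / 2" using one by simp
    finally show ?thesis using e eq by simp
  qed
  then show "\<exists>no. \<forall>n\<ge>no. norm ((\<integral>x. mollifier n (x - z) * \<psi> x \<partial>lborel) - \<psi> z) < e"
    by blast
qed

section \<open>Weak directional derivatives and the limit of the Hardy inequality\<close>

text \<open>The test functions are continuously differentiable in the directions of the basis by definition; by
  linearity, they are so in all directions.\<close>
lemma test_function_C1_along:
  assumes "\<phi> \<in> test_functions"
  shows "C1_along h \<phi> (\<lambda>x. frechet_derivative \<phi> (at x) h)"
proof -
  have Ck: "Ck (Suc 0) \<phi>" "Ck 0 \<phi>" and comp: "compact (closure {x. \<phi> x \<noteq> 0})"
    using assms by (simp_all only: test_functions_def mem_Collect_eq)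
  note D = Ck_SucD[OF Ck(1)]
  obtain R where R: "\<And>x. x \<in> closure {x. \<phi> x \<noteq> 0} \<Longrightarrow> norm x \<le> R"
    using compact_imp_bounded[OF comp] unfolding bounded_iff by blast
  have z: "\<phi> x = 0" if "norm x > R" for x
  proof (rule ccontr)
    assume "\<phi> x \<noteq> 0"
    then have "x \<in> closure {x. \<phi> x \<noteq> 0}"
      using closure_subset[of "{x. \<phi> x \<noteq> 0}"] by auto
    then show False using R that by fastforce
  qed
  have z': "frechet_derivative \<phi> (at x) h = 0" if x: "norm x > R" for x
  proof -
    have op: "open {y::'a. norm y > R}"
      by (intro open_Collect_less continuous_intros)
    have "((\<lambda>_. 0) has_derivative (\<lambda>_. 0)) (at x)"
      by simp
    then have "(\<phi> has_derivative (\<lambda>_. 0)) (at x)"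
      by (rule has_derivative_transform_within_open[OF _ op]) (use x z in auto)
    from frechet_derivative_at[OF this] show ?thesis by metis
  qed
  have lin: "frechet_derivative \<phi> (at x) h = (\<Sum>b\<in>Basis. (h \<bullet> b) * frechet_derivative \<phi> (at x) b)" for x
  proof -
    interpret L: bounded_linear "frechet_derivative \<phi> (at x)"
      using D has_derivative_bounded_linear by blast
    have "frechet_derivative \<phi> (at x) h = frechet_derivative \<phi> (at x) (\<Sum>b\<in>Basis. (h \<bullet> b) *\<^sub>R b)"
      by (simp add: euclidean_representation)
    then show ?thesis by (simp add: L.sum L.scaleR)
  qed
  have "continuous_on UNIV (\<lambda>x. frechet_derivative \<phi> (at x) h)"
    unfolding lin using Ck(1) by (intro continuous_intros) auto
  moreover have "((\<lambda>t. \<phi> (x + t *\<^sub>R h)) has_field_derivative frechet_derivative \<phi> (at x) h) (at 0)" for x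
  proof -
    have "((\<lambda>t. x + t *\<^sub>R h) has_derivative (\<lambda>t. t *\<^sub>R h)) (at 0)"
      by (auto intro!: derivative_eq_intros)
    moreover have "(\<phi> has_derivative frechet_derivative \<phi> (at x)) (at (x + 0 *\<^sub>R h))"
      using D[of x] by simp
    ultimately have "((\<lambda>t. \<phi> (x + t *\<^sub>R h)) has_derivative (\<lambda>t. frechet_derivative \<phi> (at x) (t *\<^sub>R h))) (at 0)"
      by (rule has_derivative_compose)
    moreover have "(\<lambda>t. frechet_derivative \<phi> (at x) (t *\<^sub>R h)) = (*) (frechet_derivative \<phi> (at x) h)"
      using bounded_linear.linear[OF has_derivative_bounded_linear[OF D[of x]]]
      by (simp add: fun_eq_iff linear_cmul mult.commute)
    ultimately show ?thesis
      by (simp add: has_field_derivative_def)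
  qed
  ultimately show ?thesis
    using z z' Ck(2) by (auto simp: C1_along_def cont_csupp_def)
qed

text \<open>The square integrable function \<open>g\<close> is the weak derivative of the square integrable function \<open>v\<close> in
  the direction \<open>h\<close>, which need not be a basis vector. Representatives are Borel measurable, so that
  Fubini's theorem applies.\<close>
definition weak_dir_deriv :: "'a::euclidean_space \<Rightarrow> ('a \<Rightarrow> real) \<Rightarrow> ('a \<Rightarrow> real) \<Rightarrow> bool" where
  "weak_dir_deriv h v g \<longleftrightarrow> v \<in> borel_measurable borel \<and> g \<in> borel_measurable borel \<and>
     integrable lborel (\<lambda>x. (v x)\<^sup>2) \<and> integrable lborel (\<lambda>x. (g x)\<^sup>2) \<and>
     (\<forall>\<phi>\<in>test_functions. (\<integral>x. frechet_derivative \<phi> (at x) h * v x \<partial>lborel) = - (\<integral>x. \<phi> x * g x \<partial>lborel))"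

lemma cont_csupp_mult_L2_integrable:
  assumes f: "cont_csupp f" and [measurable]: "v \<in> borel_measurable borel" and v: "integrable lborel (\<lambda>x. (v x)\<^sup>2)"
  shows "integrable lborel (\<lambda>x. f x * v x)"
proof (rule Bochner_Integration.integrable_bound)
  show "integrable lborel (\<lambda>x. (f x)\<^sup>2 + (v x)\<^sup>2)"
    using v cont_csupp_integrable[OF cont_csupp_power2[OF f]] by simp
  have [measurable]: "f \<in> borel_measurable borel" using f cont_csupp_borel by auto
  show "(\<lambda>x. f x * v x) \<in> borel_measurable lborel" by measurable
  have "\<bar>f x * v x\<bar> \<le> (f x)\<^sup>2 + (v x)\<^sup>2" for x
    using sum_squares_bound[of "\<bar>f x\<bar>" "\<bar>v x\<bar>"] abs_ge_zero[of "f x * v x"]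
    unfolding power2_abs mult.assoc abs_mult[symmetric] by linarith
  then show "AE x in lborel. norm (f x * v x) \<le> norm ((f x)\<^sup>2 + (v x)\<^sup>2)"
    by (intro AE_I2) auto
qed

lemma L2_bounded_support_integrable:
  assumes [measurable]: "v \<in> borel_measurable borel" and v: "integrable lborel (\<lambda>x. (v x)\<^sup>2)"
    and M: "\<And>z::'a::euclidean_space. norm z > M \<Longrightarrow> v z = (0::real)"
  shows "integrable lborel v"
proof (rule Bochner_Integration.integrable_bound)
  show "integrable lborel (\<lambda>x. 1 * indicator (cball (0::'a) M) x + (v x)\<^sup>2)"
    by (intro Bochner_Integration.integrable_add v integrable_const_cball)
  have "\<bar>v x\<bar> \<le> indicator (cball 0 M) x + (v x)\<^sup>2" for x
  proof (cases "norm x \<le> M")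
    case True
    have "\<bar>v x\<bar> \<le> 1 + (v x)\<^sup>2"
      using sum_squares_bound[of 1 "\<bar>v x\<bar>"] by simp
    then show ?thesis using True by simp
  qed (use M in auto)
  then show "AE x in lborel. norm (v x) \<le> norm (1 * indicator (cball 0 M) x + (v x)\<^sup>2)"
    by (intro AE_I2) auto
qed auto

text \<open>The function \<open>z \<mapsto> mollifier n (x - z)\<close> is a test function up to a factor, hence convolution
  moves the weak derivative from the mollifier to \<open>g\<close>.\<close>
lemma C1_along_convolve_mollifier:
  assumes w: "weak_dir_deriv h v g" and v: "integrable lborel v" "\<And>z. norm z > M \<Longrightarrow> v z = 0"
  shows "C1_along h (convolve (mollifier n) v) (convolve (mollifier n) g)"
proof -
  define a where "a = (real (Suc n))\<^sup>2"
  have a: "a > 0" by (simp add: a_def)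
  define I where "I = (\<integral>z. bump a (z::'a) \<partial>lborel)"
  let ?r' = "\<lambda>w. bump_grad a h w / I"
  have "C1_along h (\<lambda>w. 1 / I * bump a w + 0 * bump a w) (\<lambda>w. 1 / I * bump_grad a h w + 0 * bump_grad a h w)"
    by (intro C1_along_lincomb C1_along_bump a)
  then have "C1_along h (mollifier n) ?r'"
    by (simp add: mollifier_def[abs_def] a_def I_def)
  from C1_along_convolve[OF this v] have "C1_along h (convolve (mollifier n) v) (convolve ?r' v)" .
  moreover have "convolve ?r' v x = convolve (mollifier n) g x" for x
  proof -
    have "convolve ?r' v x = (\<integral>z. - (bump_grad a h (z - x) * v z) / I \<partial>lborel)"
      unfolding convolve_def bump_grad_minus[of a h x] by (simp add: mult_ac)
    also have "\<dots> = - (\<integral>z. frechet_derivative (\<lambda>z. bump a (z - x)) (at z) h * v z \<partial>lborel) / I"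
      by (simp add: frechet_derivative_bump_shift)
    also have "\<dots> = (\<integral>z. bump a (z - x) * g z \<partial>lborel) / I"
      using w bump_shift_test_function[OF a, of x] by (simp add: weak_dir_deriv_def)
    also have "\<dots> = (\<integral>z. bump a (z - x) * g z / I \<partial>lborel)"
      by simp
    also have "\<dots> = convolve (mollifier n) g x"
      unfolding convolve_def mollifier_def a_def[symmetric] I_def[symmetric] bump_minus[of a x] by simp
    finally show ?thesis .
  qed
  then have "convolve ?r' v = convolve (mollifier n) g"
    by (rule ext)
  ultimately show ?thesis by simp
qed

text \<open>The inequality in dual form, where \<open>v\<close> enters the potential term linearly. It is obtained for the
  mollified functions from \<open>V\<^sup>2 \<ge> 2 V \<psi> - \<psi>\<^sup>2\<close>; the limit only needs \<open>mollifier n\<close> to approximate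
  the continuous function \<open>\<psi> / (sqdist S + \<delta>)\<close> pointwise. The indicator function keeps the last integral finite.\<close>
lemma hardy_weak_dual:
  fixes v :: "'a::euclidean_space \<Rightarrow> real"
  assumes S: "orthonormal S" and pos: "\<delta> > 0"
    and inv: "\<And>k. k \<in> S \<Longrightarrow> distr lborel borel (reflect {k}) = lborel"
    and v: "v \<in> borel_measurable borel" "integrable lborel (\<lambda>x. (v x)\<^sup>2)" "\<And>z. norm z > M \<Longrightarrow> v z = 0"
    and g: "\<And>l. l \<in> S \<Longrightarrow> weak_dir_deriv l v (g l)" "\<And>l z. l \<in> S \<Longrightarrow> norm z > M \<Longrightarrow> g l z = 0"
    and odd: "AE z in lborel. v (reflect S z) = - v z"
    and \<psi>: "continuous_on UNIV \<psi>" "\<And>x. \<bar>\<psi> x\<bar> \<le> K"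
  shows "(real (card S))\<^sup>2 / 4 * (2 * (\<integral>x. v x * \<psi> x * (1 / (sqdist S x + \<delta>)) \<partial>lborel)
      - (\<integral>x. (\<psi> x)\<^sup>2 * (1 / (sqdist S x + \<delta>)) * indicator (cball 0 (M + 1)) x \<partial>lborel))
    \<le> (\<Sum>l\<in>S. \<integral>x. (g l x)\<^sup>2 \<partial>lborel)"
proof -
  define c where "c = (real (card S))\<^sup>2 / 4"
  have c: "c \<ge> 0" by (simp add: c_def)
  define \<omega> where "\<omega> x = 1 / (sqdist S x + \<delta>)" for x
  have \<omega>c: "continuous_on UNIV \<omega>"
    unfolding \<omega>_def[abs_def] by (rule inverse_sqdist_continuous[OF pos])
  have \<omega>: "0 < \<omega> x" "\<omega> x \<le> 1 / \<delta>" for x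
    using sqdist_nonneg[of S x] pos by (auto simp: \<omega>_def field_simps add_nonneg_pos)
  have vi: "integrable lborel v"
    by (rule L2_bounded_support_integrable[OF v])
  have g2: "g l \<in> borel_measurable borel" "integrable lborel (\<lambda>x. (g l x)\<^sup>2)" if "l \<in> S" for l
    using g(1)[OF that] by (simp_all add: weak_dir_deriv_def)
  have gi: "integrable lborel (g l)" if "l \<in> S" for l
    by (rule L2_bounded_support_integrable[OF g2[OF that] g(2)[OF that]])
  define V where "V n = convolve (mollifier n) v" for n
  have [measurable]: "v \<in> borel_measurable borel" "\<psi> \<in> borel_measurable borel" "\<omega> \<in> borel_measurable borel"
    using v \<psi> \<omega>c by (auto intro: borel_measurable_continuous_onI)
  have K: "K \<ge> 0" using \<psi>(2)[of 0] by linarith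
  have \<psi>\<omega>: "\<bar>\<psi> x * \<omega> x\<bar> \<le> K * (1 / \<delta>)" for x
    using \<psi>(2)[of x] \<omega>[of x] K unfolding abs_mult by (intro mult_mono) auto
  have CV: "cont_csupp (V n)" for n
    unfolding V_def by (rule cont_csupp_convolve[OF cont_csupp_mollifier vi v(3)])
  have V0: "V n x = 0" if "norm x > M + 1" for n x
    unfolding V_def
  proof (rule convolve_support[OF _ v(3) that])
    show "mollifier n w = 0" if "norm w > 1" for w :: 'a
    proof (rule mollifier_support)
      have "1 / real (Suc n) \<le> 1" by simp
      then show "1 / real (Suc n) \<le> norm w" using that by linarith
    qed
  qed
  have odd_V: "V n (reflect S x) = - V n x" for n x
  proof -
    have [measurable]: "mollifier n \<in> borel_measurable (borel :: 'a measure)"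
      using cont_csupp_borel cont_csupp_mollifier by blast
    note R = reflect_isometry[OF S subset_refl inv]
    have "V n (reflect S x) = (\<integral>z. mollifier n (reflect S x - reflect S z) * v (reflect S z) \<partial>lborel)"
      unfolding V_def convolve_def by (rule integral_reflect[symmetric, OF R(2)]) auto
    also have "\<dots> = (\<integral>z. mollifier n (x - z) * - v z \<partial>lborel)"
    proof (rule integral_cong_AE)
      have "mollifier n (reflect S x - reflect S z) = mollifier n (x - z)" for z
        using R(1)[of "x - z"] by (intro mollifier_cong_norm) (simp add: reflect_diff)
      then show "AE z in lborel. mollifier n (reflect S x - reflect S z) * v (reflect S z) = mollifier n (x - z) * - v z"
        using odd by auto
    qed measurable
    also have "\<dots> = - V n x"
      by (simp add: V_def convolve_def)
    finally show ?thesis .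
  qed
  let ?B = "indicator (cball 0 (M + 1)) :: 'a \<Rightarrow> real"
  have iB: "integrable lborel (\<lambda>x. (\<psi> x)\<^sup>2 * \<omega> x * ?B x)"
  proof -
    have "continuous_on UNIV (\<lambda>x. (\<psi> x)\<^sup>2 * \<omega> x)"
      by (intro continuous_intros \<psi> \<omega>c)
    then show ?thesis
      using borel_integrable_compact[of "cball 0 (M + 1)" "\<lambda>x. (\<psi> x)\<^sup>2 * \<omega> x"]
        continuous_on_subset by (fastforce simp: mult_ac)
  qed
  have step: "c * (2 * (\<integral>x. V n x * (\<psi> x * \<omega> x) \<partial>lborel) - (\<integral>x. (\<psi> x)\<^sup>2 * \<omega> x * ?B x \<partial>lborel))
      \<le> (\<Sum>l\<in>S. \<integral>x. (g l x)\<^sup>2 \<partial>lborel)" for n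
  proof -
    have i1: "integrable lborel (\<lambda>x. V n x * (\<psi> x * \<omega> x))" "integrable lborel (\<lambda>x. (V n x)\<^sup>2 * \<omega> x)"
      by (intro cont_csupp_integrable cont_csupp_mult cont_csupp_power2 CV continuous_intros \<psi> \<omega>c)+
    have "2 * (\<integral>x. V n x * (\<psi> x * \<omega> x) \<partial>lborel) - (\<integral>x. (\<psi> x)\<^sup>2 * \<omega> x * ?B x \<partial>lborel)
      = (\<integral>x. 2 * (V n x * (\<psi> x * \<omega> x)) - (\<psi> x)\<^sup>2 * \<omega> x * ?B x \<partial>lborel)"
      using i1 iB by simp
    also have "\<dots> \<le> (\<integral>x. (V n x)\<^sup>2 * \<omega> x \<partial>lborel)"
    proof (rule integral_mono)
      show "2 * (V n x * (\<psi> x * \<omega> x)) - (\<psi> x)\<^sup>2 * \<omega> x * ?B x \<le> (V n x)\<^sup>2 * \<omega> x" for x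
      proof (cases "norm x \<le> M + 1")
        case True
        have "0 \<le> (V n x - \<psi> x)\<^sup>2 * \<omega> x"
          using \<omega>(1)[of x] by simp
        then show ?thesis using True by (simp add: power2_eq_square algebra_simps)
      qed (use V0 in auto)
    qed (use i1 iB in auto)
    finally have "c * (2 * (\<integral>x. V n x * (\<psi> x * \<omega> x) \<partial>lborel) - (\<integral>x. (\<psi> x)\<^sup>2 * \<omega> x * ?B x \<partial>lborel))
      \<le> c * (\<integral>x. (V n x)\<^sup>2 * \<omega> x \<partial>lborel)"
      using c by (rule mult_left_mono)
    also have "\<dots> \<le> (\<Sum>l\<in>S. \<integral>x. (convolve (mollifier n) (g l) x)\<^sup>2 \<partial>lborel)"
      unfolding c_def \<omega>_def
      by (rule hardy_odd_smooth[where T = S and v = "V n", OF S pos inv subset_refl _ odd_V])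
         (auto simp: V_def intro!: C1_along_convolve_mollifier g vi v)
    also have "\<dots> \<le> (\<Sum>l\<in>S. \<integral>x. (g l x)\<^sup>2 \<partial>lborel)"
      by (intro sum_mono integral_convolve_power2_le[OF cont_csupp_mollifier mollifier_nonneg integral_mollifier]
            gi g2 g(2))
    finally show ?thesis .
  qed
  have "(\<lambda>n. \<integral>z. v z * (\<integral>x. mollifier n (x - z) * (\<psi> x * \<omega> x) \<partial>lborel) \<partial>lborel) \<longlonglongrightarrow> (\<integral>z. v z * (\<psi> z * \<omega> z) \<partial>lborel)"
  proof (rule integral_dominated_convergence[where w = "\<lambda>z. \<bar>v z\<bar> * (K * (1 / \<delta>))"])
    have [measurable]: "mollifier n \<in> borel_measurable (borel :: 'a measure)" for n
      using cont_csupp_borel cont_csupp_mollifier by blast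
    show "(\<lambda>z. v z * (\<integral>x. mollifier n (x - z) * (\<psi> x * \<omega> x) \<partial>lborel)) \<in> borel_measurable lborel" for n
      by measurable
    show "integrable lborel (\<lambda>z. \<bar>v z\<bar> * (K * (1 / \<delta>)))"
      using vi by simp
    show "AE z in lborel. (\<lambda>n. v z * (\<integral>x. mollifier n (x - z) * (\<psi> x * \<omega> x) \<partial>lborel)) \<longlonglongrightarrow> v z * (\<psi> z * \<omega> z)"
      by (intro AE_I2 tendsto_intros mollifier_approximates continuous_intros \<psi> \<omega>c)
    have "\<bar>\<integral>x. mollifier n (x - z) * (\<psi> x * \<omega> x) \<partial>lborel\<bar> \<le> K * (1 / \<delta>)" for n z
    proof -
      have i: "integrable lborel (\<lambda>x. mollifier n (x - z) * (\<psi> x * \<omega> x))" "integrable lborel (\<lambda>x. mollifier n (x - z))"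
        by (intro cont_csupp_integrable cont_csupp_mult cont_csupp_shift cont_csupp_mollifier continuous_intros \<psi> \<omega>c)+
      have "norm (\<integral>x. mollifier n (x - z) * (\<psi> x * \<omega> x) \<partial>lborel) \<le> (\<integral>x. mollifier n (x - z) * (K * (1 / \<delta>)) \<partial>lborel)"
      proof (rule Bochner_Integration.integral_norm_bound_integral)
        show "norm (mollifier n (x - z) * (\<psi> x * \<omega> x)) \<le> mollifier n (x - z) * (K * (1 / \<delta>))" for x
          using mult_left_mono[OF \<psi>\<omega>[of x] mollifier_nonneg[of n "x - z"]] mollifier_nonneg[of n "x - z"]
          by (simp add: abs_mult)
      qed (use i in auto)
      also have "\<dots> = K * (1 / \<delta>)"
        using integral_lborel_translate[of "mollifier n" "- z"] integral_mollifier[of n, where 'a = 'a] by simp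
      finally show ?thesis by simp
    qed
    then show "AE z in lborel. norm (v z * (\<integral>x. mollifier n (x - z) * (\<psi> x * \<omega> x) \<partial>lborel)) \<le> \<bar>v z\<bar> * (K * (1 / \<delta>))" for n
      by (intro AE_I2) (simp only: real_norm_def abs_mult mult_left_mono abs_ge_zero)
  qed measurable
  then have "(\<lambda>n. \<integral>x. V n x * (\<psi> x * \<omega> x) \<partial>lborel) \<longlonglongrightarrow> (\<integral>z. v z * (\<psi> z * \<omega> z) \<partial>lborel)"
    unfolding V_def using convolve_Fubini(2)[OF cont_csupp_mollifier vi _ \<psi>\<omega>] by simp
  then have "(\<lambda>n. c * (2 * (\<integral>x. V n x * (\<psi> x * \<omega> x) \<partial>lborel) - (\<integral>x. (\<psi> x)\<^sup>2 * \<omega> x * ?B x \<partial>lborel)))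
    \<longlonglongrightarrow> c * (2 * (\<integral>z. v z * (\<psi> z * \<omega> z) \<partial>lborel) - (\<integral>x. (\<psi> x)\<^sup>2 * \<omega> x * ?B x \<partial>lborel))"
    by (intro tendsto_intros)
  from LIMSEQ_le_const2[OF this] step show ?thesis
    by (auto simp: c_def \<omega>_def mult.assoc)
qed

text \<open>Every measurable \<open>v\<close> is a limit almost everywhere of continuous functions. These are inserted for \<open>\<psi>\<close>
  in the dual form after truncation at the level \<open>K\<close>, and then \<open>K \<rightarrow> \<infinity>\<close>.\<close>
lemma hardy_weak_bounded_support:
  fixes v :: "'a::euclidean_space \<Rightarrow> real"
  assumes S: "orthonormal S" and pos: "\<delta> > 0"
    and inv: "\<And>k. k \<in> S \<Longrightarrow> distr lborel borel (reflect {k}) = lborel"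
    and v: "v \<in> borel_measurable borel" "integrable lborel (\<lambda>x. (v x)\<^sup>2)" "\<And>z. norm z > M \<Longrightarrow> v z = 0"
    and g: "\<And>l. l \<in> S \<Longrightarrow> weak_dir_deriv l v (g l)" "\<And>l z. l \<in> S \<Longrightarrow> norm z > M \<Longrightarrow> g l z = 0"
    and odd: "AE z in lborel. v (reflect S z) = - v z"
  shows "(real (card S))\<^sup>2 / 4 * (\<integral>x. (v x)\<^sup>2 * (1 / (sqdist S x + \<delta>)) \<partial>lborel)
    \<le> (\<Sum>l\<in>S. \<integral>x. (g l x)\<^sup>2 \<partial>lborel)"
proof -
  define c where "c = (real (card S))\<^sup>2 / 4"
  define E where "E = (\<Sum>l\<in>S. \<integral>x. (g l x)\<^sup>2 \<partial>lborel)"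
  define \<omega> where "\<omega> x = 1 / (sqdist S x + \<delta>)" for x
  have \<omega>c: "continuous_on UNIV \<omega>"
    unfolding \<omega>_def[abs_def] by (rule inverse_sqdist_continuous[OF pos])
  have \<omega>: "0 < \<omega> x" "\<omega> x \<le> 1 / \<delta>" for x
    using sqdist_nonneg[of S x] pos by (auto simp: \<omega>_def field_simps add_nonneg_pos)
  have vi: "integrable lborel v"
    using L2_bounded_support_integrable[OF v] .
  have [measurable]: "v \<in> borel_measurable borel" "\<omega> \<in> borel_measurable borel"
    using v \<omega>c by (auto intro: borel_measurable_continuous_onI)
  let ?B = "indicator (cball 0 (M + 1)) :: 'a \<Rightarrow> real"
  define clamp where "clamp K t = max (- K) (min K t)" for K t :: real
  have clamp: "\<bar>clamp K t\<bar> \<le> K" if "K \<ge> 0" for K t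
    using that by (auto simp: clamp_def)
  have clamp': "\<bar>clamp K t\<bar> \<le> \<bar>t\<bar>" if "K \<ge> 0" for K t
    using that by (auto simp: clamp_def)
  have [measurable]: "clamp K \<in> borel_measurable borel" for K
    unfolding clamp_def by measurable
  have "v measurable_on UNIV"
    using v(1) by (intro lebesgue_measurable_imp_measurable_on measurable_completion) auto
  then obtain N f where N: "negligible N" and fc: "\<And>n. continuous_on UNIV (f n)"
    and lim: "\<And>x. x \<notin> N \<Longrightarrow> (\<lambda>n. f n x) \<longlonglongrightarrow> v x"
    unfolding measurable_on_def by auto
  have [measurable]: "cball (0::'a) (M + 1) \<in> sets borel"
    by simp
  have AEN: "AE x in lborel. x \<notin> N"
    using AE_not_in[of N lebesgue] N by (simp add: negligible_iff_null_sets AE_completion_iff)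
  have trunc: "c * (2 * (\<integral>x. v x * clamp K (v x) * \<omega> x \<partial>lborel)
      - (\<integral>x. (clamp K (v x))\<^sup>2 * \<omega> x * ?B x \<partial>lborel)) \<le> E" if K: "K \<ge> 0" for K
  proof -
    have lc: "(\<lambda>n. clamp K (f n x)) \<longlonglongrightarrow> clamp K (v x)" if "x \<notin> N" for x
      unfolding clamp_def using lim[OF that] by (intro tendsto_intros)
    have cc: "continuous_on UNIV (\<lambda>x. clamp K (f n x))" for n
      unfolding clamp_def using fc by (intro continuous_intros)
    have [measurable]: "f n \<in> borel_measurable borel" for n
      using fc by (rule borel_measurable_continuous_onI)
    have 1: "(\<lambda>n. \<integral>x. v x * clamp K (f n x) * \<omega> x \<partial>lborel) \<longlonglongrightarrow> (\<integral>x. v x * clamp K (v x) * \<omega> x \<partial>lborel)"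
    proof (rule integral_dominated_convergence[where w = "\<lambda>x. \<bar>v x\<bar> * K * (1 / \<delta>)"])
      show "AE x in lborel. (\<lambda>n. v x * clamp K (f n x) * \<omega> x) \<longlonglongrightarrow> v x * clamp K (v x) * \<omega> x"
        using AEN lc by (auto intro!: tendsto_intros elim!: eventually_mono)
      have "\<bar>v x * clamp K (f n x) * \<omega> x\<bar> \<le> \<bar>v x\<bar> * K * (1 / \<delta>)" for n x
        unfolding abs_mult using clamp[OF K, of "f n x"] \<omega>[of x] K by (intro mult_mono) auto
      then show "AE x in lborel. norm (v x * clamp K (f n x) * \<omega> x) \<le> \<bar>v x\<bar> * K * (1 / \<delta>)" for n
        by auto
      show "integrable lborel (\<lambda>x. \<bar>v x\<bar> * K * (1 / \<delta>))"
        using vi by simp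
    qed measurable
    have 2: "(\<lambda>n. \<integral>x. (clamp K (f n x))\<^sup>2 * \<omega> x * ?B x \<partial>lborel) \<longlonglongrightarrow> (\<integral>x. (clamp K (v x))\<^sup>2 * \<omega> x * ?B x \<partial>lborel)"
    proof (rule integral_dominated_convergence[where w = "\<lambda>x. K\<^sup>2 * (1 / \<delta>) * ?B x"])
      show "AE x in lborel. (\<lambda>n. (clamp K (f n x))\<^sup>2 * \<omega> x * ?B x) \<longlonglongrightarrow> (clamp K (v x))\<^sup>2 * \<omega> x * ?B x"
        using AEN lc by (auto intro!: tendsto_intros elim!: eventually_mono)
      have "\<bar>(clamp K (f n x))\<^sup>2 * \<omega> x * ?B x\<bar> \<le> K\<^sup>2 * (1 / \<delta>) * ?B x" for n x
        unfolding abs_mult using power_mono[OF clamp[OF K, of "f n x"], of 2] \<omega>[of x] pos by (intro mult_mono) auto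
      then show "AE x in lborel. norm ((clamp K (f n x))\<^sup>2 * \<omega> x * ?B x) \<le> K\<^sup>2 * (1 / \<delta>) * ?B x" for n
        by auto
      show "integrable lborel (\<lambda>x. K\<^sup>2 * (1 / \<delta>) * ?B x)"
        by (rule integrable_const_cball)
    qed measurable
    have "(\<lambda>n. c * (2 * (\<integral>x. v x * clamp K (f n x) * \<omega> x \<partial>lborel) - (\<integral>x. (clamp K (f n x))\<^sup>2 * \<omega> x * ?B x \<partial>lborel)))
       \<longlonglongrightarrow> c * (2 * (\<integral>x. v x * clamp K (v x) * \<omega> x \<partial>lborel) - (\<integral>x. (clamp K (v x))\<^sup>2 * \<omega> x * ?B x \<partial>lborel))"
      by (intro tendsto_intros 1 2)
    from LIMSEQ_le_const2[OF this] show ?thesis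
      using hardy_weak_dual[OF S pos inv v g odd cc clamp[OF K]]
      by (auto simp: c_def \<omega>_def E_def)
  qed
  have lim_clamp: "(\<lambda>n. clamp (real n) t) \<longlonglongrightarrow> t" for t
  proof (rule tendsto_eventually)
    obtain m where "\<bar>t\<bar> \<le> real m" using real_arch_simple by auto
    then show "\<forall>\<^sub>F n in sequentially. clamp (real n) t = t"
      unfolding eventually_sequentially clamp_def by (intro exI[of _ m]) auto
  qed
  have iv: "integrable lborel (\<lambda>x. (v x)\<^sup>2 * (1 / \<delta>))"
    using v by simp
  have 1: "(\<lambda>n. \<integral>x. v x * clamp (real n) (v x) * \<omega> x \<partial>lborel) \<longlonglongrightarrow> (\<integral>x. v x * v x * \<omega> x \<partial>lborel)"
  proof (rule integral_dominated_convergence[OF _ _ iv])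
    show "AE x in lborel. (\<lambda>n. v x * clamp (real n) (v x) * \<omega> x) \<longlonglongrightarrow> v x * v x * \<omega> x"
      by (intro AE_I2 tendsto_intros lim_clamp)
    have "\<bar>v x * clamp (real n) (v x) * \<omega> x\<bar> \<le> \<bar>v x\<bar> * \<bar>v x\<bar> * (1 / \<delta>)" for n x
      unfolding abs_mult using clamp'[of "real n" "v x"] \<omega>[of x] by (intro mult_mono) auto
    then show "AE x in lborel. norm (v x * clamp (real n) (v x) * \<omega> x) \<le> (v x)\<^sup>2 * (1 / \<delta>)" for n
      by (auto simp: power2_eq_square)
  qed measurable
  have 2: "(\<lambda>n. \<integral>x. (clamp (real n) (v x))\<^sup>2 * \<omega> x * ?B x \<partial>lborel) \<longlonglongrightarrow> (\<integral>x. (v x)\<^sup>2 * \<omega> x * ?B x \<partial>lborel)"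
  proof (rule integral_dominated_convergence[OF _ _ iv])
    show "AE x in lborel. (\<lambda>n. (clamp (real n) (v x))\<^sup>2 * \<omega> x * ?B x) \<longlonglongrightarrow> (v x)\<^sup>2 * \<omega> x * ?B x"
      by (intro AE_I2 tendsto_intros lim_clamp)
    have "\<bar>(clamp (real n) (v x))\<^sup>2 * \<omega> x * ?B x\<bar> \<le> \<bar>v x\<bar>\<^sup>2 * (1 / \<delta>) * 1" for n x
      unfolding abs_mult using power_mono[OF clamp'[of "real n" "v x"], of 2] \<omega>[of x] pos by (intro mult_mono) auto
    then show "AE x in lborel. norm ((clamp (real n) (v x))\<^sup>2 * \<omega> x * ?B x) \<le> (v x)\<^sup>2 * (1 / \<delta>)" for n
      by auto
  qed measurable
  have "(\<lambda>n. c * (2 * (\<integral>x. v x * clamp (real n) (v x) * \<omega> x \<partial>lborel) - (\<integral>x. (clamp (real n) (v x))\<^sup>2 * \<omega> x * ?B x \<partial>lborel)))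
       \<longlonglongrightarrow> c * (2 * (\<integral>x. v x * v x * \<omega> x \<partial>lborel) - (\<integral>x. (v x)\<^sup>2 * \<omega> x * ?B x \<partial>lborel))"
    by (intro tendsto_intros 1 2)
  from LIMSEQ_le_const2[OF this] trunc
  have "c * (2 * (\<integral>x. v x * v x * \<omega> x \<partial>lborel) - (\<integral>x. (v x)\<^sup>2 * \<omega> x * ?B x \<partial>lborel)) \<le> E"
    by auto
  moreover have "(\<lambda>x. (v x)\<^sup>2 * \<omega> x * ?B x) = (\<lambda>x. (v x)\<^sup>2 * \<omega> x)"
  proof
    show "(v x)\<^sup>2 * \<omega> x * ?B x = (v x)\<^sup>2 * \<omega> x" for x
      using v(3)[of x] by (cases "norm x \<le> M") auto
  qed
  ultimately have "c * (\<integral>x. (v x)\<^sup>2 * \<omega> x \<partial>lborel) \<le> E"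
    by (simp add: power2_eq_square)
  then show ?thesis
    by (simp only: c_def E_def \<omega>_def)
qed

text \<open>Product rule for the cutoff function \<open>exp 1 * bump a\<close>, which is bounded by one and equals one at the origin.\<close>
lemma weak_dir_deriv_cutoff:
  assumes w: "weak_dir_deriv h v g" and a: "a > 0"
  shows "weak_dir_deriv h (\<lambda>x. exp 1 * bump a x * v x) (\<lambda>x. exp 1 * bump a x * g x + exp 1 * bump_grad a h x * v x)"
proof -
  have [measurable]: "v \<in> borel_measurable borel" "g \<in> borel_measurable borel"
    and v2: "integrable lborel (\<lambda>x. (v x)\<^sup>2)" and g2: "integrable lborel (\<lambda>x. (g x)\<^sup>2)"
    using w by (auto simp: weak_dir_deriv_def)
  have [measurable]: "bump a \<in> borel_measurable (borel :: 'a measure)" "bump_grad a h \<in> borel_measurable borel"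
    by (auto intro: cont_csupp_borel cont_csupp_bump a)
  obtain C where C: "C \<ge> 0" "\<And>x. \<bar>bump_grad a h x\<bar> \<le> C"
    using cont_csupp_bounded[OF cont_csupp_bump(2)[OF a]] by metis
  have \<eta>: "\<bar>exp 1 * bump a x\<bar> \<le> 1" for x :: 'a
    using mult_left_mono[OF bump_le[of a x], of "exp 1"] a bump_nonneg[of a x] by (simp add: exp_minus)
  have \<eta>2: "(exp 1 * bump a x * t)\<^sup>2 \<le> t\<^sup>2" for x :: 'a and t
  proof -
    have "(exp 1 * bump a x)\<^sup>2 \<le> 1"
      using power_mono[OF \<eta>[of x], of 2] by simp
    then have "(exp 1 * bump a x)\<^sup>2 * t\<^sup>2 \<le> 1 * t\<^sup>2"
      by (intro mult_right_mono) auto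
    then show ?thesis by (simp add: power_mult_distrib)
  qed
  have i1: "integrable lborel (\<lambda>x. (exp 1 * bump a x * v x)\<^sup>2)"
    by (rule Bochner_Integration.integrable_bound[OF v2]) (use \<eta>2 in auto)
  have i2: "integrable lborel (\<lambda>x. (exp 1 * bump a x * g x + exp 1 * bump_grad a h x * v x)\<^sup>2)"
  proof (rule Bochner_Integration.integrable_bound)
    show "integrable lborel (\<lambda>x. 2 * (g x)\<^sup>2 + 2 * (exp 1 * C)\<^sup>2 * (v x)\<^sup>2)"
      using v2 g2 by simp
    have "(exp 1 * bump a x * g x + exp 1 * bump_grad a h x * v x)\<^sup>2 \<le> 2 * (g x)\<^sup>2 + 2 * (exp 1 * C)\<^sup>2 * (v x)\<^sup>2" for x
    proof -
      have q: "(exp 1 * bump_grad a h x * v x)\<^sup>2 \<le> (exp 1 * C)\<^sup>2 * (v x)\<^sup>2"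
        using power_mono[OF C(2)[of x], of 2] by (auto simp: power_mult_distrib intro!: mult_right_mono)
      have pq: "(p + q)\<^sup>2 \<le> 2 * p\<^sup>2 + 2 * q\<^sup>2" for p q :: real
        using zero_le_power2[of "p - q"] by (simp add: power2_eq_square algebra_simps)
      show ?thesis
        using pq[of "exp 1 * bump a x * g x" "exp 1 * bump_grad a h x * v x"] q \<eta>2[of x "g x"]
        by linarith
    qed
    then show "AE x in lborel. norm ((exp 1 * bump a x * g x + exp 1 * bump_grad a h x * v x)\<^sup>2)
        \<le> norm (2 * (g x)\<^sup>2 + 2 * (exp 1 * C)\<^sup>2 * (v x)\<^sup>2)"
      by (intro AE_I2) auto
  qed measurable
  have "(\<integral>x. frechet_derivative \<phi> (at x) h * (exp 1 * bump a x * v x) \<partial>lborel)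
      = - (\<integral>x. \<phi> x * (exp 1 * bump a x * g x + exp 1 * bump_grad a h x * v x) \<partial>lborel)"
    if \<phi>: "\<phi> \<in> test_functions" for \<phi>
  proof -
    have b: "(bump a :: 'a \<Rightarrow> real) \<in> test_functions"
      using bump_shift_test_function[OF a, of "0::'a"] by simp
    note \<psi> = test_functions_mult[OF \<phi> b]
    note C\<phi> = test_function_C1_along[OF \<phi>, of h]
    have C: "cont_csupp \<phi>" "cont_csupp (\<lambda>x. frechet_derivative \<phi> (at x) h)"
      using C\<phi> by (auto simp: C1_along_def)
    have D: "frechet_derivative (\<lambda>x. \<phi> x * bump a x) (at x) h
       = \<phi> x * bump_grad a h x + frechet_derivative \<phi> (at x) h * bump a x" for x
    proof -
      have "Ck (Suc 0) \<phi>" using \<phi> by (simp only: test_functions_def mem_Collect_eq)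
      from frechet_derivative_at[OF has_derivative_mult[OF Ck_SucD[OF this] bump_has_derivative[of a x]]]
      show ?thesis by metis
    qed
    have cb: "continuous_on UNIV (bump a :: 'a \<Rightarrow> real)" "continuous_on UNIV (bump_grad a h)"
      by (rule continuous_on_bump continuous_on_bump_grad)+
    have i: "integrable lborel (\<lambda>x. \<phi> x * bump_grad a h x * v x)" "integrable lborel (\<lambda>x. \<phi> x * bump a x * g x)"
      "integrable lborel (\<lambda>x. frechet_derivative \<phi> (at x) h * bump a x * v x)"
      by (intro cont_csupp_mult_L2_integrable cont_csupp_mult C cb v2 g2; measurable)+
    have "(\<integral>x. (\<phi> x * bump_grad a h x + frechet_derivative \<phi> (at x) h * bump a x) * v x \<partial>lborel)
       = - (\<integral>x. \<phi> x * bump a x * g x \<partial>lborel)"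
      using w \<psi> unfolding weak_dir_deriv_def D[symmetric] by blast
    then have "(\<integral>x. frechet_derivative \<phi> (at x) h * bump a x * v x \<partial>lborel)
       = - ((\<integral>x. \<phi> x * bump a x * g x \<partial>lborel) + (\<integral>x. \<phi> x * bump_grad a h x * v x \<partial>lborel))"
      using i by (simp add: distrib_right)
    then have eq: "exp 1 * (\<integral>x. frechet_derivative \<phi> (at x) h * bump a x * v x \<partial>lborel)
       = - (exp 1 * ((\<integral>x. \<phi> x * bump a x * g x \<partial>lborel) + (\<integral>x. \<phi> x * bump_grad a h x * v x \<partial>lborel)))"
      by (simp only: mult_minus_right)
    have "(\<integral>x. frechet_derivative \<phi> (at x) h * (exp 1 * bump a x * v x) \<partial>lborel)
      = (\<integral>x. exp 1 * (frechet_derivative \<phi> (at x) h * bump a x * v x) \<partial>lborel)"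
      by (simp add: mult_ac)
    also have "\<dots> = - (exp 1 * ((\<integral>x. \<phi> x * bump a x * g x \<partial>lborel) + (\<integral>x. \<phi> x * bump_grad a h x * v x \<partial>lborel)))"
      by (simp only: integral_mult_right_zero eq)
    also have "\<dots> = - (\<integral>x. exp 1 * (\<phi> x * bump a x * g x + \<phi> x * bump_grad a h x * v x) \<partial>lborel)"
      by (simp only: integral_mult_right_zero Bochner_Integration.integral_add[OF i(2) i(1)])
    also have "(\<lambda>x. exp 1 * (\<phi> x * bump a x * g x + \<phi> x * bump_grad a h x * v x))
      = (\<lambda>x. \<phi> x * (exp 1 * bump a x * g x + exp 1 * bump_grad a h x * v x))"
      by (simp add: fun_eq_iff algebra_simps)
    finally show ?thesis .
  qed
  then show ?thesis
    using i1 i2 by (simp add: weak_dir_deriv_def)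
qed

text \<open>Multiplication by the cutoff function of radius \<open>n + 1\<close> reduces the claim to functions with bounded
  support. The additional gradient term is absorbed by \<open>(p + q)\<^sup>2 \<le> (1 + t) p\<^sup>2 + (1 + 1/t) q\<^sup>2\<close> with
  \<open>t = 1 / (n + 1)\<close>.\<close>
lemma hardy_weak_regularised:
  fixes v :: "'a::euclidean_space \<Rightarrow> real"
  assumes S: "orthonormal S" and pos: "\<delta> > 0"
    and inv: "\<And>k. k \<in> S \<Longrightarrow> distr lborel borel (reflect {k}) = lborel"
    and v: "v \<in> borel_measurable borel" "integrable lborel (\<lambda>x. (v x)\<^sup>2)"
    and g: "\<And>l. l \<in> S \<Longrightarrow> weak_dir_deriv l v (g l)"
    and odd: "AE z in lborel. v (reflect S z) = - v z"
  shows "(real (card S))\<^sup>2 / 4 * (\<integral>x. (v x)\<^sup>2 * (1 / (sqdist S x + \<delta>)) \<partial>lborel)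
    \<le> (\<Sum>l\<in>S. \<integral>x. (g l x)\<^sup>2 \<partial>lborel)"
proof -
  define c where "c = (real (card S))\<^sup>2 / 4"
  define \<omega> where "\<omega> x = 1 / (sqdist S x + \<delta>)" for x
  have \<omega>c: "continuous_on UNIV \<omega>"
    unfolding \<omega>_def[abs_def] by (rule inverse_sqdist_continuous[OF pos])
  have \<omega>: "0 < \<omega> x" "\<omega> x \<le> 1 / \<delta>" for x
    using sqdist_nonneg[of S x] pos by (auto simp: \<omega>_def field_simps add_nonneg_pos)
  have [measurable]: "v \<in> borel_measurable borel" "\<omega> \<in> borel_measurable borel"
    using v \<omega>c by (auto intro: borel_measurable_continuous_onI)
  have g2: "g l \<in> borel_measurable borel" "integrable lborel (\<lambda>x. (g l x)\<^sup>2)" if "l \<in> S" for l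
    using g[OF that] by (simp_all add: weak_dir_deriv_def)
  define X where "X n = 1 / real (Suc n)" for n
  have X: "X \<longlonglongrightarrow> 0" "\<And>n. X n > 0"
    using LIMSEQ_Suc[OF lim_1_over_n[where 'a = real]] by (auto simp: X_def[abs_def] field_simps)
  define \<eta> where "\<eta> n x = exp 1 * bump ((X n)\<^sup>2) x" for n and x :: 'a
  have a: "(X n)\<^sup>2 > 0" "sqrt ((X n)\<^sup>2) = X n" for n
    using X(2)[of n] by auto
  have \<eta>01: "0 \<le> \<eta> n x" "\<eta> n x \<le> 1" for n x
    using mult_left_mono[OF bump_le[of "(X n)\<^sup>2" x], of "exp 1"] a(1)[of n] bump_nonneg[of "(X n)\<^sup>2" x]
    by (auto simp: \<eta>_def exp_minus)
  have [measurable]: "\<eta> n \<in> borel_measurable borel" for n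
    unfolding \<eta>_def[abs_def] by (intro cont_csupp_borel cont_csupp_cmult cont_csupp_bump a)
  obtain C where C: "C \<ge> 0" "\<And>(a::real) h w::'a. a > 0 \<Longrightarrow> \<bar>bump_grad a h w\<bar> \<le> C * sqrt a * norm h"
    using bump_grad_bound by blast
  have bg: "\<bar>exp 1 * bump_grad ((X n)\<^sup>2) l x\<bar> \<le> exp 1 * C * X n" if "l \<in> S" for n l x
  proof -
    have "norm l = 1"
      using S that by (simp add: orthonormal_def norm_eq_1)
    then have "\<bar>bump_grad ((X n)\<^sup>2) l x\<bar> \<le> C * X n"
      using C(2)[OF a(1)[of n], of l x] a(2)[of n] by simp
    then show ?thesis
      by (simp add: abs_mult)
  qed
  define W where "W = (\<integral>x. (v x)\<^sup>2 \<partial>lborel)"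
  have step: "c * (\<integral>x. (\<eta> n x * v x)\<^sup>2 * \<omega> x \<partial>lborel)
    \<le> (\<Sum>l\<in>S. (1 + X n) * (\<integral>x. (g l x)\<^sup>2 \<partial>lborel) + (exp 1 * C)\<^sup>2 * ((X n)\<^sup>2 + X n) * W)" for n
  proof -
    let ?g = "\<lambda>l x. exp 1 * bump ((X n)\<^sup>2) x * g l x + exp 1 * bump_grad ((X n)\<^sup>2) l x * v x"
    have w: "weak_dir_deriv l (\<lambda>x. \<eta> n x * v x) (?g l)" if "l \<in> S" for l
      unfolding \<eta>_def by (rule weak_dir_deriv_cutoff[OF g[OF that] a(1)])
    have z: "bump ((X n)\<^sup>2) x = 0" "bump_grad ((X n)\<^sup>2) l x = 0" if "norm x > 1 / X n" for x l :: 'a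
      using bump_support[OF a(1)[of n], of x] a(2)[of n] that by auto
    have i: "integrable lborel (\<lambda>x. (\<eta> n x * v x)\<^sup>2)"
    proof (rule Bochner_Integration.integrable_bound[OF v(2)])
      have "(\<eta> n x)\<^sup>2 * (v x)\<^sup>2 \<le> 1 * (v x)\<^sup>2" for x
        using \<eta>01[of n x] by (intro mult_right_mono) (auto simp: power_le_one)
      then show "AE x in lborel. norm ((\<eta> n x * v x)\<^sup>2) \<le> norm ((v x)\<^sup>2)"
        by (intro AE_I2) (simp add: power_mult_distrib)
    qed measurable
    have m: "(\<lambda>x. \<eta> n x * v x) \<in> borel_measurable borel"
      by measurable
    have odd': "AE z in lborel. \<eta> n (reflect S z) * v (reflect S z) = - (\<eta> n z * v z)"
    proof -
      have "\<eta> n (reflect S z) = \<eta> n z" for z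
        using norm_reflect[OF S subset_refl inv, of z] by (simp add: \<eta>_def bump_def dot_square_norm)
      then show ?thesis using odd by auto
    qed
    have "c * (\<integral>x. (\<eta> n x * v x)\<^sup>2 * \<omega> x \<partial>lborel) \<le> (\<Sum>l\<in>S. \<integral>x. (?g l x)\<^sup>2 \<partial>lborel)"
      unfolding c_def \<omega>_def
      by (rule hardy_weak_bounded_support[where M = "1 / X n", OF S pos inv m i _ w _ odd'])
         (auto simp: \<eta>_def z)
    also have "\<dots> \<le> (\<Sum>l\<in>S. (1 + X n) * (\<integral>x. (g l x)\<^sup>2 \<partial>lborel) + (exp 1 * C)\<^sup>2 * ((X n)\<^sup>2 + X n) * W)"
    proof (rule sum_mono)
      fix l assume l: "l \<in> S"
      have "(\<integral>x. (?g l x)\<^sup>2 \<partial>lborel) \<le> (\<integral>x. (1 + X n) * (g l x)\<^sup>2 + (exp 1 * C)\<^sup>2 * ((X n)\<^sup>2 + X n) * (v x)\<^sup>2 \<partial>lborel)"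
      proof (rule integral_mono)
        show "integrable lborel (\<lambda>x. (?g l x)\<^sup>2)"
          using w[OF l] by (simp add: weak_dir_deriv_def)
        show "integrable lborel (\<lambda>x. (1 + X n) * (g l x)\<^sup>2 + (exp 1 * C)\<^sup>2 * ((X n)\<^sup>2 + X n) * (v x)\<^sup>2)"
          using g2[OF l] v by simp
        fix x
        define p where "p = \<eta> n x * g l x"
        define q where "q = exp 1 * bump_grad ((X n)\<^sup>2) l x * v x"
        have t: "X n > 0" by (rule X)
        have p: "p\<^sup>2 \<le> (g l x)\<^sup>2"
          using mult_right_mono[of "(\<eta> n x)\<^sup>2" 1 "(g l x)\<^sup>2"] \<eta>01[of n x] by (simp add: p_def power_mult_distrib power_le_one)
        have q: "q\<^sup>2 \<le> (exp 1 * C * X n)\<^sup>2 * (v x)\<^sup>2"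
          unfolding q_def power_mult_distrib[of _ "v x"]
          using power_mono[OF bg[OF l, of n x], of 2] by (intro mult_right_mono) auto
        have "(p + q)\<^sup>2 \<le> (1 + X n) * p\<^sup>2 + (1 + 1 / X n) * q\<^sup>2"
        proof -
          have "0 \<le> (X n * p - q)\<^sup>2 / X n" using t by simp
          also have "\<dots> = X n * p\<^sup>2 - 2 * p * q + q\<^sup>2 / X n"
            using t by (simp add: power2_eq_square field_simps)
          finally show ?thesis by (simp add: power2_eq_square algebra_simps)
        qed
        also have "\<dots> \<le> (1 + X n) * (g l x)\<^sup>2 + (1 + 1 / X n) * ((exp 1 * C * X n)\<^sup>2 * (v x)\<^sup>2)"
          using t p q by (intro add_mono mult_left_mono) auto
        also have "(1 + 1 / X n) * ((exp 1 * C * X n)\<^sup>2 * (v x)\<^sup>2) = (exp 1 * C)\<^sup>2 * ((X n)\<^sup>2 + X n) * (v x)\<^sup>2"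
          using t by (simp add: power2_eq_square field_simps)
        finally show "(?g l x)\<^sup>2 \<le> (1 + X n) * (g l x)\<^sup>2 + (exp 1 * C)\<^sup>2 * ((X n)\<^sup>2 + X n) * (v x)\<^sup>2"
          by (simp add: p_def q_def \<eta>_def)
      qed
      also have "\<dots> = (1 + X n) * (\<integral>x. (g l x)\<^sup>2 \<partial>lborel) + (exp 1 * C)\<^sup>2 * ((X n)\<^sup>2 + X n) * W"
        using g2[OF l] v by (simp add: W_def)
      finally show "(\<integral>x. (?g l x)\<^sup>2 \<partial>lborel) \<le> (1 + X n) * (\<integral>x. (g l x)\<^sup>2 \<partial>lborel) + (exp 1 * C)\<^sup>2 * ((X n)\<^sup>2 + X n) * W" .
    qed
    finally show ?thesis .
  qed
  have \<eta>lim: "(\<lambda>n. \<eta> n x) \<longlonglongrightarrow> 1" for x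
  proof -
    have "isCont (flat 1) 1"
      using flat_has_field_derivative DERIV_isCont by blast
    moreover have "(\<lambda>n. 1 - (X n)\<^sup>2 * (x \<bullet> x)) \<longlonglongrightarrow> 1 - 0\<^sup>2 * (x \<bullet> x)"
      by (intro tendsto_intros X)
    ultimately have "(\<lambda>n. exp 1 * flat 1 (1 - (X n)\<^sup>2 * (x \<bullet> x))) \<longlonglongrightarrow> exp 1 * flat 1 1"
      by (intro tendsto_intros isCont_tendsto_compose[of 1 "flat 1"]) auto
    then show ?thesis by (simp add: \<eta>_def bump_def flat_def exp_minus)
  qed
  have "(\<lambda>n. \<integral>x. (\<eta> n x * v x)\<^sup>2 * \<omega> x \<partial>lborel) \<longlonglongrightarrow> (\<integral>x. (v x)\<^sup>2 * \<omega> x \<partial>lborel)"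
  proof (rule integral_dominated_convergence[where w = "\<lambda>x. (v x)\<^sup>2 * (1 / \<delta>)"])
    have "(\<lambda>n. (\<eta> n x * v x)\<^sup>2 * \<omega> x) \<longlonglongrightarrow> (1 * v x)\<^sup>2 * \<omega> x" for x
      by (intro tendsto_intros \<eta>lim)
    then show "AE x in lborel. (\<lambda>n. (\<eta> n x * v x)\<^sup>2 * \<omega> x) \<longlonglongrightarrow> (v x)\<^sup>2 * \<omega> x"
      by simp
    have "(\<eta> n x * v x)\<^sup>2 * \<omega> x \<le> (v x)\<^sup>2 * (1 / \<delta>)" for n x
      using mult_right_mono[of "(\<eta> n x)\<^sup>2" 1 "(v x)\<^sup>2"] \<eta>01[of n x] \<omega>[of x]
      by (intro mult_mono) (auto simp: power_mult_distrib power_le_one)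
    then show "AE x in lborel. norm ((\<eta> n x * v x)\<^sup>2 * \<omega> x) \<le> (v x)\<^sup>2 * (1 / \<delta>)" for n
      by (intro AE_I2) (simp add: abs_mult abs_of_pos \<omega>)
  qed (use v in auto)
  then have 1: "(\<lambda>n. c * (\<integral>x. (\<eta> n x * v x)\<^sup>2 * \<omega> x \<partial>lborel)) \<longlonglongrightarrow> c * (\<integral>x. (v x)\<^sup>2 * \<omega> x \<partial>lborel)"
    by (intro tendsto_intros)
  have "(\<lambda>n. \<Sum>l\<in>S. (1 + X n) * (\<integral>x. (g l x)\<^sup>2 \<partial>lborel) + (exp 1 * C)\<^sup>2 * ((X n)\<^sup>2 + X n) * W)
    \<longlonglongrightarrow> (\<Sum>l\<in>S. (1 + 0) * (\<integral>x. (g l x)\<^sup>2 \<partial>lborel) + (exp 1 * C)\<^sup>2 * (0\<^sup>2 + 0) * W)"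
    by (intro tendsto_intros X)
  from LIMSEQ_le[OF 1 this] step show ?thesis
    by (auto simp: c_def \<omega>_def)
qed

text \<open>The limit \<open>\<delta> \<rightarrow> 0\<close> by Fatou's lemma. The right-hand side is finite, so the left-hand side is finite too.\<close>
lemma hardy_weak:
  fixes v :: "'a::euclidean_space \<Rightarrow> real"
  assumes S: "orthonormal S"
    and inv: "\<And>k. k \<in> S \<Longrightarrow> distr lborel borel (reflect {k}) = lborel"
    and v: "v \<in> borel_measurable borel" "integrable lborel (\<lambda>x. (v x)\<^sup>2)"
    and g: "\<And>l. l \<in> S \<Longrightarrow> weak_dir_deriv l v (g l)"
    and odd: "AE z in lborel. v (reflect S z) = - v z"
  shows "(\<integral>\<^sup>+x. ennreal ((real (card S))\<^sup>2 / 4 * ((v x)\<^sup>2 / sqdist S x)) \<partial>lborel)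
    \<le> (\<Sum>l\<in>S. \<integral>\<^sup>+x. ennreal ((g l x)\<^sup>2) \<partial>lborel)"
proof -
  define c where "c = (real (card S))\<^sup>2 / 4"
  have c: "c \<ge> 0" by (simp add: c_def)
  define E where "E = (\<Sum>l\<in>S. \<integral>x. (g l x)\<^sup>2 \<partial>lborel)"
  have E: "(\<Sum>l\<in>S. \<integral>\<^sup>+x. ennreal ((g l x)\<^sup>2) \<partial>lborel) = ennreal E"
  proof -
    have "(\<integral>\<^sup>+x. ennreal ((g l x)\<^sup>2) \<partial>lborel) = ennreal (\<integral>x. (g l x)\<^sup>2 \<partial>lborel)" if "l \<in> S" for l
      using g[OF that] by (intro nn_integral_eq_integral) (auto simp: weak_dir_deriv_def)
    then show ?thesis
      by (simp add: E_def sum_ennreal)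
  qed
  define X where "X n = 1 / real (Suc n)" for n
  have X: "X \<longlonglongrightarrow> 0" "\<And>n. X n > 0"
    using LIMSEQ_Suc[OF lim_1_over_n[where 'a = real]] by (auto simp: X_def[abs_def] field_simps)
  have [measurable]: "v \<in> borel_measurable borel" by (rule v)
  have [measurable]: "(\<lambda>x. 1 / (sqdist S x + X n)) \<in> borel_measurable borel" for n
    by (intro borel_measurable_continuous_onI inverse_sqdist_continuous X)
  let ?f = "\<lambda>n x. ennreal (c * ((v x)\<^sup>2 * (1 / (sqdist S x + X n))))"
  have le: "(\<integral>\<^sup>+x. ?f n x \<partial>lborel) \<le> ennreal E" for n
  proof -
    have pos: "0 < sqdist S x + X n" for x
      using X(2)[of n] sqdist_nonneg[of S x] by linarith
    have "integrable lborel (\<lambda>x. (v x)\<^sup>2 * (1 / (sqdist S x + X n)))"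
    proof (rule Bochner_Integration.integrable_bound)
      show "integrable lborel (\<lambda>x. (v x)\<^sup>2 * (1 / X n))"
        using v by simp
      have "(v x)\<^sup>2 * (1 / (sqdist S x + X n)) \<le> (v x)\<^sup>2 * (1 / X n)" for x
        using X(2)[of n] sqdist_nonneg[of S x] by (intro mult_left_mono divide_left_mono mult_pos_pos pos) auto
      then show "AE x in lborel. norm ((v x)\<^sup>2 * (1 / (sqdist S x + X n))) \<le> norm ((v x)\<^sup>2 * (1 / X n))"
        using pos X(2)[of n] by (intro AE_I2) (simp add: abs_mult less_imp_le)
    qed measurable
    then have "(\<integral>\<^sup>+x. ?f n x \<partial>lborel) = ennreal (\<integral>x. c * ((v x)\<^sup>2 * (1 / (sqdist S x + X n))) \<partial>lborel)"
      using c pos by (intro nn_integral_eq_integral integrable_mult_right) (auto simp: less_imp_le)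
    also have "\<dots> \<le> ennreal E"
      using hardy_weak_regularised[OF S X(2) inv v g odd, of n] by (intro ennreal_leI) (simp only: c_def E_def integral_mult_right_zero)
    finally show ?thesis .
  qed
  have "(\<integral>\<^sup>+x. ennreal (c * ((v x)\<^sup>2 / sqdist S x)) \<partial>lborel) \<le> (\<integral>\<^sup>+x. liminf (\<lambda>n. ?f n x) \<partial>lborel)"
  proof (rule nn_integral_mono)
    fix x
    show "ennreal (c * ((v x)\<^sup>2 / sqdist S x)) \<le> liminf (\<lambda>n. ?f n x)"
    \<comment> \<open>On the singular set the quotient is zero by the convention for division by zero.\<close>
    proof (cases "sqdist S x = 0")
      case True
      then show ?thesis by simp
    next
      case False
      have "(\<lambda>n. c * ((v x)\<^sup>2 * (1 / (sqdist S x + X n)))) \<longlonglongrightarrow> c * ((v x)\<^sup>2 * (1 / (sqdist S x + 0)))"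
        using False by (intro tendsto_intros X) auto
      then have "(\<lambda>n. ?f n x) \<longlonglongrightarrow> ennreal (c * ((v x)\<^sup>2 / sqdist S x))"
        by (intro tendsto_ennrealI) simp
      then show ?thesis
        using lim_imp_Liminf[OF sequentially_bot] by fastforce
    qed
  qed
  also have "\<dots> \<le> liminf (\<lambda>n. \<integral>\<^sup>+x. ?f n x \<partial>lborel)"
    by (rule nn_integral_liminf) measurable
  also have "\<dots> \<le> ennreal E"
    using le by (intro Liminf_le) auto
  finally show ?thesis
    by (simp add: E c_def)
qed

section \<open>The exchange of two particles as a reflection\<close>

text \<open>This reflection exchanges the two basis vectors \<open>a\<close> and \<open>b\<close>, hence maps boxes to boxes of the same
  volume.\<close>
lemma distr_reflect_basis:
  fixes a b :: "'a::euclidean_space"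
  assumes ab: "a \<in> Basis" "b \<in> Basis" "a \<noteq> b"
  shows "distr lborel borel (reflect {(1 / sqrt 2) *\<^sub>R (a - b)}) = (lborel :: 'a measure)"
proof (rule lborel_eqI[symmetric])
  let ?R = "reflect {(1 / sqrt 2) *\<^sub>R (a - b)}"
  define \<pi> where "\<pi> = Transposition.transpose a b"
  have R: "?R x = x - (x \<bullet> a - x \<bullet> b) *\<^sub>R (a - b)" for x
    by (simp add: reflect_def inner_diff_right)
  have \<pi>: "\<pi> c \<in> Basis" "\<pi> (\<pi> c) = c" if "c \<in> Basis" for c
    using ab that unfolding \<pi>_def by (cases "c = a"; cases "c = b"; simp)+
  have bij: "bij_betw \<pi> Basis Basis"
    by (rule bij_betwI[of _ _ _ \<pi>]) (use \<pi> in auto)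
  have Rc: "?R x \<bullet> c = x \<bullet> \<pi> c" if "c \<in> Basis" for x c
    using ab that by (auto simp: R \<pi>_def transpose_def inner_diff_left inner_Basis)
  fix l u :: 'a assume le: "\<And>b. b \<in> Basis \<Longrightarrow> l \<bullet> b \<le> u \<bullet> b"
  define l' where "l' = (\<Sum>c\<in>Basis. (l \<bullet> \<pi> c) *\<^sub>R c)"
  define u' where "u' = (\<Sum>c\<in>Basis. (u \<bullet> \<pi> c) *\<^sub>R c)"
  have l': "l' \<bullet> c = l \<bullet> \<pi> c" "u' \<bullet> c = u \<bullet> \<pi> c" if "c \<in> Basis" for c
    using that by (simp_all add: l'_def u'_def)
  have box: "?R -` box l u = box l' u'"
  proof (intro set_eqI iffI)
    fix x assume "x \<in> ?R -` box l u"
    then have "\<forall>c\<in>Basis. l \<bullet> c < x \<bullet> \<pi> c \<and> x \<bullet> \<pi> c < u \<bullet> c"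
      by (auto simp: mem_box Rc)
    then have "\<forall>c\<in>Basis. l \<bullet> \<pi> c < x \<bullet> c \<and> x \<bullet> c < u \<bullet> \<pi> c"
      using \<pi> by metis
    then show "x \<in> box l' u'"
      by (auto simp: mem_box l')
  next
    fix x assume "x \<in> box l' u'"
    then have "\<forall>c\<in>Basis. l \<bullet> \<pi> c < x \<bullet> c \<and> x \<bullet> c < u \<bullet> \<pi> c"
      by (auto simp: mem_box l')
    then have "\<forall>c\<in>Basis. l \<bullet> c < x \<bullet> \<pi> c \<and> x \<bullet> \<pi> c < u \<bullet> c"
      using \<pi> by metis
    then show "x \<in> ?R -` box l u"
      by (auto simp: mem_box Rc)
  qed
  have "emeasure (distr lborel borel ?R) (box l u) = emeasure lborel (box l' u')"
    using box by (simp add: emeasure_distr)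
  also have "\<dots> = (\<Prod>c\<in>Basis. (u' - l') \<bullet> c)"
    using le \<pi>(1) by (intro emeasure_lborel_box) (simp add: l')
  also have "(\<Prod>c\<in>Basis. (u' - l') \<bullet> c) = (\<Prod>c\<in>Basis. (u - l) \<bullet> \<pi> c)"
    by (intro prod.cong) (auto simp: l' inner_diff_left)
  also have "\<dots> = (\<Prod>c\<in>Basis. (u - l) \<bullet> c)"
    by (rule prod.reindex_bij_betw[OF bij])
  finally show "emeasure (distr lborel borel ?R) (box l u) = (\<Prod>c\<in>Basis. (u - l) \<bullet> c)" .
qed simp

text \<open>The unit vectors in the directions of the components of the relative coordinate of the particles
  \<open>i\<close> and \<open>j\<close>.\<close>
definition relative_direction :: "'n::finite \<Rightarrow> 'n \<Rightarrow> 'd::finite \<Rightarrow> real^'d^'n" where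
  "relative_direction i j k = (1 / sqrt 2) *\<^sub>R (axis i (axis k 1) - axis j (axis k 1))"

lemma inner_axis_axis2: "axis i (axis k 1) \<bullet> (axis j (axis l 1) :: real^'d^'n) = (if i = j \<and> k = l then 1 else 0)"
  by (auto simp: inner_axis_axis)

lemma axis_axis_Basis: "(axis i (axis k 1) :: real^'d^'n) \<in> Basis"
  by (auto simp: axis_in_Basis_iff)

lemma relative_direction_inner:
  assumes "i \<noteq> j"
  shows "relative_direction i j k \<bullet> (relative_direction i j l :: real^'d^'n) = (if k = l then 1 else 0)"
  using assms unfolding relative_direction_def
  by (simp add: inner_diff_left inner_diff_right inner_axis_axis2)

lemma inj_relative_direction:
  assumes "i \<noteq> j" shows "inj (relative_direction i j :: 'd \<Rightarrow> real^'d^'n)"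
proof (rule injI)
  fix k l :: 'd assume "relative_direction i j k = (relative_direction i j l :: real^'d^'n)"
  then show "k = l"
    using relative_direction_inner[OF assms, of k l] relative_direction_inner[OF assms, of k k]
    by (auto split: if_splits)
qed

lemma orthonormal_relative_direction:
  assumes "i \<noteq> j" shows "orthonormal (range (relative_direction i j :: 'd \<Rightarrow> real^'d^'n))"
  unfolding orthonormal_def
  by (auto simp: relative_direction_inner[OF assms] inj_eq[OF inj_relative_direction[OF assms]])

lemma inner_relative_direction:
  fixes x :: "real^'d^'n"
  shows "x \<bullet> relative_direction i j k = (x $ i $ k - x $ j $ k) / sqrt 2"
  by (simp add: relative_direction_def inner_diff_right inner_axis)

lemma sqdist_relative_direction:
  fixes x :: "real^'d^'n"
  assumes "i \<noteq> j"
  shows "sqdist (range (relative_direction i j)) x = (particle_dist i j x)\<^sup>2 / 2"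
proof -
  have "sqdist (range (relative_direction i j)) x = (\<Sum>k\<in>UNIV. ((x $ i $ k - x $ j $ k) / sqrt 2)\<^sup>2)"
    unfolding sqdist_def using inj_relative_direction[OF assms, where 'd = 'd]
    by (simp add: sum.reindex inner_relative_direction)
  also have "\<dots> = (\<Sum>k\<in>UNIV. (x $ i $ k - x $ j $ k)\<^sup>2) / 2"
    by (simp add: power_divide sum_divide_distrib)
  also have "(\<Sum>k\<in>UNIV. (x $ i $ k - x $ j $ k)\<^sup>2) = (particle_dist i j x)\<^sup>2"
    unfolding particle_dist_def power2_norm_eq_inner by (simp add: inner_vec_def power2_eq_square)
  finally show ?thesis .
qed

lemma reflect_relative_direction:
  fixes x :: "real^'d^'n"
  assumes "i \<noteq> j"
  shows "reflect (range (relative_direction i j)) x = swap_particles i j x"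
proof -
  have "reflect (range (relative_direction i j)) x
      = x - (\<Sum>k\<in>UNIV. (x $ i $ k - x $ j $ k) *\<^sub>R (axis i (axis k 1) - axis j (axis k 1)))"
    unfolding reflect_def using inj_relative_direction[OF assms, where 'd = 'd]
    by (simp add: sum.reindex inner_relative_direction)
       (simp add: relative_direction_def diff_divide_distrib)
  moreover have "(\<Sum>k\<in>UNIV. (x $ i $ k - x $ j $ k) *\<^sub>R (axis i (axis k 1) - axis j (axis k 1) :: real^'d^'n)) $ m $ l
      = (if m = i then x $ i $ l - x $ j $ l else if m = j then x $ j $ l - x $ i $ l else 0)" for m l
  proof -
    have "(\<Sum>k\<in>UNIV. (x $ i $ k - x $ j $ k) *\<^sub>R (axis i (axis k 1) - axis j (axis k 1) :: real^'d^'n)) $ m $ l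
      = (\<Sum>k\<in>UNIV. if k = l then (if m = i then x $ i $ l - x $ j $ l else if m = j then x $ j $ l - x $ i $ l else 0) else 0)"
      unfolding sum_component vector_scaleR_component vector_minus_component
      using assms by (intro sum.cong) (auto simp: axis_def)
    then show ?thesis by simp
  qed
  ultimately show ?thesis
    by (simp add: vec_eq_iff swap_particles_def transpose_def)
qed

lemma distr_reflect_relative_direction:
  assumes "i \<noteq> j" "k \<in> range (relative_direction i j :: 'd \<Rightarrow> real^'d^'n)"
  shows "distr lborel borel (reflect {k}) = lborel"
proof -
  obtain l where k: "k = relative_direction i j l" using assms(2) by auto
  have "axis i (axis l 1) \<noteq> (axis j (axis l 1) :: real^'d^'n)"
    using assms(1) by (simp add: axis_eq_axis)
  then show ?thesis
    unfolding k relative_direction_def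
    using distr_reflect_basis[OF axis_axis_Basis axis_axis_Basis] by blast
qed

section \<open>From complex-valued functions to Borel representatives of real and imaginary parts\<close>

lemma integral_lebesgue_eq_lborel:
  fixes f f' :: "'a::euclidean_space \<Rightarrow> real"
  assumes f: "f \<in> borel_measurable lebesgue" and f': "f' \<in> borel_measurable borel"
    and eq: "AE x in lborel. f x = f' x"
  shows "(\<integral>x. f x \<partial>lebesgue) = (\<integral>x. f' x \<partial>lborel)" "integrable lebesgue f \<longleftrightarrow> integrable lborel f'"
proof -
  have m: "f' \<in> borel_measurable lebesgue" "AE x in lebesgue. f x = f' x"
    using f' eq by (auto intro: measurable_completion AE_completion)
  show "(\<integral>x. f x \<partial>lebesgue) = (\<integral>x. f' x \<partial>lborel)"
    using integral_cong_AE[OF f m] f' integral_completion[of f' lborel] by simp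
  show "integrable lebesgue f \<longleftrightarrow> integrable lborel f'"
    using integrable_cong_AE[OF f m] f' integrable_completion[of f' lborel] by simp
qed

text \<open>Here \<open>\<Phi>\<close> stands for the real or the imaginary part.\<close>
lemma weak_dir_deriv_of_complex:
  fixes u G :: "'a::euclidean_space \<Rightarrow> complex" and v g :: "'a \<Rightarrow> real"
  assumes w: "is_weak_partial b u G" and u: "u \<in> L2" and G: "G \<in> L2"
    and \<Phi>: "bounded_linear \<Phi>" "\<And>z. \<bar>\<Phi> z\<bar> \<le> norm z"
    and v: "v \<in> borel_measurable borel" "AE x in lborel. \<Phi> (u x) = v x"
    and g: "g \<in> borel_measurable borel" "AE x in lborel. \<Phi> (G x) = g x"
  shows "weak_dir_deriv b v g"
proof -
  interpret \<Phi>: bounded_linear \<Phi> by (rule \<Phi>)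
  have [measurable]: "\<Phi> \<in> borel_measurable borel"
    by (intro borel_measurable_continuous_onI \<Phi>.continuous_on continuous_on_id)
  have sq: "integrable lborel (\<lambda>x. (h' x)\<^sup>2)"
    and prod: "cont_csupp \<phi> \<Longrightarrow> (\<Phi> (\<integral>x. \<phi> x *\<^sub>R h x \<partial>lebesgue)) = (\<integral>x. \<phi> x * h' x \<partial>lborel)"
    if h: "h \<in> L2" and h': "h' \<in> borel_measurable borel" "AE x in lborel. \<Phi> (h x) = h' x"
    for h :: "'a \<Rightarrow> complex" and h' \<phi>
  proof -
    have hm[measurable]: "h \<in> borel_measurable lebesgue" and h2: "integrable lebesgue (\<lambda>x. (norm (h x))\<^sup>2)"
      using h by (auto simp: L2_def)
    have hm'[measurable]: "(\<lambda>x. \<Phi> (h x)) \<in> borel_measurable lebesgue"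
      by measurable
    have i: "integrable lebesgue (\<lambda>x. (\<Phi> (h x))\<^sup>2)"
    proof (rule Bochner_Integration.integrable_bound[OF h2])
      show "AE x in lebesgue. norm ((\<Phi> (h x))\<^sup>2) \<le> norm ((norm (h x))\<^sup>2)"
        using \<Phi>(2) by (intro AE_I2) (simp add: abs_le_square_iff[symmetric])
    qed measurable
    have "AE x in lborel. (\<Phi> (h x))\<^sup>2 = (h' x)\<^sup>2"
      using h'(2) by eventually_elim simp
    from integral_lebesgue_eq_lborel(2)[OF borel_measurable_integrable[OF i] _ this] i
    show "integrable lborel (\<lambda>x. (h' x)\<^sup>2)"
      using h'(1) by simp
    assume \<phi>: "cont_csupp \<phi>"
    have \<phi>m: "\<phi> \<in> borel_measurable borel" using cont_csupp_borel[OF \<phi>] .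
    have \<phi>m'[measurable]: "\<phi> \<in> borel_measurable lebesgue"
      using \<phi>m by (intro measurable_completion) simp
    have ih: "integrable lebesgue (\<lambda>x. \<phi> x *\<^sub>R h x)"
    proof (rule Bochner_Integration.integrable_bound)
      have "integrable lebesgue (\<lambda>x. (\<phi> x)\<^sup>2)"
        using cont_csupp_integrable[OF cont_csupp_power2[OF \<phi>]] integrable_completion[of "\<lambda>x. (\<phi> x)\<^sup>2" lborel] \<phi>m by simp
      then show "integrable lebesgue (\<lambda>x. (\<phi> x)\<^sup>2 + (norm (h x))\<^sup>2)"
        using h2 by simp
      have "\<bar>\<phi> x\<bar> * norm (h x) \<le> (\<phi> x)\<^sup>2 + (norm (h x))\<^sup>2" for x
        using sum_squares_bound[of "\<bar>\<phi> x\<bar>" "norm (h x)"] mult_nonneg_nonneg[OF abs_ge_zero norm_ge_zero, of "\<phi> x" "h x"]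
        unfolding power2_abs mult.assoc by linarith
      then show "AE x in lebesgue. norm (\<phi> x *\<^sub>R h x) \<le> norm ((\<phi> x)\<^sup>2 + (norm (h x))\<^sup>2)"
        by (intro AE_I2) simp
    qed measurable
    have "\<Phi> (\<integral>x. \<phi> x *\<^sub>R h x \<partial>lebesgue) = (\<integral>x. \<phi> x * \<Phi> (h x) \<partial>lebesgue)"
      using integral_bounded_linear[OF \<Phi>(1) ih] by (simp add: \<Phi>.scaleR)
    also have "\<dots> = (\<integral>x. \<phi> x * h' x \<partial>lborel)"
      using h' \<phi>m by (intro integral_lebesgue_eq_lborel(1)) (auto elim: eventually_mono)
    finally show "\<Phi> (\<integral>x. \<phi> x *\<^sub>R h x \<partial>lebesgue) = (\<integral>x. \<phi> x * h' x \<partial>lborel)" .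
  qed
  have "(\<integral>x. frechet_derivative \<phi> (at x) b * v x \<partial>lborel) = - (\<integral>x. \<phi> x * g x \<partial>lborel)"
    if \<phi>: "\<phi> \<in> test_functions" for \<phi>
  proof -
    have C: "cont_csupp \<phi>" "cont_csupp (\<lambda>x. frechet_derivative \<phi> (at x) b)"
      using test_function_C1_along[OF \<phi>, of b] by (auto simp: C1_along_def)
    have "(\<integral>x. frechet_derivative \<phi> (at x) b *\<^sub>R u x \<partial>lebesgue) = - (\<integral>x. \<phi> x *\<^sub>R G x \<partial>lebesgue)"
      using w \<phi> by (simp add: is_weak_partial_def)
    from arg_cong[OF this, of \<Phi>] show ?thesis
      using prod[OF u v C(2)] prod[OF G g C(1)] by (simp add: \<Phi>.neg)
  qed
  then show ?thesis
    using sq[OF u v] sq[OF G g] v g by (simp add: weak_dir_deriv_def)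
qed

lemma weak_dir_deriv_scaled_diff:
  assumes w: "weak_dir_deriv b v g" "weak_dir_deriv b' v g'"
  shows "weak_dir_deriv (s *\<^sub>R (b - b')) v (\<lambda>x. s * (g x - g' x))"
proof -
  have m[measurable]: "v \<in> borel_measurable borel" "g \<in> borel_measurable borel" "g' \<in> borel_measurable borel"
    and i: "integrable lborel (\<lambda>x. (v x)\<^sup>2)" "integrable lborel (\<lambda>x. (g x)\<^sup>2)" "integrable lborel (\<lambda>x. (g' x)\<^sup>2)"
    using w by (auto simp: weak_dir_deriv_def)
  have "integrable lborel (\<lambda>x. (s * (g x - g' x))\<^sup>2)"
  proof (rule Bochner_Integration.integrable_bound)
    show "integrable lborel (\<lambda>x. s\<^sup>2 * (2 * (g x)\<^sup>2 + 2 * (g' x)\<^sup>2))"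
      using i by simp
    have "(s * (g x - g' x))\<^sup>2 \<le> s\<^sup>2 * (2 * (g x)\<^sup>2 + 2 * (g' x)\<^sup>2)" for x
      unfolding power_mult_distrib using zero_le_power2[of "g x + g' x"]
      by (intro mult_left_mono) (auto simp: power2_eq_square algebra_simps)
    then show "AE x in lborel. norm ((s * (g x - g' x))\<^sup>2) \<le> norm (s\<^sup>2 * (2 * (g x)\<^sup>2 + 2 * (g' x)\<^sup>2))"
      by (intro AE_I2) auto
  qed measurable
  moreover have "(\<integral>x. frechet_derivative \<phi> (at x) (s *\<^sub>R (b - b')) * v x \<partial>lborel)
      = - (\<integral>x. \<phi> x * (s * (g x - g' x)) \<partial>lborel)" if \<phi>: "\<phi> \<in> test_functions" for \<phi>
  proof -
    have C: "cont_csupp \<phi>" "cont_csupp (\<lambda>x. frechet_derivative \<phi> (at x) h)" for h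
      using test_function_C1_along[OF \<phi>, of h] by (auto simp: C1_along_def)
    have I: "integrable lborel (\<lambda>x. frechet_derivative \<phi> (at x) h * v x)" for h
      by (intro cont_csupp_mult_L2_integrable C i m)
    have J: "integrable lborel (\<lambda>x. \<phi> x * g x)" "integrable lborel (\<lambda>x. \<phi> x * g' x)"
      by (intro cont_csupp_mult_L2_integrable C i m)+
    have Ck: "Ck (Suc 0) \<phi>" using \<phi> by (simp only: test_functions_def mem_Collect_eq)
    have lin: "frechet_derivative \<phi> (at x) (s *\<^sub>R (b - b'))
       = s * (frechet_derivative \<phi> (at x) b - frechet_derivative \<phi> (at x) b')" for x
      using bounded_linear.linear[OF has_derivative_bounded_linear[OF Ck_SucD[OF Ck, of x]]]
      by (simp only: linear_cmul linear_diff real_scaleR_def)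
    have "(\<integral>x. frechet_derivative \<phi> (at x) (s *\<^sub>R (b - b')) * v x \<partial>lborel)
      = (\<integral>x. s * (frechet_derivative \<phi> (at x) b * v x - frechet_derivative \<phi> (at x) b' * v x) \<partial>lborel)"
      by (simp only: lin) (simp add: algebra_simps)
    also have "\<dots> = s * ((\<integral>x. frechet_derivative \<phi> (at x) b * v x \<partial>lborel) - (\<integral>x. frechet_derivative \<phi> (at x) b' * v x \<partial>lborel))"
      using I by simp
    also have "\<dots> = - (s * ((\<integral>x. \<phi> x * g x \<partial>lborel) - (\<integral>x. \<phi> x * g' x \<partial>lborel)))"
      using w \<phi> by (simp add: weak_dir_deriv_def algebra_simps)
    also have "\<dots> = - (\<integral>x. s * (\<phi> x * g x - \<phi> x * g' x) \<partial>lborel)"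
      using J by simp
    also have "(\<lambda>x. s * (\<phi> x * g x - \<phi> x * g' x)) = (\<lambda>x. \<phi> x * (s * (g x - g' x)))"
      by (simp add: fun_eq_iff algebra_simps)
    finally show ?thesis .
  qed
  ultimately show ?thesis
    using m i by (simp add: weak_dir_deriv_def)
qed

section \<open>Summation over the pairs of particles\<close>

text \<open>The unit vectors \<open>relative_direction i j k\<close> give \<open>sqdist = r\<^sup>2 / 2\<close> and half of the squared differences
  of partial derivatives, so the constant \<open>d\<^sup>2/4\<close> turns into \<open>d\<^sup>2\<close>.\<close>
lemma hardy_antisymmetric_pair_part:
  fixes u :: "real^'d^'n::finite \<Rightarrow> complex"
  assumes ij: "i \<noteq> j"
    and u: "u \<in> L2" and odd: "AE x in lebesgue. u (swap_particles i j x) = - u x"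
    and Di: "\<And>k. is_weak_partial (axis i (axis k 1)) u (Di k)" "\<And>k. Di k \<in> L2"
    and Dj: "\<And>k. is_weak_partial (axis j (axis k 1)) u (Dj k)" "\<And>k. Dj k \<in> L2"
    and \<Phi>: "bounded_linear \<Phi>" "\<And>z. \<bar>\<Phi> z\<bar> \<le> norm z"
  shows "(\<integral>\<^sup>+x. ennreal ((real CARD('d))\<^sup>2 * ((\<Phi> (u x))\<^sup>2 / (particle_dist i j x)\<^sup>2)) \<partial>lebesgue)
    \<le> (\<Sum>k\<in>UNIV. \<integral>\<^sup>+x. ennreal ((\<Phi> (Di k x - Dj k x))\<^sup>2) \<partial>lebesgue)"
proof -
  interpret \<Phi>: bounded_linear \<Phi> by (rule \<Phi>)
  have \<Phi>m [measurable]: "\<Phi> \<in> borel_measurable borel"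
    by (intro borel_measurable_continuous_onI \<Phi>.continuous_on continuous_on_id)
  have rep: "\<exists>v\<in>borel_measurable borel. AE x in lborel. \<Phi> (f x) = v x" if "f \<in> L2" for f :: "real^'d^'n \<Rightarrow> complex"
  proof -
    have [measurable]: "f \<in> borel_measurable lebesgue" using that by (simp add: L2_def)
    have "(\<lambda>x. \<Phi> (f x)) \<in> borel_measurable lebesgue" by measurable
    from completion_ex_borel_measurable_real[OF this] show ?thesis by simp
  qed
  obtain v where v: "v \<in> borel_measurable borel" "AE x in lborel. \<Phi> (u x) = v x"
    using rep[OF u] by auto
  have "\<forall>k. \<exists>g. g \<in> borel_measurable borel \<and> (AE x in lborel. \<Phi> (Di k x) = g x)"
    using rep[OF Di(2)] by blast
  then obtain gi where gi: "\<And>k. gi k \<in> borel_measurable borel" "\<And>k. AE x in lborel. \<Phi> (Di k x) = gi k x"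
    by metis
  have "\<forall>k. \<exists>g. g \<in> borel_measurable borel \<and> (AE x in lborel. \<Phi> (Dj k x) = g x)"
    using rep[OF Dj(2)] by blast
  then obtain gj where gj: "\<And>k. gj k \<in> borel_measurable borel" "\<And>k. AE x in lborel. \<Phi> (Dj k x) = gj k x"
    by metis
  have [measurable]: "v \<in> borel_measurable borel" "gi k \<in> borel_measurable borel" "gj k \<in> borel_measurable borel" for k
    by (rule v gi gj)+
  let ?e = "relative_direction i j :: 'd \<Rightarrow> real^'d^'n"
  let ?S = "range ?e"
  note S = orthonormal_relative_direction[OF ij, where 'd = 'd]
  note inj = inj_relative_direction[OF ij, where 'd = 'd]
  have card: "card ?S = CARD('d)"
    using inj by (simp add: card_image)
  define g where "g l x = 1 / sqrt 2 * (gi (inv ?e l) x - gj (inv ?e l) x)" for l x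
  have w: "weak_dir_deriv l v (g l)" if "l \<in> ?S" for l
  proof -
    obtain k where k: "l = ?e k" using \<open>l \<in> ?S\<close> by auto
    have "weak_dir_deriv (axis i (axis k 1)) v (gi k)" "weak_dir_deriv (axis j (axis k 1)) v (gj k)"
      by (rule weak_dir_deriv_of_complex[OF Di(1) u Di(2) \<Phi> v gi] weak_dir_deriv_of_complex[OF Dj(1) u Dj(2) \<Phi> v gj])+
    moreover have "g (?e k) = (\<lambda>x. 1 / sqrt 2 * (gi k x - gj k x))"
      by (simp add: g_def fun_eq_iff inv_f_f[OF inj])
    ultimately show ?thesis
      using weak_dir_deriv_scaled_diff[of _ v "gi k" _ "gj k" "1 / sqrt 2"]
      unfolding k by (simp only:) (simp only: relative_direction_def)
  qed
  have v2: "integrable lborel (\<lambda>x. (v x)\<^sup>2)"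
    using w[of "?e k" for k] by (auto simp: weak_dir_deriv_def)
  note inv' = distr_reflect_relative_direction[OF ij, where 'd = 'd]
  have oddv: "AE z in lborel. v (reflect ?S z) = - v z"
  proof -
    have d: "distr lborel borel (reflect ?S) = lborel"
      by (rule distr_reflect[OF S subset_refl inv'])
    have "AE z in distr lborel borel (reflect ?S). \<Phi> (u z) = v z"
      unfolding d by (rule v(2))
    then have "AE z in lborel. \<Phi> (u (reflect ?S z)) = v (reflect ?S z)"
      by (rule AE_distrD[rotated]) measurable
    moreover have "AE z in lborel. u (reflect ?S z) = - u z"
      using odd by (simp add: reflect_relative_direction[OF ij] AE_completion_iff)
    ultimately show ?thesis
      using v(2)
    proof eventually_elim
      case (elim z)
      then show ?case by (metis \<Phi>.neg)
    qed
  qed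
  note H = hardy_weak[OF S inv' v(1) v2 w oddv]
  have "(\<integral>\<^sup>+x. ennreal ((real CARD('d))\<^sup>2 * ((\<Phi> (u x))\<^sup>2 / (particle_dist i j x)\<^sup>2)) \<partial>lebesgue)
    = (\<integral>\<^sup>+x. ennreal ((real CARD('d))\<^sup>2 * ((\<Phi> (u x))\<^sup>2 / (particle_dist i j x)\<^sup>2)) \<partial>lborel)"
    by (rule nn_integral_completion)
  also have "\<dots> = (\<integral>\<^sup>+x. ennreal 2 * ennreal ((real (card ?S))\<^sup>2 / 4 * ((v x)\<^sup>2 / sqdist ?S x)) \<partial>lborel)"
  proof (rule nn_integral_cong_AE)
    have "ennreal ((real CARD('d))\<^sup>2 * ((v x)\<^sup>2 / (particle_dist i j x)\<^sup>2))
        = ennreal 2 * ennreal ((real (card ?S))\<^sup>2 / 4 * ((v x)\<^sup>2 / sqdist ?S x))" for x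
      unfolding sqdist_relative_direction[OF ij] card
      by (subst ennreal_mult[symmetric]) (auto intro!: arg_cong[where f = ennreal] simp: field_simps)
    then show "AE x in lborel. ennreal ((real CARD('d))\<^sup>2 * ((\<Phi> (u x))\<^sup>2 / (particle_dist i j x)\<^sup>2))
        = ennreal 2 * ennreal ((real (card ?S))\<^sup>2 / 4 * ((v x)\<^sup>2 / sqdist ?S x))"
      using v(2) by auto
  qed
  also have "\<dots> = ennreal 2 * (\<integral>\<^sup>+x. ennreal ((real (card ?S))\<^sup>2 / 4 * ((v x)\<^sup>2 / sqdist ?S x)) \<partial>lborel)"
  proof (rule nn_integral_cmult)
    have [measurable]: "sqdist ?S \<in> borel_measurable borel"
      by (intro borel_measurable_continuous_onI continuous_on_sqdist continuous_on_id)
    show "(\<lambda>x. ennreal ((real (card ?S))\<^sup>2 / 4 * ((v x)\<^sup>2 / sqdist ?S x))) \<in> borel_measurable lborel"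
      by measurable
  qed
  also have "\<dots> \<le> ennreal 2 * (\<Sum>l\<in>?S. \<integral>\<^sup>+x. ennreal ((g l x)\<^sup>2) \<partial>lborel)"
    by (intro mult_left_mono H) auto
  also have "\<dots> = (\<Sum>k\<in>UNIV. ennreal 2 * (\<integral>\<^sup>+x. ennreal ((g (?e k) x)\<^sup>2) \<partial>lborel))"
    using inj by (simp add: sum.reindex sum_distrib_left)
  also have "\<dots> = (\<Sum>k\<in>UNIV. \<integral>\<^sup>+x. ennreal ((\<Phi> (Di k x - Dj k x))\<^sup>2) \<partial>lebesgue)"
  proof (rule sum.cong[OF refl])
    fix k
    have "ennreal 2 * (\<integral>\<^sup>+x. ennreal ((g (?e k) x)\<^sup>2) \<partial>lborel) = (\<integral>\<^sup>+x. ennreal 2 * ennreal ((g (?e k) x)\<^sup>2) \<partial>lborel)"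
      unfolding g_def by (rule nn_integral_cmult[symmetric]) measurable
    also have "\<dots> = (\<integral>\<^sup>+x. ennreal ((\<Phi> (Di k x - Dj k x))\<^sup>2) \<partial>lborel)"
    proof (rule nn_integral_cong_AE)
      have eq: "ennreal 2 * ennreal ((g (?e k) x)\<^sup>2) = ennreal ((gi k x - gj k x)\<^sup>2)" for x
        by (subst ennreal_mult[symmetric])
           (auto intro!: arg_cong[where f = ennreal] simp: g_def inv_f_f[OF inj] power_mult_distrib power_divide)
      show "AE x in lborel. ennreal 2 * ennreal ((g (?e k) x)\<^sup>2) = ennreal ((\<Phi> (Di k x - Dj k x))\<^sup>2)"
        using gi(2)[of k] gj(2)[of k] by eventually_elim (simp only: eq \<Phi>.diff)
    qed
    finally show "ennreal 2 * (\<integral>\<^sup>+x. ennreal ((g (?e k) x)\<^sup>2) \<partial>lborel) = (\<integral>\<^sup>+x. ennreal ((\<Phi> (Di k x - Dj k x))\<^sup>2) \<partial>lebesgue)"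
      by (simp add: nn_integral_completion)
  qed
  finally show ?thesis .
qed

lemma borel_measurable_particle_dist [measurable]:
  "(particle_dist i j :: real^'d^'n \<Rightarrow> real) \<in> borel_measurable lebesgue"
proof (intro measurable_completion)
  have "continuous_on UNIV (particle_dist i j :: real^'d^'n \<Rightarrow> real)"
    unfolding particle_dist_def by (intro continuous_intros)
  then show "(particle_dist i j :: real^'d^'n \<Rightarrow> real) \<in> borel_measurable lborel"
    using borel_measurable_continuous_onI by simp
qed

lemma hardy_antisymmetric_pair:
  fixes u :: "real^'d^'n::finite \<Rightarrow> complex"
  assumes ij: "i \<noteq> j"
    and u: "u \<in> L2" and odd: "AE x in lebesgue. u (swap_particles i j x) = - u x"
    and Di: "\<And>k. is_weak_partial (axis i (axis k 1)) u (Di k)" "\<And>k. Di k \<in> L2"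
    and Dj: "\<And>k. is_weak_partial (axis j (axis k 1)) u (Dj k)" "\<And>k. Dj k \<in> L2"
  shows "(\<integral>\<^sup>+x. ennreal ((real CARD('d))\<^sup>2 * ((norm (u x))\<^sup>2 / (particle_dist i j x)\<^sup>2)) \<partial>lebesgue)
    \<le> (\<Sum>k\<in>UNIV. \<integral>\<^sup>+x. ennreal ((norm (Di k x - Dj k x))\<^sup>2) \<partial>lebesgue)"
proof -
  let ?d = "(real CARD('d))\<^sup>2"
  have [measurable]: "u \<in> borel_measurable lebesgue" "Di k \<in> borel_measurable lebesgue"
    "Dj k \<in> borel_measurable lebesgue" for k
    using u Di(2) Dj(2) by (auto simp: L2_def)
  have [measurable]: "(\<lambda>x. Re (f x)) \<in> borel_measurable lebesgue" "(\<lambda>x. Im (f x)) \<in> borel_measurable lebesgue"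
    if "f \<in> borel_measurable lebesgue" for f :: "real^'d^'n \<Rightarrow> complex"
    using that by measurable
  have "(\<integral>\<^sup>+x. ennreal (?d * ((norm (u x))\<^sup>2 / (particle_dist i j x)\<^sup>2)) \<partial>lebesgue)
    = (\<integral>\<^sup>+x. ennreal (?d * ((Re (u x))\<^sup>2 / (particle_dist i j x)\<^sup>2))
        + ennreal (?d * ((Im (u x))\<^sup>2 / (particle_dist i j x)\<^sup>2)) \<partial>lebesgue)"
    by (intro nn_integral_cong) (simp add: cmod_power2 ennreal_plus[symmetric] add_divide_distrib distrib_left del: ennreal_plus)
  also have "\<dots> = (\<integral>\<^sup>+x. ennreal (?d * ((Re (u x))\<^sup>2 / (particle_dist i j x)\<^sup>2)) \<partial>lebesgue)
        + (\<integral>\<^sup>+x. ennreal (?d * ((Im (u x))\<^sup>2 / (particle_dist i j x)\<^sup>2)) \<partial>lebesgue)"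
    by (rule nn_integral_add) measurable
  also have "\<dots> \<le> (\<Sum>k\<in>UNIV. \<integral>\<^sup>+x. ennreal ((Re (Di k x - Dj k x))\<^sup>2) \<partial>lebesgue)
      + (\<Sum>k\<in>UNIV. \<integral>\<^sup>+x. ennreal ((Im (Di k x - Dj k x))\<^sup>2) \<partial>lebesgue)"
    by (intro add_mono hardy_antisymmetric_pair_part[OF ij u odd Di Dj] bounded_linear_Re bounded_linear_Im
        abs_Re_le_cmod abs_Im_le_cmod)
  also have "\<dots> = (\<Sum>k\<in>UNIV. \<integral>\<^sup>+x. ennreal ((norm (Di k x - Dj k x))\<^sup>2) \<partial>lebesgue)"
    unfolding sum.distrib[symmetric]
  proof (rule sum.cong[OF refl])
    fix k
    have "(\<integral>\<^sup>+x. ennreal ((Re (Di k x - Dj k x))\<^sup>2) \<partial>lebesgue) + (\<integral>\<^sup>+x. ennreal ((Im (Di k x - Dj k x))\<^sup>2) \<partial>lebesgue)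
      = (\<integral>\<^sup>+x. ennreal ((Re (Di k x - Dj k x))\<^sup>2) + ennreal ((Im (Di k x - Dj k x))\<^sup>2) \<partial>lebesgue)"
      by (rule nn_integral_add[symmetric]) measurable
    also have "\<dots> = (\<integral>\<^sup>+x. ennreal ((norm (Di k x - Dj k x))\<^sup>2) \<partial>lebesgue)"
      by (intro nn_integral_cong) (simp add: cmod_power2 ennreal_plus[symmetric] del: ennreal_plus)
    finally show "(\<integral>\<^sup>+x. ennreal ((Re (Di k x - Dj k x))\<^sup>2) \<partial>lebesgue) + (\<integral>\<^sup>+x. ennreal ((Im (Di k x - Dj k x))\<^sup>2) \<partial>lebesgue)
      = (\<integral>\<^sup>+x. ennreal ((norm (Di k x - Dj k x))\<^sup>2) \<partial>lebesgue)" .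
  qed
  finally show ?thesis .
qed

lemma sum_pair_differences_le:
  fixes z :: "'n::{finite, linorder} \<Rightarrow> 'a::real_inner"
  shows "(\<Sum>(i, j) | i < j. (norm (z i - z j))\<^sup>2) \<le> real CARD('n) * (\<Sum>i\<in>UNIV. (norm (z i))\<^sup>2)"
proof -
  let ?f = "\<lambda>(i, j). (norm (z i - z j))\<^sup>2"
  have sym: "sum ?f {(i, j). j < i} = sum ?f {(i, j). i < j}"
    by (rule sum.reindex_bij_witness[of _ prod.swap prod.swap]) (auto simp: norm_minus_commute)
  have split: "(UNIV :: ('n \<times> 'n) set) = ({(i, j). i < j} \<union> {(i, j). j < i}) \<union> {(i, j). i = j}"
    by auto
  have "sum ?f UNIV = sum ?f {(i, j). i < j} + sum ?f {(i, j). j < i} + sum ?f {(i, j). i = j}"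
    by (subst split) (subst sum.union_disjoint; (subst sum.union_disjoint)?; auto)
  also have "sum ?f {(i, j). i = j} = 0"
    by (intro sum.neutral) auto
  finally have "2 * sum ?f {(i, j). i < j} = sum ?f UNIV"
    using sym by simp
  also have "\<dots> = (\<Sum>i\<in>UNIV. \<Sum>j\<in>UNIV. (norm (z i))\<^sup>2 + (norm (z j))\<^sup>2 - 2 * (z i \<bullet> z j))"
    unfolding UNIV_Times_UNIV[symmetric] sum.cartesian_product[symmetric]
    by (simp add: power2_norm_eq_inner inner_diff_left inner_diff_right inner_commute algebra_simps)
  also have "\<dots> = 2 * (real CARD('n) * (\<Sum>i\<in>UNIV. (norm (z i))\<^sup>2)) - 2 * ((\<Sum>i\<in>UNIV. z i) \<bullet> (\<Sum>j\<in>UNIV. z j))"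
    by (simp add: sum.distrib sum_subtractf inner_sum_left inner_sum_right sum_distrib_left) (rule sum.swap)
  also have "\<dots> \<le> 2 * (real CARD('n) * (\<Sum>i\<in>UNIV. (norm (z i))\<^sup>2))"
    by simp
  finally show ?thesis by simp
qed

theorem theorem2p8:
  fixes u :: "real^'d^'n::{finite,linorder} \<Rightarrow> complex"
  assumes "CARD('n) \<ge> 2"
    and "u \<in> H1"
    and "antisymmetric u"
  shows "(\<Sum>j\<in>UNIV. \<integral>\<^sup>+x. ennreal ((norm (particle_grad j u x))\<^sup>2) \<partial>lebesgue) \<ge>
    ennreal ((real CARD('d))\<^sup>2 / real CARD('n)) *
      (\<Sum>(i, j) | i < j. \<integral>\<^sup>+x. ennreal ((norm (u x))\<^sup>2 / (particle_dist i j x)\<^sup>2) \<partial>lebesgue)"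
proof (cases "(\<Sum>j\<in>UNIV. \<integral>\<^sup>+x. ennreal ((norm (particle_grad j u x))\<^sup>2) \<partial>lebesgue) = \<infinity>")
  case True
  then show ?thesis
    by (simp only: True infinity_ennreal_def top_greatest)
next
  case False
  define D where "D j k = weak_partial (axis j (axis k 1)) u" for j k
  have u: "u \<in> L2" using assms(2) by (simp add: H1_def)
  have D: "is_weak_partial (axis j (axis k 1)) u (D j k)" for j k
  proof -
    have "\<exists>g. is_weak_partial (axis j (axis k 1)) u g"
      using assms(2) axis_axis_Basis[of j k] unfolding H1_def by blast
    then show ?thesis
      unfolding D_def weak_partial_def by (rule someI_ex)
  qed
  \<comment> \<open>Local integrability, which is part of being a weak derivative, implies measurability.\<close>
  have Dm [measurable]: "D j k \<in> borel_measurable lebesgue" for j k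
  proof (rule borel_measurable_LIMSEQ_metric)
    have loc: "locally_integrable (D j k)" using D by (simp add: is_weak_partial_def)
    show "(\<lambda>x. indicator (cball 0 (real n)) x *\<^sub>R D j k x) \<in> borel_measurable lebesgue" for n
      using loc unfolding locally_integrable_def set_integrable_def
      by (intro borel_measurable_integrable) auto
    show "(\<lambda>n. indicator (cball 0 (real n)) x *\<^sub>R D j k x) \<longlonglongrightarrow> D j k x" for x
    proof (rule tendsto_eventually)
      obtain m where "norm x \<le> real m" using real_arch_simple by auto
      then show "\<forall>\<^sub>F n in sequentially. indicator (cball 0 (real n)) x *\<^sub>R D j k x = D j k x"
        by (auto simp: eventually_sequentially indicator_def intro!: exI[of _ m])
    qed
  qed
  have grad: "(norm (particle_grad j u x))\<^sup>2 = (\<Sum>k\<in>UNIV. (norm (D j k x))\<^sup>2)" for j x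
    by (simp add: particle_grad_def D_def norm_vec_def L2_set_def sum_nonneg)
  \<comment> \<open>If the left-hand side is finite, the chosen weak derivatives are square integrable; no uniqueness
    of weak derivatives is needed.\<close>
  have fin: "(\<integral>\<^sup>+x. ennreal ((norm (D j k x))\<^sup>2) \<partial>lebesgue) < \<infinity>" for j k
  proof -
    have "(\<integral>\<^sup>+x. ennreal ((norm (D j k x))\<^sup>2) \<partial>lebesgue) \<le> (\<integral>\<^sup>+x. ennreal ((norm (particle_grad j u x))\<^sup>2) \<partial>lebesgue)"
      unfolding grad by (intro nn_integral_mono ennreal_leI member_le_sum) auto
    also have "\<dots> < \<infinity>"
      using False by (simp add: less_top)
    finally show ?thesis .
  qed
  have D2: "D j k \<in> L2" for j k
    unfolding L2_def using fin[of j k] by (auto intro!: integrableI_bounded)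
  let ?N = "real CARD('n)"
  let ?W = "\<lambda>i j. \<integral>\<^sup>+x. ennreal ((norm (u x))\<^sup>2 / (particle_dist i j x)\<^sup>2) \<partial>lebesgue"
  have [measurable]: "u \<in> borel_measurable lebesgue" using u by (simp add: L2_def)
  have "(\<Sum>(i, j) | i < j. \<Sum>k\<in>UNIV. \<integral>\<^sup>+x. ennreal ((norm (D i k x - D j k x))\<^sup>2) \<partial>lebesgue)
    = (\<integral>\<^sup>+x. ennreal (\<Sum>k\<in>UNIV. \<Sum>(i, j) | i < j. (norm (D i k x - D j k x))\<^sup>2) \<partial>lebesgue)"
  proof -
    let ?f = "\<lambda>k p x. (norm (D (fst p) k x - D (snd p) k x))\<^sup>2"
    have m: "(\<lambda>x. ennreal (?f k p x)) \<in> borel_measurable lebesgue" for k p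
      by measurable
    have "(\<integral>\<^sup>+x. ennreal (\<Sum>k\<in>UNIV. \<Sum>p | fst p < snd p. ?f k p x) \<partial>lebesgue)
        = (\<integral>\<^sup>+x. (\<Sum>k\<in>UNIV. \<Sum>p | fst p < snd p. ennreal (?f k p x)) \<partial>lebesgue)"
      by (simp add: sum_nonneg)
    also have "\<dots> = (\<Sum>k\<in>UNIV. \<integral>\<^sup>+x. (\<Sum>p | fst p < snd p. ennreal (?f k p x)) \<partial>lebesgue)"
      by (intro nn_integral_sum borel_measurable_sum m)
    also have "\<dots> = (\<Sum>k\<in>UNIV. \<Sum>p | fst p < snd p. \<integral>\<^sup>+x. ennreal (?f k p x) \<partial>lebesgue)"
      by (intro sum.cong refl nn_integral_sum m)
    also have "\<dots> = (\<Sum>p | fst p < snd p. \<Sum>k\<in>UNIV. \<integral>\<^sup>+x. ennreal (?f k p x) \<partial>lebesgue)"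
      by (rule sum.swap)
    finally show ?thesis
      by (simp only: case_prod_unfold)
  qed
  also have "\<dots> \<le> (\<integral>\<^sup>+x. ennreal (\<Sum>k\<in>UNIV. ?N * (\<Sum>j\<in>UNIV. (norm (D j k x))\<^sup>2)) \<partial>lebesgue)"
    by (intro nn_integral_mono ennreal_leI sum_mono sum_pair_differences_le)
  also have "\<dots> = (\<integral>\<^sup>+x. ennreal ?N * (\<Sum>j\<in>UNIV. ennreal ((norm (particle_grad j u x))\<^sup>2)) \<partial>lebesgue)"
  proof (intro nn_integral_cong)
    fix x
    have "(\<Sum>k\<in>UNIV. ?N * (\<Sum>j\<in>UNIV. (norm (D j k x))\<^sup>2)) = ?N * (\<Sum>j\<in>UNIV. (norm (particle_grad j u x))\<^sup>2)"
      unfolding grad sum_distrib_left[symmetric] by (subst sum.swap) simp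
    then show "ennreal (\<Sum>k\<in>UNIV. ?N * (\<Sum>j\<in>UNIV. (norm (D j k x))\<^sup>2))
        = ennreal ?N * (\<Sum>j\<in>UNIV. ennreal ((norm (particle_grad j u x))\<^sup>2))"
      by (simp add: ennreal_mult sum_nonneg sum_ennreal)
  qed
  also have "\<dots> = ennreal ?N * (\<Sum>j\<in>UNIV. \<integral>\<^sup>+x. ennreal ((norm (particle_grad j u x))\<^sup>2) \<partial>lebesgue)"
  proof -
    have m: "(\<lambda>x. ennreal ((norm (particle_grad j u x))\<^sup>2)) \<in> borel_measurable lebesgue" for j
      unfolding grad by measurable
    show ?thesis
      by (simp only: nn_integral_cmult[OF borel_measurable_sum[OF m]] nn_integral_sum[OF m])
  qed
  finally have key: "(\<Sum>(i, j) | i < j. \<Sum>k\<in>UNIV. \<integral>\<^sup>+x. ennreal ((norm (D i k x - D j k x))\<^sup>2) \<partial>lebesgue)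
    \<le> ennreal ?N * (\<Sum>j\<in>UNIV. \<integral>\<^sup>+x. ennreal ((norm (particle_grad j u x))\<^sup>2) \<partial>lebesgue)" .
  have "ennreal ((real CARD('d))\<^sup>2 / ?N) * (\<Sum>(i, j) | i < j. ?W i j)
    = ennreal (1 / ?N) * (\<Sum>(i, j) | i < j. ennreal ((real CARD('d))\<^sup>2) * ?W i j)"
    by (simp add: sum_distrib_left case_prod_unfold mult.assoc[symmetric] ennreal_mult[symmetric])
  also have "\<dots> \<le> ennreal (1 / ?N) * (\<Sum>(i, j) | i < j. \<Sum>k\<in>UNIV. \<integral>\<^sup>+x. ennreal ((norm (D i k x - D j k x))\<^sup>2) \<partial>lebesgue)"
  proof (intro mult_left_mono sum_mono)
    fix p :: "'n \<times> 'n" assume "p \<in> {(i, j). i < j}"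
    then obtain i j where p: "p = (i, j)" "i < j" by auto
    have "ennreal ((real CARD('d))\<^sup>2) * ?W i j
      = (\<integral>\<^sup>+x. ennreal ((real CARD('d))\<^sup>2 * ((norm (u x))\<^sup>2 / (particle_dist i j x)\<^sup>2)) \<partial>lebesgue)"
      by (subst nn_integral_cmult[symmetric], measurable)
         (intro nn_integral_cong ennreal_mult[symmetric], auto)
    also have "\<dots> \<le> (\<Sum>k\<in>UNIV. \<integral>\<^sup>+x. ennreal ((norm (D i k x - D j k x))\<^sup>2) \<partial>lebesgue)"
      using assms(3) p(2) by (intro hardy_antisymmetric_pair u D D2) (auto simp: antisymmetric_def)
    finally show "(case p of (i, j) \<Rightarrow> ennreal ((real CARD('d))\<^sup>2) * ?W i j)
      \<le> (case p of (i, j) \<Rightarrow> \<Sum>k\<in>UNIV. \<integral>\<^sup>+x. ennreal ((norm (D i k x - D j k x))\<^sup>2) \<partial>lebesgue)"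
      by (simp add: p)
  qed auto
  also have "\<dots> \<le> ennreal (1 / ?N) * (ennreal ?N * (\<Sum>j\<in>UNIV. \<integral>\<^sup>+x. ennreal ((norm (particle_grad j u x))\<^sup>2) \<partial>lebesgue))"
    by (intro mult_left_mono key) auto
  also have "ennreal (1 / ?N) * (ennreal ?N * E) = E" for E
    by (simp add: mult.assoc[symmetric] ennreal_mult[symmetric])
  finally show ?thesis .
qed

end
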